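(* Assume the standing assumptions (A) on $W$, let $\chi>0$, and assume $p_\chi^+<\infty$, $p_\chi^->-\infty$ and $\tau(p_\chi^+)>0$. Let $h\in(h_\chi^+,h_\chi^-)$ and, for $\varepsilon>0$ and $j\ge0$, let $$C_j(\varepsilon)=\#\big\{k\in\{0,\dots,N-1\}: 2^{-j(h+\varepsilon)}\le\tilde\mu(I_{j,k})\le 2^{-j(h-\varepsilon)}\big\}.$$ Then almost surely $$\lim_{\varepsilon\to0}\liminf_{j\to\infty}\frac1j\log_2 C_j(\varepsilon)=\chi+D(h)\quad\text{and}\quad\lim_{\varepsilon\to0}\limsup_{j\to\infty}\frac1j\log_2 C_j(\varepsilon)=\chi+D(h).$$
   Context: Let $W$ be a real random variable and fix $T>0$. Standing assumptions (A): $\mathbb E[W]=1$, $\mathbb E[W\log_2 W]<1$, $\mathbb P(W=1)<1$, $\mathbb P(W>0)=1$, and $\mathbb E[W^p]<\infty$ for all $p\in\mathbb R$. Define $\tau(p)=p-\log_2\mathbb E[W^p]-1$ and its Legendre transform $D(h)=\inf_{p\in\mathbb R}(ph-\tau(p))$. For words $r=(r_1,\dots,r_j)\in\{0,1\}^j$ write $r|i=(r_1,\dots,r_i)$ and $\bar r=2^j\sum_{i=1}^j r_i2^{-i}$ ($\bar r=0$ for the empty word). Let $I_{j,k}=[k2^{-j}T,(k+1)2^{-j}T]$. Given i.i.d. copies $(W_r)$ of $W$ indexed by nonempty finite words, the cascade measure $\mu_\infty$ on $[0,T]$ is the almost sure weak limit of the measures $\mu_j$ with density $\prod_{i=1}^jW_{r|i}$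 on $I_{j,\bar r}$, $r\in\{0,1\}^j$. Mixed asymptotics: $(\mu^{(m)}_\infty)_{m\ge0}$ are i.i.d. cascade measures on $[0,T]$ (built from independent families of i.i.d. copies of $W$); $\tilde\mu(A)=\sum_{m\ge0}\mu^{(m)}_\infty((A-mT)\cap[0,T])$ on $[0,\infty)$. For $\chi>0$ and $j\ge0$: $N_T=\lfloor 2^{j\chi}\rfloor$, $N=N_T2^j$. Critical exponents: $p_\chi^+=\inf\{p\ge1: p\tau'(p)-\tau(p)\le-\chi\}\in(1,+\infty]$, $p_\chi^-=\sup\{p\le0: p\tau'(p)-\tau(p)\le-\chi\}\in[-\infty,0)$ (with $\inf\emptyset=+\infty$, $\sup\emptyset=-\infty$); when finite, $h_\chi^\pm=\tau'(p_\chi^\pm)$. *)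

theory Defs
  imports "HOL-Probability.Probability"
begin

definition standing_assumptions :: "'a measure \<Rightarrow> ('a \<Rightarrow> real) \<Rightarrow> bool" where
  "standing_assumptions M W \<longleftrightarrow>
     W \<in> borel_measurable M \<and>
     integrable M W \<and> (\<integral>\<omega>. W \<omega> \<partial>M) = 1 \<and>
     integrable M (\<lambda>\<omega>. W \<omega> * log 2 (W \<omega>)) \<and> (\<integral>\<omega>. W \<omega> * log 2 (W \<omega>) \<partial>M) < 1 \<and>
     measure M {\<omega>\<in>space M. W \<omega> = 1} < 1 \<and>
     measure M {\<omega>\<in>space M. W \<omega> > 0} = 1 \<and>
     (\<forall>p::real. integrable M (\<lambda>\<omega>. W \<omega> powr p))"

definition tau :: "'a measure \<Rightarrow> ('a \<Rightarrow> real) \<Rightarrow> real \<Rightarrow> real" where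
  "tau M W p = p - log 2 (\<integral>\<omega>. W \<omega> powr p \<partial>M) - 1"

definition Dspec :: "'a measure \<Rightarrow> ('a \<Rightarrow> real) \<Rightarrow> real \<Rightarrow> ereal" where
  "Dspec M W h = (INF p. ereal (p * h - tau M W p))"

(* critical exponents, with inf {} = +infinity and sup {} = -infinity *)
definition p_plus :: "'a measure \<Rightarrow> ('a \<Rightarrow> real) \<Rightarrow> real \<Rightarrow> ereal" where
  "p_plus M W chi = Inf (ereal ` {p. p \<ge> 1 \<and> p * deriv (tau M W) p - tau M W p \<le> - chi})"

definition p_minus :: "'a measure \<Rightarrow> ('a \<Rightarrow> real) \<Rightarrow> real \<Rightarrow> ereal" where
  "p_minus M W chi = Sup (ereal ` {p. p \<le> 0 \<and> p * deriv (tau M W) p - tau M W p \<le> - chi})"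

(* the word r in {0,1}^j with rbar = k (true = digit 1), r_i = i-th binary digit of k *)
definition dyadic_word :: "nat \<Rightarrow> nat \<Rightarrow> bool list" where
  "dyadic_word j k = map (\<lambda>i. odd (k div 2 ^ (j - i))) [1..<Suc j]"

(* density of mu_j on [0,T]: on I_{j,rbar} it equals prod_{i=1}^j W_{r|i} *)
definition cascade_density :: "real \<Rightarrow> (bool list \<Rightarrow> real) \<Rightarrow> nat \<Rightarrow> real \<Rightarrow> real" where
  "cascade_density T w j x =
     (if 0 \<le> x \<and> x \<le> T
      then (\<Prod>i\<in>{1..j}. w (take i (dyadic_word j (nat \<lfloor>x * 2 ^ j / T\<rfloor>))))
      else 0)"

definition cascade_approx :: "real \<Rightarrow> (bool list \<Rightarrow> real) \<Rightarrow> nat \<Rightarrow> real measure" where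
  "cascade_approx T w j = density lborel (\<lambda>x. ennreal (cascade_density T w j x))"

definition weak_conv_fin :: "(nat \<Rightarrow> real measure) \<Rightarrow> real measure \<Rightarrow> bool" where
  "weak_conv_fin Ms L \<longleftrightarrow>
     (\<forall>f::real \<Rightarrow> real. continuous_on UNIV f \<and> bounded (range f) \<longrightarrow>
        (\<lambda>n. \<integral>x. f x \<partial>Ms n) \<longlonglongrightarrow> (\<integral>x. f x \<partial>L))"

definition dyadic_interval :: "real \<Rightarrow> nat \<Rightarrow> nat \<Rightarrow> real set" where
  "dyadic_interval T j k = {real k * T / 2 ^ j .. (real k + 1) * T / 2 ^ j}"

definition mu_tilde :: "real \<Rightarrow> (nat \<Rightarrow> real measure) \<Rightarrow> real set \<Rightarrow> ennreal" where
  "mu_tilde T mus A = (\<Sum>m. emeasure (mus m) ((\<lambda>x. x - real m * T) ` A \<inter> {0..T}))"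

definition N_mixed :: "real \<Rightarrow> nat \<Rightarrow> nat" where
  "N_mixed chi j = nat \<lfloor>2 powr (real j * chi)\<rfloor> * 2 ^ j"

definition count_C :: "real \<Rightarrow> (nat \<Rightarrow> real measure) \<Rightarrow> real \<Rightarrow> real \<Rightarrow> real \<Rightarrow> nat \<Rightarrow> nat" where
  "count_C T mus chi h \<epsilon> j = card {k \<in> {0..<N_mixed chi j}.
      ennreal (2 powr (- (real j * (h + \<epsilon>)))) \<le> mu_tilde T mus (dyadic_interval T j k) \<and>
      mu_tilde T mus (dyadic_interval T j k) \<le> ennreal (2 powr (- (real j * (h - \<epsilon>))))}"

definition elog2 :: "nat \<Rightarrow> ereal" where
  "elog2 n = (if n = 0 then - \<infinity> else ereal (log 2 (real n)))"

end

theory Submission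
  imports Defs
begin

text \<open>
  Above an interval of level \<open>j\<close> the cascade is a product of the weights on the path to it times an
  independent copy \<open>Y\<close> of the total mass, which satisfies a two-fold distributional fixed point
  equation. From the equation, \<open>Y\<close> has all moments of order \<open>s \<le> p\<^sup>+\<close>: the positive ones because
  \<open>\<tau>(s) > 0\<close>, the negative ones by a bootstrap that starts from a Paley--Zygmund estimate.

  Choose \<open>p\<close> between the critical exponents with \<open>\<tau>'(p) = h\<close>, so that \<open>D(h) = p h - \<tau>(p)\<close>. Taking
  expectations, the sum of \<open>\<mu>(I)\<^sup>q\<close> over all intervals of level \<open>j\<close> is at most of order
  \<open>2 powr (j (\<chi> - \<tau>(q)))\<close> almost surely. For \<open>q = p\<close> this is also a lower bound: the normalised sums of the
  individual cascades satisfy a recursion which bounds their moment of order \<open>1 + \<eta>\<close> by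
  \<open>2 powr (j \<eta> \<beta>)\<close> with \<open>\<beta> < \<chi>\<close>, precisely because \<open>p \<tau>'(p) - \<tau>(p) > - \<chi>\<close>; hence truncation at
  a level below the number of independent cascades loses little mass, and an exponential Chebyshev bound applies.
  Comparing the sums of orders \<open>p\<close> and \<open>p \<plusminus> \<eta>\<close> localises the mass at \<open>\<mu>(I) \<approx> 2 powr (- j h)\<close>.
\<close>

section \<open>The scaling function\<close>

text \<open>The limit measures enter through the assumed weak convergence, so convergence of the
  total mass is extracted from it. Weak limits determine the mass of an interval only if its end
  points carry none; this comes from first moments, since the two cells of level i next to a dyadic
  point have expected mass of order 2^(-i). The convergence found on the original space is carried
  to the canonical tree by equality in law, and moment bounds at finite levels, uniform in the
  level, pass to the limit by Fatou.

  The obstacle in the lower bound is that the normalised sum of order p may have no bounded moment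
  beyond the first. The growth of such a moment is harmless as long as it is slower than that of the
  number of cascades. The moment of order 1 + \<eta> of that sum involves moments of Y of order p (1
  + \<eta>), where the strict inequality p < P is used. Finally, the orders q that are compared run
  through a countable set, because each q brings its own null set.\<close>

lemma exp_diff_quot_le:
  fixes x t :: real
  assumes "\<bar>t\<bar> \<le> 1" "t \<noteq> 0"
  shows "\<bar>(exp (t * x) - 1) / t\<bar> \<le> exp (2 * x) + exp (- 2 * x)"
proof -
  have "\<bar>exp y - 1\<bar> \<le> \<bar>y\<bar> * exp \<bar>y\<bar>" for y :: real
  proof (cases "0 \<le> y")
    case True
    have "1 - y \<le> exp (- y)"
      using exp_ge_add_one_self[of "-y"] by simp
    then have "(1 - y) * exp y \<le> exp (- y) * exp y"
      by (intro mult_right_mono) auto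
    then show ?thesis
      using True by (simp add: exp_minus algebra_simps)
  next
    case False
    have "1 + y \<le> exp y" "exp y \<le> 1"
      using False exp_ge_add_one_self[of y] by auto
    moreover have "- y * 1 \<le> - y * exp (- y)"
      using False by (intro mult_left_mono) auto
    moreover have "\<bar>exp y - 1\<bar> \<le> - y"
      using calculation by linarith
    moreover have "- y * exp (- y) = \<bar>y\<bar> * exp \<bar>y\<bar>"
      using False by simp
    ultimately show ?thesis
      by linarith
  qed
  from this[of "t * x"] have "\<bar>(exp (t * x) - 1) / t\<bar> \<le> \<bar>t * x\<bar> * exp \<bar>t * x\<bar> / \<bar>t\<bar>"
    by (simp add: divide_right_mono)
  also have "\<dots> = \<bar>x\<bar> * exp \<bar>t * x\<bar>"
    using assms by (simp add: abs_mult)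
  also have "\<dots> \<le> exp \<bar>x\<bar> * exp \<bar>x\<bar>"
  proof (intro mult_mono)
    show "\<bar>x\<bar> \<le> exp \<bar>x\<bar>"
      using exp_ge_add_one_self[of "\<bar>x\<bar>"] by linarith
    have "\<bar>t\<bar> * \<bar>x\<bar> \<le> 1 * \<bar>x\<bar>"
      using assms by (intro mult_right_mono) auto
    then show "exp \<bar>t * x\<bar> \<le> exp \<bar>x\<bar>"
      by (simp add: abs_mult)
  qed auto
  also have "\<dots> = exp (2 * \<bar>x\<bar>)"
    by (simp flip: exp_add)
  also have "\<dots> \<le> exp (2 * x) + exp (- 2 * x)"
    by (cases "0 \<le> x") auto
  finally show ?thesis .
qed

text \<open>Dominating function for differentiating the moments under the integral: it does not
  depend on t, and it is integrable because all real moments of the weight are finite.\<close>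

lemma powr_diff_quot_le:
  fixes x p t :: real
  assumes "0 < x" "\<bar>t\<bar> \<le> 1" "t \<noteq> 0"
  shows "\<bar>(x powr (p + t) - x powr p) / t\<bar> \<le> x powr (p + 2) + x powr (p - 2)"
proof -
  have "(x powr (p + t) - x powr p) / t = x powr p * ((exp (t * ln x) - 1) / t)"
    using assms by (simp add: powr_def exp_add algebra_simps)
  also have "\<bar>\<dots>\<bar> \<le> x powr p * (exp (2 * ln x) + exp (- 2 * ln x))"
    unfolding abs_mult using exp_diff_quot_le[OF assms(2,3), of "ln x"] by (intro mult_mono) auto
  also have "\<dots> = x powr (p + 2) + x powr (p - 2)"
    using assms by (simp add: powr_def exp_add exp_diff algebra_simps exp_minus divide_inverse)
  finally show ?thesis .
qed

text \<open>The weight is represented by its law \<open>\<nu>\<close>, with the identity as random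
  variable; moments, critical exponents and spectrum depend on the law alone.\<close>

locale cascade_weight = prob_space \<nu> for \<nu> :: "real measure" +
  assumes sets_weight [measurable_cong]: "sets \<nu> = sets borel"
    and weight_pos: "AE x in \<nu>. 0 < x"
    and weight_mean: "(\<integral>x. x \<partial>\<nu>) = 1"
    and weight_moments: "\<And>p. integrable \<nu> (\<lambda>x. x powr p)"
begin

definition moment :: "real \<Rightarrow> real" where
  "moment p = (\<integral>x. x powr p \<partial>\<nu>)"

definition log_moment :: "real \<Rightarrow> real" where
  "log_moment p = (\<integral>x. x powr p * ln x \<partial>\<nu>)"

abbreviation scaling :: "real \<Rightarrow> real" where
  "scaling \<equiv> tau \<nu> (\<lambda>x. x)"

lemma scaling_eq: "scaling p = p - log 2 (moment p) - 1"
  by (simp add: tau_def moment_def)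

lemma moment_pos: "0 < moment p"
proof -
  have "moment p \<noteq> 0"
  proof
    assume "moment p = 0"
    then have "AE x in \<nu>. x powr p = 0"
      unfolding moment_def
      by (subst (asm) integral_nonneg_eq_0_iff_AE) (auto intro: weight_moments)
    with weight_pos have "AE x in \<nu>. False"
      by eventually_elim auto
    then show False
      by simp
  qed
  moreover have "0 \<le> moment p"
    unfolding moment_def by (rule integral_nonneg_AE) auto
  ultimately show ?thesis
    by linarith
qed

lemma moment_0: "moment 0 = 1"
proof -
  have "moment 0 = (\<integral>x. 1 \<partial>\<nu>)"
    unfolding moment_def
    by (rule integral_cong_AE) (use weight_pos in \<open>auto elim!: eventually_mono\<close>)
  then show ?thesis
    by (simp add: prob_space)
qed

lemma moment_1: "moment 1 = 1"
proof -
  have "moment 1 = (\<integral>x. x \<partial>\<nu>)"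
    unfolding moment_def
    by (rule integral_cong_AE) (use weight_pos in \<open>auto elim!: eventually_mono\<close>)
  then show ?thesis
    by (simp add: weight_mean)
qed

lemma scaling_1: "scaling 1 = 0"
  by (simp add: scaling_eq moment_1)

text \<open>This is the factor by which the expected sum of p-th powers of path products grows per
  level: two children, each contributing the moment of order p.\<close>

lemma two_moment_eq: "2 * moment p = 2 powr (p - scaling p)"
proof -
  have "2 powr (p - scaling p) = 2 powr (1 + log 2 (moment p))"
    by (simp add: scaling_eq add.commute)
  also have "\<dots> = 2 * moment p"
    by (subst powr_add) (simp add: moment_pos)
  finally show ?thesis ..
qed

text \<open>Differentiation under the integral sign, along sequences, for which dominated
  convergence applies; integrability of the differentiated integrand falls out of the same
  step.\<close>

lemma moment_has_derivative:
  shows integrable_log_moment: "integrable \<nu> (\<lambda>x. x powr p * ln x)"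
    and has_real_derivative_moment: "(moment has_real_derivative log_moment p) (at p)"
proof -
  have *: "integrable \<nu> (\<lambda>x. x powr p * ln x) \<and>
      (\<lambda>i. (moment (p + Y i) - moment p) / Y i) \<longlonglongrightarrow> log_moment p"
    if Y: "\<forall>i. Y i \<noteq> 0" "Y \<longlonglongrightarrow> 0" for Y
  proof -
    obtain N where N: "\<And>i. i \<ge> N \<Longrightarrow> \<bar>Y i\<bar> < 1"
      using Y(2) by (metis LIMSEQ_iff diff_0_right real_norm_def zero_less_one)
    \<comment> \<open>Shifted so that all increments have modulus at most 1, the range in which the
      dominating function is valid.\<close>
    define Z where "Z i = Y (i + N)" for i
    have Z: "Z i \<noteq> 0" "\<bar>Z i\<bar> \<le> 1" for i
      using Y N[of "i + N"] by (auto simp: Z_def)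
    have Zlim: "Z \<longlonglongrightarrow> 0"
      unfolding Z_def using Y(2) by (rule LIMSEQ_ignore_initial_segment)
    let ?q = "\<lambda>i x. (x powr (p + Z i) - x powr p) / Z i"
    have lim: "AE x in \<nu>. (\<lambda>i. ?q i x) \<longlonglongrightarrow> x powr p * ln x"
      using weight_pos
    proof eventually_elim
      case (elim x)
      have "((\<lambda>q. x powr q) has_real_derivative (x powr p * ln x)) (at p)"
        using elim unfolding powr_def by (auto intro!: derivative_eq_intros)
      then have "((\<lambda>t. (x powr (p + t) - x powr p) / t) \<longlongrightarrow> x powr p * ln x) (at 0)"
        by (simp add: DERIV_def)
      then show ?case
        by (rule filterlim_compose) (use Z Zlim in \<open>auto simp: filterlim_at\<close>)
    qed
    have bound: "AE x in \<nu>. norm (?q i x) \<le> x powr (p + 2) + x powr (p - 2)" for i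
      using weight_pos by eventually_elim (use powr_diff_quot_le Z in auto)
    have int: "integrable \<nu> (\<lambda>x. x powr (p + 2) + x powr (p - 2))"
      by (intro Bochner_Integration.integrable_add weight_moments)
    have "integrable \<nu> (\<lambda>x. x powr p * ln x)"
      by (rule integrable_dominated_convergence[OF _ _ int lim bound]) auto
    moreover have "(\<lambda>i. \<integral>x. ?q i x \<partial>\<nu>) \<longlonglongrightarrow> log_moment p"
      unfolding log_moment_def
      by (rule integral_dominated_convergence[OF _ _ int lim bound]) auto
    moreover have "(\<lambda>i. \<integral>x. ?q i x \<partial>\<nu>) = (\<lambda>i. (moment (p + Z i) - moment p) / Z i)"
      unfolding moment_def by (simp add: weight_moments)
    ultimately have "integrable \<nu> (\<lambda>x. x powr p * ln x)"
      "(\<lambda>i. (moment (p + Z i) - moment p) / Z i) \<longlonglongrightarrow> log_moment p"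
      by (simp_all only:)
    then show ?thesis
      unfolding Z_def by (auto intro: LIMSEQ_offset[where k = N])
  qed
  show "integrable \<nu> (\<lambda>x. x powr p * ln x)"
    using *[of "\<lambda>n. 1 / real (Suc n)"] LIMSEQ_Suc[OF lim_1_over_n] by auto
  show "(moment has_real_derivative log_moment p) (at p)"
    unfolding DERIV_def tendsto_at_iff_sequentially
    using * by (auto simp: comp_def)
qed

text \<open>Jensen's inequality for the exponential under the tilted law with density
  \<open>x powr p / moment p\<close>. The number \<open>a\<close> in the proof is the tilted mean of
  \<open>(q - p) * ln x\<close>, and the exponential is bounded below by its tangent at
  \<open>a\<close>.\<close>

lemma moment_tangent: "moment p * exp ((q - p) * (log_moment p / moment p)) \<le> moment q"
proof -
  define a where "a = (q - p) * (log_moment p / moment p)"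
  have "(\<integral>x. exp a * (x powr p * (1 - a) + (q - p) * (x powr p * ln x)) \<partial>\<nu>) \<le> moment q"
    unfolding moment_def
  proof (rule integral_mono_AE)
    show "AE x in \<nu>. exp a * (x powr p * (1 - a) + (q - p) * (x powr p * ln x)) \<le> x powr q"
      using weight_pos
    proof eventually_elim
      case (elim x)
      have "1 + ((q - p) * ln x - a) \<le> exp ((q - p) * ln x - a)"
        by (rule exp_ge_add_one_self)
      then have "exp a * x powr p * (1 + ((q - p) * ln x - a)) \<le>
          exp a * x powr p * exp ((q - p) * ln x - a)"
        by (intro mult_left_mono) auto
      also have "\<dots> = x powr q"
        using elim by (simp add: powr_def flip: exp_add) (simp add: algebra_simps)
      finally show ?case
        by (simp add: algebra_simps)
    qed
  qed (auto intro!: weight_moments integrable_log_moment Bochner_Integration.integrable_add)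
  also have "(\<integral>x. exp a * (x powr p * (1 - a) + (q - p) * (x powr p * ln x)) \<partial>\<nu>) =
      exp a * (moment p * (1 - a) + (q - p) * log_moment p)"
    unfolding moment_def log_moment_def
    by (simp add: weight_moments integrable_log_moment)
  also have "\<dots> = moment p * exp a"
    using moment_pos[of p] by (simp add: a_def field_simps)
  finally show ?thesis
    by (simp add: a_def)
qed

lemma has_real_derivative_scaling:
  "(scaling has_real_derivative deriv scaling p) (at p)"
  and deriv_scaling: "deriv scaling p = 1 - log_moment p / moment p / ln 2"
proof -
  have "((\<lambda>p. p - ln (moment p) / ln 2 - 1) has_real_derivative
      (1 - log_moment p / moment p / ln 2)) (at p)"
    using moment_pos[of p]
    by (auto intro!: derivative_eq_intros has_real_derivative_moment)
  moreover have "scaling = (\<lambda>p. p - ln (moment p) / ln 2 - 1)"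
    by (auto simp: scaling_eq log_def)
  ultimately have *: "(scaling has_real_derivative (1 - log_moment p / moment p / ln 2)) (at p)"
    by simp
  then show "deriv scaling p = 1 - log_moment p / moment p / ln 2"
    by (rule DERIV_imp_deriv)
  with * show "(scaling has_real_derivative deriv scaling p) (at p)"
    by simp
qed

text \<open>Concavity of \<tau>, in the form used from here on: the logarithm of
  \<open>moment_tangent\<close>.\<close>

lemma scaling_tangent: "scaling q \<le> scaling p + deriv scaling p * (q - p)"
proof -
  have "ln (moment p * exp ((q - p) * (log_moment p / moment p))) \<le> ln (moment q)"
    using moment_tangent[of p q] moment_pos[of p] by (simp add: moment_pos)
  then have "ln (moment p) + (q - p) * (log_moment p / moment p) \<le> ln (moment q)"
    using moment_pos[of p] by (simp add: ln_mult)
  then have "(ln (moment p) + (q - p) * (log_moment p / moment p)) / ln 2 \<le> ln (moment q) / ln 2"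
    by (intro divide_right_mono) auto
  then show ?thesis
    unfolding scaling_eq deriv_scaling log_def by (simp add: algebra_simps add_divide_distrib diff_divide_distrib)
qed

lemma deriv_scaling_antimono:
  assumes "p < q"
  shows "deriv scaling q \<le> deriv scaling p"
proof -
  have "0 \<le> (deriv scaling p - deriv scaling q) * (q - p)"
    using scaling_tangent[of q p] scaling_tangent[of p q] by (simp add: algebra_simps)
  with assms show ?thesis
    by (simp add: zero_le_mult_iff)
qed

text \<open>By concavity \<tau> lies above its chord from 1, where it vanishes, to P. The tangent
  inequality at p is evaluated at 1 and at P; the weights \<open>P - p\<close> and
  \<open>p - 1\<close> make the derivative cancel.\<close>

lemma scaling_pos_between:
  assumes "0 < scaling P" "1 < p" "p \<le> P"
  shows "0 < scaling p"
proof (cases "p = P")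
  case False
  then have "p < P"
    using assms by simp
  have "0 \<le> scaling p + deriv scaling p * (1 - p)"
    using scaling_tangent[of 1 p] by (simp add: scaling_1)
  moreover have "scaling P \<le> scaling p + deriv scaling p * (P - p)"
    by (rule scaling_tangent)
  ultimately have "0 * (P - p) + scaling P * (p - 1) \<le>
     (scaling p + deriv scaling p * (1 - p)) * (P - p) + (scaling p + deriv scaling p * (P - p)) * (p - 1)"
    using assms by (intro add_mono mult_right_mono) auto
  also have "\<dots> = scaling p * (P - 1)"
    by (simp add: algebra_simps)
  finally have "scaling P * (p - 1) \<le> scaling p * (P - 1)"
    by simp
  moreover have "0 < scaling P * (p - 1)"
    using assms by auto
  ultimately have "0 < scaling p * (P - 1)"
    by linarith
  with assms show ?thesis
    by (simp add: zero_less_mult_iff)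
qed (use assms in auto)

section \<open>Legendre transform and the exponent at which it is attained\<close>

lemma Dspec_eq:
  assumes "deriv scaling p = h"
  shows "Dspec \<nu> (\<lambda>x. x) h = ereal (p * h - scaling p)"
proof (rule antisym)
  show "Dspec \<nu> (\<lambda>x. x) h \<le> ereal (p * h - scaling p)"
    unfolding Dspec_def by (rule INF_lower) simp
  show "ereal (p * h - scaling p) \<le> Dspec \<nu> (\<lambda>x. x) h"
    unfolding Dspec_def
  proof (rule INF_greatest)
    fix q
    show "ereal (p * h - scaling p) \<le> ereal (q * h - scaling q)"
      using scaling_tangent[of q p] assms by (simp add: algebra_simps)
  qed
qed

text \<open>Darboux's argument: \<tau>(p) - p h attains its maximum over [Q, P]. It increases at Q
  and decreases at P, so the maximum is interior and the derivative vanishes there.\<close>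

lemma deriv_scaling_surj:
  assumes "Q < P" "deriv scaling P < h" "h < deriv scaling Q"
  obtains p where "Q < p" "p < P" "deriv scaling p = h"
proof -
  have "continuous_on {Q..P} (\<lambda>p. scaling p - p * h)"
    using DERIV_isCont[OF has_real_derivative_scaling]
    by (intro continuous_intros continuous_at_imp_continuous_on) auto
  then obtain p where p: "p \<in> {Q..P}" and max: "\<And>q. q \<in> {Q..P} \<Longrightarrow> scaling q - q * h \<le> scaling p - p * h"
    using continuous_attains_sup[of "{Q..P}" "\<lambda>p. scaling p - p * h"] assms(1) by auto
  have der: "((\<lambda>p. scaling p - p * h) has_real_derivative deriv scaling q - h) (at q)" for q
    by (auto intro!: derivative_eq_intros has_real_derivative_scaling)
  have "p \<noteq> Q"
  proof
    assume "p = Q"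
    from DERIV_pos_inc_right[OF der[of Q]] assms obtain d
      where "d > 0" "\<And>t. 0 < t \<Longrightarrow> t < d \<Longrightarrow> scaling Q - Q * h < scaling (Q + t) - (Q + t) * h"
      by auto
    moreover define t where "t = min (d / 2) (P - Q)"
    ultimately have "scaling Q - Q * h < scaling (Q + t) - (Q + t) * h" "Q + t \<in> {Q..P}"
      using assms by (auto simp: t_def)
    with max[of "Q + t"] \<open>p = Q\<close> show False
      by simp
  qed
  moreover have "p \<noteq> P"
  proof
    assume "p = P"
    from DERIV_neg_dec_left[OF der[of P]] assms obtain d
      where "d > 0" "\<And>t. 0 < t \<Longrightarrow> t < d \<Longrightarrow> scaling P - P * h < scaling (P - t) - (P - t) * h"
      by auto
    moreover define t where "t = min (d / 2) (P - Q)"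
    ultimately have "scaling P - P * h < scaling (P - t) - (P - t) * h" "P - t \<in> {Q..P}"
      using assms by (auto simp: t_def)
    with max[of "P - t"] \<open>p = P\<close> show False
      by simp
  qed
  ultimately have "Q < p" "p < P"
    using p by auto
  moreover have "deriv scaling p - h = 0"
    by (rule DERIV_local_max[OF der[of p], of "min (p - Q) (P - p)"])
       (use calculation max in \<open>auto simp: abs_less_iff\<close>)
  ultimately show ?thesis
    using that by auto
qed

text \<open>For p outside (0, 1) the strict bound just says that p, lying strictly between the
  critical exponents, belongs to neither of the sets defining them. Those sets give no information
  inside (0, 1); there concavity decides: \<tau>(1) = 0 < \<tau>(P) makes \<tau>'(1) positive, so
  \<tau> is negative and increasing to the left of 1, and p h - \<tau>(p) is even positive.\<close>

lemma saddle_point: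
  assumes chi: "0 < chi"
    and fin: "p_plus \<nu> (\<lambda>x. x) chi < \<infinity>" "p_minus \<nu> (\<lambda>x. x) chi > - \<infinity>"
    and pos: "0 < scaling (real_of_ereal (p_plus \<nu> (\<lambda>x. x) chi))"
    and h: "deriv scaling (real_of_ereal (p_plus \<nu> (\<lambda>x. x) chi)) < h"
      "h < deriv scaling (real_of_ereal (p_minus \<nu> (\<lambda>x. x) chi))"
  obtains P p where "1 < P" "0 < scaling P" "p < P" "deriv scaling p = h" "- chi < p * h - scaling p"
proof -
  define A where "A = {p. p \<ge> 1 \<and> p * deriv scaling p - scaling p \<le> - chi}"
  define B where "B = {p. p \<le> 0 \<and> p * deriv scaling p - scaling p \<le> - chi}"
  have Pp: "p_plus \<nu> (\<lambda>x. x) chi = Inf (ereal ` A)" and Pm: "p_minus \<nu> (\<lambda>x. x) chi = Sup (ereal ` B)"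
    by (auto simp: p_plus_def p_minus_def A_def B_def)
  have "1 \<le> Inf (ereal ` A)"
    by (rule Inf_greatest) (auto simp: A_def one_ereal_def)
  with fin Pp obtain P where P: "Inf (ereal ` A) = ereal P" "1 \<le> P"
    by (cases "Inf (ereal ` A)") (auto simp: one_ereal_def)
  have "Sup (ereal ` B) \<le> 0"
    by (rule Sup_least) (auto simp: B_def zero_ereal_def)
  with fin Pm obtain Q where Q: "Sup (ereal ` B) = ereal Q" "Q \<le> 0"
    by (cases "Sup (ereal ` B)") (auto simp: zero_ereal_def)
  have pos': "0 < scaling P" and h': "deriv scaling P < h" "h < deriv scaling Q"
    using pos h by (auto simp: Pp Pm P Q)
  then have "P \<noteq> 1"
    by (auto simp: scaling_1)
  then have "1 < P"
    using P by simp
  then obtain p where p: "Q < p" "p < P" "deriv scaling p = h"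
    using deriv_scaling_surj[of Q P h] h' Q by auto
  have notA: "p \<notin> A"
    using p P Inf_lower[of "ereal p" "ereal ` A"] by auto
  have notB: "p \<notin> B"
    using p Q Sup_upper[of "ereal p" "ereal ` B"] by auto
  have "- chi < p * h - scaling p"
  proof (cases "1 \<le> p \<or> p \<le> 0")
    case True
    then show ?thesis
      using notA notB p by (auto simp: A_def B_def)
  next
    case False
    then have p01: "0 < p" "p < 1"
      by auto
    have "0 < deriv scaling 1 * (P - 1)"
      using scaling_tangent[of P 1] pos' by (simp add: scaling_1)
    then have d1: "0 < deriv scaling 1"
      using \<open>1 < P\<close> by (simp add: zero_less_mult_iff)
    have "scaling p \<le> deriv scaling 1 * (p - 1)"
      using scaling_tangent[of p 1] by (simp add: scaling_1)
    also have "\<dots> < 0"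
      using d1 p01 by (simp add: mult_pos_neg)
    finally have "scaling p < 0" .
    moreover have "0 < h"
      using d1 deriv_scaling_antimono[of p 1] p01 p by simp
    then have "0 < p * h"
      using p01 by simp
    ultimately show ?thesis
      using chi by linarith
  qed
  with that[of P p] \<open>1 < P\<close> pos' p show ?thesis
    by blast
qed

end

section \<open>Independent families indexed by binary words\<close>

text \<open>Independence in the form in which it is used below: functions of disjoint blocks of
  coordinates have multiplicative expectations, with no integrability to check.\<close>

lemma (in prob_space) nn_integral_prod_blocks:
  fixes G :: "'k \<Rightarrow> ('i \<Rightarrow> 'b) \<Rightarrow> ennreal"
  assumes "indep_vars M' X I" "finite L" "\<And>k. k \<in> L \<Longrightarrow> B k \<subseteq> I" "disjoint_family_on B L"
    and "\<And>k. k \<in> L \<Longrightarrow> G k \<in> borel_measurable (PiM (B k) M')"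
  shows "(\<integral>\<^sup>+\<omega>. (\<Prod>k\<in>L. G k (\<lambda>i\<in>B k. X i \<omega>)) \<partial>M) = (\<Prod>k\<in>L. \<integral>\<^sup>+\<omega>. G k (\<lambda>i\<in>B k. X i \<omega>) \<partial>M)"
proof (rule indep_vars_nn_integral)
  show "indep_vars (\<lambda>_. borel) (\<lambda>k \<omega>. G k (\<lambda>i\<in>B k. X i \<omega>)) L"
    by (rule indep_vars_compose2[OF indep_vars_restrict[OF assms(1,3,4)] assms(5)])
qed (use assms in auto)

text \<open>Serves for self-similarity: prefixing words by a letter, or by a cascade index and a
  nonempty word, is injective, so the weights below any such vertex again have the canonical product
  law.\<close>

lemma (in prob_space) distr_reindexed_family:
  fixes X :: "'i \<Rightarrow> 'a \<Rightarrow> real" and e :: "'k \<Rightarrow> 'i"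
  assumes ind: "indep_vars (\<lambda>_. borel) X I" and e: "inj e" "range e \<subseteq> I"
    and X: "\<And>i. i \<in> I \<Longrightarrow> distr M borel (X i) = \<nu>"
  shows "distr M (PiM UNIV (\<lambda>_. borel)) (\<lambda>\<omega> r. X (e r) \<omega>) = PiM UNIV (\<lambda>_. \<nu>)"
proof -
  let ?E = "range e"
  have rv [measurable]: "i \<in> ?E \<Longrightarrow> X i \<in> borel_measurable M" for i
    using ind e by (auto simp: indep_vars_def)
  have nu: "prob_space \<nu>" "sets \<nu> = sets borel"
  proof -
    have "e undefined \<in> I"
      using e by auto
    from X[OF this, symmetric] show "prob_space \<nu>" "sets \<nu> = sets borel"
      using rv[of "e undefined"] by (auto intro!: prob_space_distr)
  qed
  have sets_eq: "sets (PiM J (\<lambda>_. \<nu>)) = sets (PiM J (\<lambda>_. borel))" for J :: "'j set"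
    by (intro sets_PiM_cong) (auto simp: nu)
  have "distr M (PiM ?E (\<lambda>_. borel)) (\<lambda>x. \<lambda>i\<in>?E. X i x) = PiM ?E (\<lambda>i. distr M borel (X i))"
    using indep_vars_subset[OF ind e(2)] by (subst (asm) indep_vars_iff_distr_eq_PiM') auto
  also have "\<dots> = PiM ?E (\<lambda>i. \<nu>)"
    using X e by (intro PiM_cong) auto
  finally have *: "distr M (PiM ?E (\<lambda>_. borel)) (\<lambda>x. \<lambda>i\<in>?E. X i x) = PiM ?E (\<lambda>i. \<nu>)" .
  have "PiM UNIV (\<lambda>_. \<nu>) = distr (PiM ?E (\<lambda>_. \<nu>)) (PiM UNIV (\<lambda>_. \<nu>)) (\<lambda>\<omega>. \<lambda>n\<in>UNIV. \<omega> (e n))"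
    using e nu by (intro distr_PiM_reindex[symmetric]) auto
  also have "\<dots> = distr (PiM ?E (\<lambda>_. \<nu>)) (PiM UNIV (\<lambda>_. borel)) (\<lambda>\<omega> n. \<omega> (e n))"
    by (intro distr_cong) (auto simp: sets_eq)
  also have "\<dots> = distr M (PiM UNIV (\<lambda>_. borel)) ((\<lambda>\<omega> n. \<omega> (e n)) \<circ> (\<lambda>x. \<lambda>i\<in>?E. X i x))"
    unfolding *[symmetric]
    by (rule distr_distr)
       (auto intro!: measurable_PiM_single' measurable_restrict measurable_component_singleton)
  also have "(\<lambda>\<omega> n. \<omega> (e n)) \<circ> (\<lambda>x. \<lambda>i\<in>?E. X i x) = (\<lambda>\<omega> r. X (e r) \<omega>)"
    by (auto simp: fun_eq_iff)
  finally show ?thesis ..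
qed

section \<open>Recursive functionals of a weighted binary tree\<close>

definition subtree :: "bool \<Rightarrow> (bool list \<Rightarrow> real) \<Rightarrow> bool list \<Rightarrow> real" where
  "subtree b w = (\<lambda>r. w (b # r))"

text \<open>Sum over all words r of length n of the product of \<phi> over the weights at the proper
  prefixes of r, root included, times \<psi> of the subtree at r. The weight at r itself is thus
  left to \<psi>. Total masses and partition sums are all of this form.\<close>

primrec branch :: "(real \<Rightarrow> real) \<Rightarrow> ((bool list \<Rightarrow> real) \<Rightarrow> real) \<Rightarrow> nat \<Rightarrow> (bool list \<Rightarrow> real) \<Rightarrow> real" where
  "branch \<phi> \<psi> 0 w = \<psi> w"
| "branch \<phi> \<psi> (Suc n) w =
    \<phi> (w []) * (branch \<phi> \<psi> n (subtree False w) + branch \<phi> \<psi> n (subtree True w))"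

definition pos_tree :: "(bool list \<Rightarrow> real) \<Rightarrow> bool" where
  "pos_tree w \<longleftrightarrow> (\<forall>r. 0 < w r)"

lemma pos_tree_subtree: "pos_tree w \<Longrightarrow> pos_tree (subtree b w)"
  by (simp add: pos_tree_def subtree_def)

lemma branch_nonneg:
  assumes "\<And>x. 0 < x \<Longrightarrow> 0 \<le> \<phi> x" "\<And>w. pos_tree w \<Longrightarrow> 0 \<le> \<psi> w" "pos_tree w"
  shows "0 \<le> branch \<phi> \<psi> n w"
  using assms(3)
proof (induction n arbitrary: w)
  case (Suc n)
  then have "0 \<le> \<phi> (w [])"
    using assms(1) by (auto simp: pos_tree_def)
  with Suc show ?case
    by (auto intro!: mult_nonneg_nonneg add_nonneg_nonneg simp: pos_tree_subtree)
qed (use assms in auto)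

lemma branch_pos:
  assumes "\<And>x. 0 < x \<Longrightarrow> 0 < \<phi> x" "\<And>w. pos_tree w \<Longrightarrow> 0 < \<psi> w" "pos_tree w"
  shows "0 < branch \<phi> \<psi> n w"
  using assms(3)
proof (induction n arbitrary: w)
  case (Suc n)
  then have "0 < \<phi> (w [])"
    using assms(1) by (auto simp: pos_tree_def)
  with Suc show ?case
    by (auto intro!: mult_pos_pos add_pos_pos simp: pos_tree_subtree)
qed (use assms in auto)

text \<open>What exceeds the diagonal terms is a sum of products of orders 1 and s - 1. For
  independent x and y their expectation involves only moments of order below s, which is what makes
  a recursion for moments of order s linear. The mean value theorem is applied at the larger
  summand; the intermediate point is at most twice it, whence \<open>2 powr (s - 1)\<close>.\<close>

lemma powr_add_le:
  fixes x y s :: real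
  assumes "0 \<le> x" "0 \<le> y" "1 \<le> s"
  shows "(x + y) powr s \<le>
    x powr s + y powr s + s * 2 powr (s - 1) * (x * y powr (s - 1) + x powr (s - 1) * y)"
proof -
  have *: "(x + y) powr s \<le> x powr s + s * 2 powr (s - 1) * (x powr (s - 1) * y)"
    if "0 < y" "y \<le> x" for x y :: real
  proof -
    have "\<exists>z. x < z \<and> z < x + y \<and> (x + y) powr s - x powr s = (x + y - x) * (s * z powr (s - 1))"
      using that by (intro MVT2) (auto intro!: derivative_eq_intros)
    then obtain z where z: "x < z" "z < x + y"
      "(x + y) powr s - x powr s = y * (s * z powr (s - 1))"
      by auto
    have "z powr (s - 1) \<le> (2 * x) powr (s - 1)"
      using z that assms by (intro powr_mono2) auto
    also have "\<dots> = 2 powr (s - 1) * x powr (s - 1)"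
      using that by (simp add: powr_mult)
    finally have "y * (s * z powr (s - 1)) \<le> y * (s * (2 powr (s - 1) * x powr (s - 1)))"
      using that assms by (intro mult_left_mono) auto
    with z show ?thesis
      by (simp add: algebra_simps)
  qed
  consider "x = 0" | "y = 0" | "0 < y" "y \<le> x" | "0 < x" "x \<le> y"
    using assms by linarith
  then show ?thesis
  proof cases
    case 3
    have "0 \<le> y powr s + s * 2 powr (s - 1) * (x * y powr (s - 1))"
      using assms by auto
    with *[OF 3] show ?thesis
      by (simp add: algebra_simps)
  next
    case 4
    have "0 \<le> x powr s + s * 2 powr (s - 1) * (x powr (s - 1) * y)"
      using assms by auto
    with *[OF 4] show ?thesis
      by (simp add: algebra_simps)
  qed (use assms in auto)
qed

lemma nn_integral_lincomb4:
  fixes c :: ennreal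
  assumes "f1 \<in> borel_measurable M" "f2 \<in> borel_measurable M" "f3 \<in> borel_measurable M" "f4 \<in> borel_measurable M"
  shows "(\<integral>\<^sup>+x. f1 x + f2 x + (c * f3 x + c * f4 x) \<partial>M) =
    (\<integral>\<^sup>+x. f1 x \<partial>M) + (\<integral>\<^sup>+x. f2 x \<partial>M) + (c * (\<integral>\<^sup>+x. f3 x \<partial>M) + c * (\<integral>\<^sup>+x. f4 x \<partial>M))"
  using assms by (simp add: nn_integral_add nn_integral_cmult)

section \<open>The canonical tree and its self-similarity\<close>

context cascade_weight
begin

definition tree :: "(bool list \<Rightarrow> real) measure" where
  "tree = PiM UNIV (\<lambda>_. \<nu>)"

lemma sets_tree [measurable_cong]: "sets tree = sets (PiM UNIV (\<lambda>_. borel))"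
  unfolding tree_def by (intro sets_PiM_cong) (auto simp: sets_weight)

lemma space_tree [simp]: "space tree = UNIV"
  using sets_eq_imp_space_eq[OF sets_tree] by (simp add: space_PiM)

sublocale tree: prob_space tree
  unfolding tree_def by (intro prob_space_PiM prob_space_axioms)

lemma measurable_subtree [measurable]: "subtree b \<in> measurable tree tree"
  unfolding measurable_cong_sets[OF refl sets_tree] subtree_def
  by (rule measurable_PiM_single') (auto simp: space_PiM)

lemma measurable_branch [measurable]:
  assumes [measurable]: "\<phi> \<in> borel_measurable borel" "\<psi> \<in> borel_measurable tree"
  shows "branch \<phi> \<psi> n \<in> borel_measurable tree"
proof (induction n)
  case (Suc n)
  note [measurable] = Suc
  show ?case
    unfolding branch.simps by measurable
qed simp

lemma distr_component_tree: "distr tree borel (\<lambda>w. w r) = \<nu>"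
proof -
  have "distr tree borel (\<lambda>w. w r) = distr (PiM UNIV (\<lambda>_. \<nu>)) \<nu> (\<lambda>w. w r)"
    unfolding tree_def by (intro distr_cong) (auto simp: sets_weight)
  also have "\<dots> = \<nu>"
    by (rule distr_PiM_component) (auto simp: prob_space_axioms)
  finally show ?thesis .
qed

lemma indep_components: "tree.indep_vars (\<lambda>_. borel) (\<lambda>r w. w r) UNIV"
proof (subst tree.indep_vars_iff_distr_eq_PiM')
  have "distr tree (PiM UNIV (\<lambda>_. borel)) (\<lambda>x. \<lambda>i\<in>UNIV. x i) = distr tree tree (\<lambda>x. x)"
    by (intro distr_cong) (auto simp: sets_tree)
  also have "\<dots> = tree"
    by (rule distr_id)
  finally have *: "distr tree (PiM UNIV (\<lambda>_. borel)) (\<lambda>x. \<lambda>i\<in>UNIV. x i) = tree" .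
  show "distr tree (PiM UNIV (\<lambda>_. borel)) (\<lambda>x. \<lambda>i\<in>UNIV. x i) =
      PiM UNIV (\<lambda>i. distr tree borel (\<lambda>w. w i))"
    by (simp only: * distr_component_tree) (simp only: tree_def)
qed auto

lemma distr_subtree: "distr tree tree (subtree b) = tree"
proof -
  have "distr tree (PiM UNIV (\<lambda>_. borel)) (\<lambda>w r. w (b # r)) = PiM UNIV (\<lambda>_. \<nu>)"
    by (rule tree.distr_reindexed_family[OF indep_components]) (auto simp: distr_component_tree)
  then show ?thesis
    unfolding subtree_def by (simp add: tree_def[symmetric] cong: distr_cong add: sets_tree)
qed

lemma nn_integral_subtree:
  assumes [measurable]: "g \<in> borel_measurable tree"
  shows "(\<integral>\<^sup>+w. g (subtree b w) \<partial>tree) = (\<integral>\<^sup>+w. g w \<partial>tree)"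
  using nn_integral_distr[of "subtree b" tree tree g] by (simp add: distr_subtree)

lemma nn_integral_root:
  assumes [measurable]: "f \<in> borel_measurable borel"
  shows "(\<integral>\<^sup>+w. f (w []) \<partial>tree) = (\<integral>\<^sup>+x. f x \<partial>\<nu>)"
  by (subst distr_component_tree[of "[]", symmetric], subst nn_integral_distr) auto

text \<open>The root weight and the two subtrees are independent, and each subtree has the law of
  the whole tree. Every moment recursion below rests on this identity. In the proof the block
  \<open>None\<close> is the root and \<open>Some b\<close> the subtree below
  \<open>b\<close>.\<close>

lemma nn_integral_tree_split:
  fixes f :: "real \<Rightarrow> ennreal"
  assumes f [measurable]: "f \<in> borel_measurable borel"
    and g: "g \<in> borel_measurable tree" and h: "h \<in> borel_measurable tree"
  shows "(\<integral>\<^sup>+w. f (w []) * (g (subtree False w) * h (subtree True w)) \<partial>tree) =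
    (\<integral>\<^sup>+x. f x \<partial>\<nu>) * ((\<integral>\<^sup>+w. g w \<partial>tree) * (\<integral>\<^sup>+w. h w \<partial>tree))"
proof -
  note [measurable] = g h
  define L where "L = {None, Some False, Some True}"
  define B :: "bool option \<Rightarrow> bool list set" where "B = (\<lambda>k. case k of None \<Rightarrow> {[]} | Some b \<Rightarrow> range (Cons b))"
  define G :: "bool option \<Rightarrow> (bool list \<Rightarrow> real) \<Rightarrow> ennreal" where
    "G = (\<lambda>k x. case k of None \<Rightarrow> f (x []) | Some b \<Rightarrow> (if b then h else g) (subtree b x))"
  have sub: "subtree b \<in> measurable (PiM (range (Cons b)) (\<lambda>_. borel)) tree" for b
    unfolding measurable_cong_sets[OF refl sets_tree] subtree_def
    by (rule measurable_PiM_single') (auto simp: space_PiM intro!: measurable_component_singleton)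
  have sub_restrict: "subtree b (restrict w (range ((#) b))) = subtree b w" for b w
    by (auto simp: subtree_def)
  have "(\<integral>\<^sup>+w. (\<Prod>k\<in>L. G k (\<lambda>r\<in>B k. w r)) \<partial>tree) = (\<Prod>k\<in>L. \<integral>\<^sup>+w. G k (\<lambda>r\<in>B k. w r) \<partial>tree)"
  proof (rule tree.nn_integral_prod_blocks[OF indep_components])
    show "disjoint_family_on B L"
      by (auto simp: disjoint_family_on_def B_def L_def)
    show "G k \<in> borel_measurable (PiM (B k) (\<lambda>_. borel))" if "k \<in> L" for k
    proof (cases k)
      case None
      have "(\<lambda>x. x []) \<in> measurable (PiM {[]} (\<lambda>_. borel :: real measure)) borel"
        by (rule measurable_component_singleton) simp
      from measurable_compose[OF this f] show ?thesis
        by (simp add: G_def B_def None)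
    next
      case (Some b)
      show ?thesis
        using measurable_compose[OF sub[of b] g] measurable_compose[OF sub[of b] h]
        by (cases b) (simp_all add: G_def B_def Some)
    qed
  qed (auto simp: L_def)
  then show ?thesis
    by (simp add: L_def G_def B_def sub_restrict nn_integral_subtree nn_integral_root mult.assoc)
qed

lemma AE_pos_tree: "AE w in tree. pos_tree w"
  unfolding pos_tree_def AE_all_countable
proof
  fix r
  show "AE w in tree. 0 < w r"
    unfolding tree_def
    by (rule AE_PiM_component[of UNIV "\<lambda>_. \<nu>" r "\<lambda>x. 0 < x"]) (auto simp: prob_space_axioms weight_pos)
qed

text \<open>Taken in \<open>ennreal\<close>, so that it is meaningful before finiteness is known.
  Since \<open>0 powr s\<close> is 0 for every s, the moment of order 0 is the probability that g
  does not vanish.\<close>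

definition tmoment :: "((bool list \<Rightarrow> real) \<Rightarrow> real) \<Rightarrow> real \<Rightarrow> ennreal" where
  "tmoment g s = (\<integral>\<^sup>+w. ennreal (g w powr s) \<partial>tree)"

lemma tmoment_branch_1:
  assumes [measurable]: "\<phi> \<in> borel_measurable borel" "\<psi> \<in> borel_measurable tree"
    and nonneg: "\<And>x. 0 < x \<Longrightarrow> 0 \<le> \<phi> x" "\<And>w. pos_tree w \<Longrightarrow> 0 \<le> \<psi> w"
  shows "tmoment (branch \<phi> \<psi> (Suc n)) 1 = 2 * (\<integral>\<^sup>+x. ennreal (\<phi> x) \<partial>\<nu>) * tmoment (branch \<phi> \<psi> n) 1"
proof -
  let ?G = "branch \<phi> \<psi> n" and ?I = "\<integral>\<^sup>+x. ennreal (\<phi> x) \<partial>\<nu>"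
  let ?f = "\<lambda>w. ennreal (\<phi> (w []))"
  let ?a = "\<lambda>w. ?f w * (ennreal (?G (subtree False w) powr 1) * 1)"
  let ?b = "\<lambda>w. ?f w * (1 * ennreal (?G (subtree True w) powr 1))"
  have "tmoment (branch \<phi> \<psi> (Suc n)) 1 = (\<integral>\<^sup>+w. ?a w + ?b w \<partial>tree)"
    unfolding tmoment_def
  proof (rule nn_integral_cong_AE)
    show "AE w in tree. ennreal (branch \<phi> \<psi> (Suc n) w powr 1) = ?a w + ?b w"
      using AE_pos_tree
    proof eventually_elim
      case (elim w)
      have "0 \<le> ?G (subtree False w)" "0 \<le> ?G (subtree True w)"
        using elim by (auto intro!: branch_nonneg nonneg pos_tree_subtree)
      moreover have "0 \<le> \<phi> (w [])"
        using elim nonneg by (auto simp: pos_tree_def)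
      ultimately show ?case
        by (simp add: ennreal_mult ennreal_plus distrib_left)
    qed
  qed
  also have "\<dots> = (\<integral>\<^sup>+w. ?a w \<partial>tree) + (\<integral>\<^sup>+w. ?b w \<partial>tree)"
    by (rule nn_integral_add) measurable
  also have "(\<integral>\<^sup>+w. ?a w \<partial>tree) = ?I * (tmoment ?G 1 * (\<integral>\<^sup>+w. 1 \<partial>tree))"
    unfolding tmoment_def
    by (rule nn_integral_tree_split[of "\<lambda>x. ennreal (\<phi> x)" "\<lambda>w. ennreal (?G w powr 1)" "\<lambda>_. 1"]) measurable
  also have "(\<integral>\<^sup>+w. ?b w \<partial>tree) = ?I * ((\<integral>\<^sup>+w. 1 \<partial>tree) * tmoment ?G 1)"
    unfolding tmoment_def
    by (rule nn_integral_tree_split[of "\<lambda>x. ennreal (\<phi> x)" "\<lambda>_. 1" "\<lambda>w. ennreal (?G w powr 1)"]) measurable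
  also have "?I * (tmoment ?G 1 * (\<integral>\<^sup>+w. 1 \<partial>tree)) + ?I * ((\<integral>\<^sup>+w. 1 \<partial>tree) * tmoment ?G 1) = 2 * ?I * tmoment ?G 1"
    using tree.emeasure_space_1 by (simp add: mult.assoc flip: mult_2)
  finally show ?thesis .
qed

text \<open>By \<open>powr_add_le\<close> and independence, the moment of order s obeys an affine
  recursion in the depth: its coefficient is twice the integral of \<phi> to the power s, and the
  inhomogeneous term has orders 1 and s - 1 only.\<close>

lemma tmoment_branch_le:
  assumes [measurable]: "\<phi> \<in> borel_measurable borel" "\<psi> \<in> borel_measurable tree"
    and nonneg: "\<And>x. 0 < x \<Longrightarrow> 0 \<le> \<phi> x" "\<And>w. pos_tree w \<Longrightarrow> 0 \<le> \<psi> w"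
    and s: "1 < s"
  shows "tmoment (branch \<phi> \<psi> (Suc n)) s \<le> (\<integral>\<^sup>+x. ennreal (\<phi> x powr s) \<partial>\<nu>) *
    (2 * tmoment (branch \<phi> \<psi> n) s +
     ennreal (2 * s * 2 powr (s - 1)) * (tmoment (branch \<phi> \<psi> n) 1 * tmoment (branch \<phi> \<psi> n) (s - 1)))"
proof -
  let ?G = "branch \<phi> \<psi> n"
  let ?f = "\<lambda>w. ennreal (\<phi> (w []) powr s)"
  let ?g = "\<lambda>b p w. ennreal (?G (subtree b w) powr p)"
  define C where "C = ennreal (s * 2 powr (s - 1))"
  have "tmoment (branch \<phi> \<psi> (Suc n)) s \<le>
      (\<integral>\<^sup>+w. ?f w * (?g False s w * 1) + ?f w * (1 * ?g True s w) +
        (C * (?f w * (?g False 1 w * ?g True (s - 1) w)) + C * (?f w * (?g False (s - 1) w * ?g True 1 w))) \<partial>tree)"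
    unfolding tmoment_def
  proof (rule nn_integral_mono_AE)
    show "AE w in tree. ennreal (branch \<phi> \<psi> (Suc n) w powr s) \<le>
        ?f w * (?g False s w * 1) + ?f w * (1 * ?g True s w) +
        (C * (?f w * (?g False 1 w * ?g True (s - 1) w)) + C * (?f w * (?g False (s - 1) w * ?g True 1 w)))"
      using AE_pos_tree
    proof eventually_elim
      case (elim w)
      define a b c where "a = ?G (subtree False w)" and "b = ?G (subtree True w)" and "c = \<phi> (w [])"
      have nn: "0 \<le> a" "0 \<le> b"
        unfolding a_def b_def using elim by (auto intro!: branch_nonneg nonneg pos_tree_subtree)
      have "0 \<le> c"
        using elim nonneg by (auto simp: pos_tree_def c_def)
      have "(c * (a + b)) powr s = c powr s * (a + b) powr s"
        using nn \<open>0 \<le> c\<close> by (simp add: powr_mult)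
      also have "\<dots> \<le> c powr s * (a powr s + b powr s + s * 2 powr (s - 1) * (a * b powr (s - 1) + a powr (s - 1) * b))"
        using nn s by (intro mult_left_mono powr_add_le) auto
      also have "\<dots> = c powr s * a powr s + c powr s * b powr s +
         ((s * 2 powr (s - 1)) * (c powr s * (a powr 1 * b powr (s - 1))) +
          (s * 2 powr (s - 1)) * (c powr s * (a powr (s - 1) * b powr 1)))"
        using nn by (simp add: algebra_simps)
      finally have "ennreal ((c * (a + b)) powr s) \<le> ennreal \<dots>"
        by (rule ennreal_leI)
      also have "\<dots> = ennreal (c powr s) * ennreal (a powr s) + ennreal (c powr s) * ennreal (b powr s) +
         (C * (ennreal (c powr s) * (ennreal (a powr 1) * ennreal (b powr (s - 1)))) +
          C * (ennreal (c powr s) * (ennreal (a powr (s - 1)) * ennreal (b powr 1))))"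
        unfolding C_def using s nn by (simp add: ennreal_mult ennreal_plus)
      finally show ?case
        by (simp add: a_def b_def c_def)
    qed
  qed
  also have "\<dots> = (\<integral>\<^sup>+x. ennreal (\<phi> x powr s) \<partial>\<nu>) * (tmoment ?G s * (\<integral>\<^sup>+w. 1 \<partial>tree)) +
      (\<integral>\<^sup>+x. ennreal (\<phi> x powr s) \<partial>\<nu>) * ((\<integral>\<^sup>+w. 1 \<partial>tree) * tmoment ?G s) +
      (C * ((\<integral>\<^sup>+x. ennreal (\<phi> x powr s) \<partial>\<nu>) * (tmoment ?G 1 * tmoment ?G (s - 1))) +
       C * ((\<integral>\<^sup>+x. ennreal (\<phi> x powr s) \<partial>\<nu>) * (tmoment ?G (s - 1) * tmoment ?G 1)))"
  proof -
    have split: "(\<integral>\<^sup>+w. ?f w * (?g False p w * ?g True q w) \<partial>tree) =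
        (\<integral>\<^sup>+x. ennreal (\<phi> x powr s) \<partial>\<nu>) * (tmoment ?G p * tmoment ?G q)" for p q
      unfolding tmoment_def
      by (rule nn_integral_tree_split[of "\<lambda>x. ennreal (\<phi> x powr s)" "\<lambda>w. ennreal (?G w powr p)" "\<lambda>w. ennreal (?G w powr q)"]) measurable
    have split1: "(\<integral>\<^sup>+w. ?f w * (?g False p w * 1) \<partial>tree) =
        (\<integral>\<^sup>+x. ennreal (\<phi> x powr s) \<partial>\<nu>) * (tmoment ?G p * (\<integral>\<^sup>+w. 1 \<partial>tree))" for p
      unfolding tmoment_def
      by (rule nn_integral_tree_split[of "\<lambda>x. ennreal (\<phi> x powr s)" "\<lambda>w. ennreal (?G w powr p)" "\<lambda>_. 1"]) measurable
    have split2: "(\<integral>\<^sup>+w. ?f w * (1 * ?g True p w) \<partial>tree) =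
        (\<integral>\<^sup>+x. ennreal (\<phi> x powr s) \<partial>\<nu>) * ((\<integral>\<^sup>+w. 1 \<partial>tree) * tmoment ?G p)" for p
      unfolding tmoment_def
      by (rule nn_integral_tree_split[of "\<lambda>x. ennreal (\<phi> x powr s)" "\<lambda>_. 1" "\<lambda>w. ennreal (?G w powr p)"]) measurable
    show ?thesis
      unfolding split[symmetric] split1[symmetric] split2[symmetric]
      by (rule nn_integral_lincomb4) measurable
  qed
  also have "\<dots> = (\<integral>\<^sup>+x. ennreal (\<phi> x powr s) \<partial>\<nu>) *
      (2 * tmoment ?G s + 2 * C * (tmoment ?G 1 * tmoment ?G (s - 1)))"
    using tree.emeasure_space_1 by (simp add: algebra_simps flip: mult_2)
  also have "2 * C = ennreal (2 * s * 2 powr (s - 1))"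
    unfolding C_def by (subst ennreal_numeral[symmetric], subst ennreal_mult[symmetric]) (use s in \<open>auto simp: mult.assoc\<close>)
  finally show ?thesis .
qed

end

section \<open>Moments of the total mass\<close>

lemma affine_recursion_bounded:
  fixes a :: "nat \<Rightarrow> ennreal"
  assumes "a 0 \<le> ennreal A" "\<And>n. a (Suc n) \<le> ennreal c * a n + ennreal d" "0 \<le> c" "c < 1" "0 \<le> d"
  obtains B where "\<And>n. a n \<le> ennreal B" "0 \<le> B"
proof
  \<comment> \<open>\<open>d / (1 - c)\<close> is the fixed point of the affine map; a bound at or
    above it is preserved by the recursion.\<close>
  define B where "B = max \<bar>A\<bar> (d / (1 - c))"
  show "0 \<le> B"
    by (simp add: B_def le_max_iff_disj)
  have "d / (1 - c) \<le> B"
    by (simp add: B_def)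
  then have *: "c * B + d \<le> B"
    using assms by (simp add: field_simps)
  show "a n \<le> ennreal B" for n
  proof (induction n)
    case 0
    have "ennreal A \<le> ennreal B"
      by (intro ennreal_leI) (auto simp: B_def)
    with assms(1) show ?case
      by (rule order.trans)
  next
    case (Suc n)
    have "a (Suc n) \<le> ennreal c * ennreal B + ennreal d"
      using assms(2)[of n] Suc by (meson add_mono mult_left_mono order.trans order_refl zero_le)
    also have "\<dots> = ennreal (c * B + d)"
      using assms \<open>0 \<le> B\<close> by (simp add: ennreal_mult ennreal_plus)
    also have "\<dots> \<le> ennreal B"
      using * by (rule ennreal_leI)
    finally show ?case .
  qed
qed

context cascade_weight
begin

lemma nn_integral_moment: "(\<integral>\<^sup>+x. ennreal (x powr s) \<partial>\<nu>) = ennreal (moment s)"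
  unfolding moment_def by (rule nn_integral_eq_integral) (auto intro: weight_moments)

lemma nn_integral_half_moment: "(\<integral>\<^sup>+x. ennreal ((x / 2) powr s) \<partial>\<nu>) = ennreal (2 powr (- s) * moment s)"
proof -
  have "(\<integral>\<^sup>+x. ennreal ((x / 2) powr s) \<partial>\<nu>) = (\<integral>\<^sup>+x. ennreal (2 powr (- s)) * ennreal (x powr s) \<partial>\<nu>)"
  proof (rule nn_integral_cong_AE)
    show "AE x in \<nu>. ennreal ((x / 2) powr s) = ennreal (2 powr (- s)) * ennreal (x powr s)"
      using weight_pos
    proof eventually_elim
      case (elim x)
      then have "(x / 2) powr s = 2 powr (- s) * x powr s"
        by (simp add: powr_divide powr_minus_divide)
      then show ?case
        by (simp add: ennreal_mult)
    qed
  qed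
  also have "\<dots> = ennreal (2 powr (- s)) * ennreal (moment s)"
    unfolding nn_integral_moment[symmetric] by (rule nn_integral_cmult) measurable
  also have "\<dots> = ennreal (2 powr (- s) * moment s)"
    using moment_pos[of s] by (simp add: ennreal_mult)
  finally show ?thesis .
qed

text \<open>Pointwise, the power of order s is dominated by the one of order b above 1 and by the
  one of order a below 1.\<close>

lemma tmoment_mono_interp:
  assumes [measurable]: "g \<in> borel_measurable tree"
    and nonneg: "AE w in tree. 0 \<le> g w" and s: "a \<le> s" "s \<le> b"
  shows "tmoment g s \<le> tmoment g a + tmoment g b"
proof -
  have "tmoment g s \<le> (\<integral>\<^sup>+w. ennreal (g w powr a) + ennreal (g w powr b) \<partial>tree)"
    unfolding tmoment_def
  proof (rule nn_integral_mono_AE)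
    show "AE w in tree. ennreal (g w powr s) \<le> ennreal (g w powr a) + ennreal (g w powr b)"
      using nonneg
    proof eventually_elim
      case (elim w)
      have "g w powr s \<le> g w powr a + g w powr b"
      proof (cases "g w = 0")
        case False
        show ?thesis
        proof (cases "1 \<le> g w")
          case True
          then have "g w powr s \<le> g w powr b"
            using s by (intro powr_mono) auto
          moreover have "0 \<le> g w powr a"
            by simp
          ultimately show ?thesis
            by linarith
        next
          case le: False
          then have "g w powr s \<le> g w powr a"
            using s elim False by (intro powr_mono') auto
          moreover have "0 \<le> g w powr b"
            by simp
          ultimately show ?thesis
            by linarith
        qed
      qed simp
      then show ?case
        by (simp flip: ennreal_plus)
    qed
  qed
  also have "\<dots> = tmoment g a + tmoment g b"
    unfolding tmoment_def by (rule nn_integral_add) auto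
  finally show ?thesis .
qed

lemma tmoment_0_le: "tmoment g 0 \<le> 1"
proof -
  have "tmoment g 0 \<le> (\<integral>\<^sup>+w. 1 \<partial>tree)"
    unfolding tmoment_def by (rule nn_integral_mono) auto
  then show ?thesis
    using tree.emeasure_space_1 by simp
qed

text \<open>Total mass, for unit length, after n levels below the root: 2^(-n) times the sum over
  words of length n of the products of all weights on the path, those at the root and at the end
  included.\<close>

definition mass :: "nat \<Rightarrow> (bool list \<Rightarrow> real) \<Rightarrow> real" where
  "mass = branch (\<lambda>x. x / 2) (\<lambda>w. w [])"

lemma mass_Suc: "mass (Suc n) w = w [] / 2 * (mass n (subtree False w) + mass n (subtree True w))"
  by (simp add: mass_def)

lemma measurable_mass [measurable]: "mass n \<in> borel_measurable tree"
  unfolding mass_def by measurable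

lemma mass_pos: "pos_tree w \<Longrightarrow> 0 < mass n w"
  unfolding mass_def by (rule branch_pos) (auto simp: pos_tree_def)

lemma AE_mass_pos: "AE w in tree. 0 < mass n w"
  using AE_pos_tree by eventually_elim (rule mass_pos)

lemma AE_mass_nonneg: "AE w in tree. 0 \<le> mass n w"
  using AE_mass_pos[of n] by eventually_elim simp

lemma tmoment_mass_initial: "tmoment (mass 0) s = ennreal (moment s)"
  unfolding tmoment_def mass_def
  by (simp add: nn_integral_root[of "\<lambda>x. ennreal (x powr s)"] nn_integral_moment)

lemma tmoment_mass_1: "tmoment (mass n) 1 = 1"
proof (induction n)
  case 0
  show ?case
    by (simp add: tmoment_mass_initial moment_1)
next
  case (Suc n)
  have "(\<integral>\<^sup>+x. ennreal (x / 2) \<partial>\<nu>) = (\<integral>\<^sup>+x. ennreal ((x / 2) powr 1) \<partial>\<nu>)"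
    by (rule nn_integral_cong_AE) (use weight_pos in \<open>auto elim!: eventually_mono\<close>)
  also have "\<dots> = ennreal (1 / 2)"
    unfolding nn_integral_half_moment by (simp only: moment_1) (simp add: powr_minus)
  finally have "2 * (\<integral>\<^sup>+x. ennreal (x / 2) \<partial>\<nu>) = ennreal 2 * ennreal (1 / 2)"
    by simp
  also have "\<dots> = 1"
    by (subst ennreal_mult[symmetric]) auto
  finally have *: "2 * (\<integral>\<^sup>+x. ennreal (x / 2) \<partial>\<nu>) = 1" .
  have "tmoment (mass (Suc n)) 1 = 2 * (\<integral>\<^sup>+x. ennreal (x / 2) \<partial>\<nu>) * tmoment (mass n) 1"
    unfolding mass_def by (rule tmoment_branch_1) (auto simp: pos_tree_def less_imp_le)
  then show ?case
    using Suc * by simp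
qed

text \<open>Induction over unit steps of the order, because the inhomogeneous term of the recursion
  has order s - 1. For s > 1 the coefficient is 2 * 2^(-s) times the moment of order s, that is
  2^(-\<tau>(s)), which is below 1 since \<tau> is positive on (1, P].\<close>

lemma mass_moment_pos_bounded:
  assumes P: "0 < scaling P" and s: "0 \<le> s" "s \<le> P"
  obtains B where "\<And>n. tmoment (mass n) s \<le> ennreal B" "0 \<le> B"
proof -
  have "\<exists>B. (\<forall>n. tmoment (mass n) s \<le> ennreal B) \<and> 0 \<le> B" if "s \<le> real k" "0 \<le> s" "s \<le> P" for k s
    using that
  proof (induction k arbitrary: s)
    case 0
    then have "s = 0"
      by simp
    then show ?case
      by (intro exI[of _ 1]) (simp add: tmoment_0_le)
  next
    case (Suc k)
    show ?case
    proof (cases "s \<le> 1")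
      case True
      have "tmoment (mass n) s \<le> tmoment (mass n) 0 + tmoment (mass n) 1" for n
        using Suc True by (intro tmoment_mono_interp AE_mass_nonneg) auto
      moreover have "tmoment (mass n) 0 + tmoment (mass n) 1 \<le> 1 + 1" for n
        by (intro add_mono) (simp_all add: tmoment_mass_1 tmoment_0_le)
      ultimately have "tmoment (mass n) s \<le> ennreal 2" for n
        by (metis order.trans one_add_one ennreal_numeral)
      then show ?thesis
        by (intro exI[of _ 2]) auto
    next
      case False
      then obtain B where B: "\<And>n. tmoment (mass n) (s - 1) \<le> ennreal B" "0 \<le> B"
        using Suc.IH[of "s - 1"] Suc.prems by auto
      define c where "c = 2 powr (- s) * moment s"
      define d where "d = c * ((2 * s * 2 powr (s - 1)) * B)"
      have "0 < c"
        using moment_pos[of s] by (simp add: c_def)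
      have "2 * c = 2 powr (- s) * (2 * moment s)"
        by (simp add: c_def)
      also have "\<dots> = 2 powr (- scaling s)"
        by (subst two_moment_eq) (simp flip: powr_add)
      also have "\<dots> < 1"
        using scaling_pos_between[of P s] P False Suc.prems by (simp add: powr_less_one)
      finally have "2 * c < 1" .
      have rec: "tmoment (mass (Suc n)) s \<le> ennreal (2 * c) * tmoment (mass n) s + ennreal d" for n
      proof -
        have "tmoment (mass (Suc n)) s \<le> (\<integral>\<^sup>+x. ennreal ((x / 2) powr s) \<partial>\<nu>) *
            (2 * tmoment (mass n) s +
             ennreal (2 * s * 2 powr (s - 1)) * (tmoment (mass n) 1 * tmoment (mass n) (s - 1)))"
          unfolding mass_def using False
          by (intro tmoment_branch_le) (auto simp: pos_tree_def less_imp_le)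
        also have "\<dots> \<le> ennreal c * (2 * tmoment (mass n) s +
             ennreal (2 * s * 2 powr (s - 1)) * ennreal B)"
          unfolding nn_integral_half_moment c_def
          using B by (intro mult_left_mono add_mono) (auto simp: tmoment_mass_1)
        also have "\<dots> = ennreal (2 * c) * tmoment (mass n) s + ennreal d"
          unfolding d_def using B \<open>0 < c\<close> False
          by (simp add: distrib_left ennreal_mult ac_simps)
        finally show ?thesis .
      qed
      have "0 \<le> d"
        using B \<open>0 < c\<close> False by (simp add: d_def)
      obtain B' where "\<And>n. tmoment (mass n) s \<le> ennreal B'" "0 \<le> B'"
        by (rule affine_recursion_bounded[of "\<lambda>n. tmoment (mass n) s" "moment s" "2 * c" d])
           (use rec \<open>2 * c < 1\<close> \<open>0 < c\<close> \<open>0 \<le> d\<close> in \<open>auto simp: tmoment_mass_initial\<close>)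
      then show ?thesis
        by auto
    qed
  qed
  from this[of s "nat \<lceil>s\<rceil>"] s that show ?thesis
    using real_nat_ceiling_ge by blast
qed

text \<open>As in the Paley--Zygmund inequality, the unit mean cannot be carried by a small event,
  because some moment of order larger than one is bounded.\<close>

lemma mass_small_prob:
  assumes P: "0 < scaling P" "1 < P"
  obtains c where "0 < c" "\<And>n. measure tree {w. mass n w < 1 / 2} \<le> 1 - c"
proof -
  obtain B where B: "\<And>n. tmoment (mass n) P \<le> ennreal B" "0 \<le> B"
    using mass_moment_pos_bounded[of P P] P by auto
  \<comment> \<open>\<open>l\<close> is so small that the part with \<open>l * x powr P\<close>
    costs at most 1/4; \<open>L\<close> is the threshold with \<open>L powr (P - 1) = 1 / l\<close>,
    above which x itself is at most \<open>l * x powr P\<close>.\<close>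
  define l where "l = 1 / (4 * (B + 1))"
  define L where "L = l powr (- 1 / (P - 1))"
  have l: "0 < l" "l * B \<le> 1 / 4"
    using B by (auto simp: l_def field_simps)
  then have L: "0 < L"
    by (simp add: L_def)
  have le: "x \<le> l * x powr P + L" if "0 < x" for x
  proof (cases "x \<le> L")
    case True
    have "0 \<le> l * x powr P"
      using l by simp
    with True show ?thesis
      by linarith
  next
    case False
    have "L powr (P - 1) = l powr (- 1 / (P - 1) * (P - 1))"
      unfolding L_def by (rule powr_powr)
    also have "\<dots> = 1 / l"
      using P l by (simp add: powr_minus_divide)
    finally have "L powr (P - 1) = 1 / l" .
    moreover have "L powr (P - 1) \<le> x powr (P - 1)"
      using False L P by (intro powr_mono2) auto
    ultimately have "1 / l \<le> x powr (P - 1)"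
      by simp
    then have "1 \<le> l * x powr (P - 1)"
      using l by (simp add: pos_divide_le_eq mult.commute)
    then have "x * 1 \<le> x * (l * x powr (P - 1))"
      using that by (intro mult_left_mono) auto
    also have "\<dots> = l * x powr P"
      using that by (simp add: powr_diff)
    finally show ?thesis
      using L by simp
  qed
  show ?thesis
  proof
    show "0 < 1 / (4 * L)"
      using L by simp
    fix n
    define A where "A = {w \<in> space tree. 1 / 2 \<le> mass n w}"
    have A [measurable]: "A \<in> sets tree"
      unfolding A_def by measurable
    have "1 = tmoment (mass n) 1"
      by (simp add: tmoment_mass_1)
    \<comment> \<open>The unit mean is split: values below 1/2 give at most 1/2, values above
      \<open>L\<close> are charged to the moment of order P and give at most 1/4, so the remaining
      1/4 is at most \<open>L\<close> times the probability of \<open>A\<close>.\<close>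
    also have "\<dots> \<le> (\<integral>\<^sup>+w. (ennreal (1 / 2) + ennreal l * ennreal (mass n w powr P)) + ennreal L * indicator A w \<partial>tree)"
      unfolding tmoment_def
    proof (rule nn_integral_mono_AE)
      show "AE w in tree. ennreal (mass n w powr 1) \<le>
          (ennreal (1 / 2) + ennreal l * ennreal (mass n w powr P)) + ennreal L * indicator A w"
        using AE_mass_pos[of n]
      proof eventually_elim
        case (elim w)
        have "mass n w powr 1 \<le> (1 / 2 + l * mass n w powr P) + L * indicator A w"
        proof (cases "1 / 2 \<le> mass n w")
          case True
          then show ?thesis
            using le[OF elim] elim by (simp add: indicator_def A_def)
        next
          case False
          moreover have "0 \<le> l * mass n w powr P"
            using l by simp
          ultimately show ?thesis
            using elim by (simp add: indicator_def A_def)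
        qed
        then have "ennreal (mass n w powr 1) \<le> ennreal ((1 / 2 + l * mass n w powr P) + L * indicator A w)"
          by (rule ennreal_leI)
        also have "\<dots> = (ennreal (1 / 2) + ennreal l * ennreal (mass n w powr P)) + ennreal L * indicator A w"
          using l L by (simp add: ennreal_plus ennreal_mult ennreal_indicator[symmetric])
        finally show ?case .
      qed
    qed
    also have "\<dots> = (ennreal (1 / 2) + ennreal l * tmoment (mass n) P) + ennreal L * emeasure tree A"
      unfolding tmoment_def using tree.emeasure_space_1
      by (simp add: nn_integral_add nn_integral_cmult A)
    also have "\<dots> \<le> (ennreal (1 / 2) + ennreal l * ennreal B) + ennreal L * ennreal (measure tree A)"
      using B by (intro add_mono mult_left_mono) (auto simp: tree.emeasure_eq_measure)
    also have "\<dots> = ennreal (1 / 2 + l * B + L * measure tree A)"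
      using l L B by (simp add: ennreal_plus ennreal_mult)
    finally have "1 \<le> 1 / 2 + l * B + L * measure tree A"
      by (simp flip: ennreal_1 del: ennreal_1) (simp add: ennreal_le_iff2)
    then have "1 / (4 * L) \<le> measure tree A"
      using l L by (simp add: field_simps)
    also have "measure tree A = 1 - measure tree {w. mass n w < 1 / 2}"
    proof -
      have "{w \<in> space tree. mass n w < 1 / 2} \<in> sets tree"
        by measurable
      from tree.prob_neg[OF this] show ?thesis
        by (simp only: not_less A_def space_tree UNIV_I simp_thms)
    qed
    finally show "measure tree {w. mass n w < 1 / 2} \<le> 1 - 1 / (4 * L)"
      by simp
  qed
qed

text \<open>If the right subtree has mass at least 1/2, the negative power of the sum is at most
  \<open>2 powr q\<close>; otherwise only the left subtree is kept. The smallness of the right one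
  is independent of the left one, so the recursion gains the probability of smallness as a
  factor.\<close>

lemma tmoment_mass_Suc_neg:
  assumes q: "0 < q"
  shows "tmoment (mass (Suc n)) (- q) \<le> ennreal (2 powr q * moment (- q)) *
    (ennreal (2 powr q) + ennreal (measure tree {w. mass n w < 1 / 2}) * tmoment (mass n) (- q))"
proof -
  let ?A = "{w. mass n w < 1 / 2}"
  have A [measurable]: "?A \<in> sets tree"
  proof -
    have "{w \<in> space tree. mass n w < 1 / 2} \<in> sets tree"
      by measurable
    then show ?thesis
      by simp
  qed
  let ?f = "\<lambda>w. ennreal ((w [] / 2) powr (- q))"
  let ?g = "\<lambda>w. ennreal (mass n (subtree False w) powr (- q))"
  let ?h = "\<lambda>w. indicator ?A (subtree True w) :: ennreal"
  have "tmoment (mass (Suc n)) (- q) \<le> (\<integral>\<^sup>+w. ennreal (2 powr q) * ?f w + ?f w * (?g w * ?h w) \<partial>tree)"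
    unfolding tmoment_def
  proof (rule nn_integral_mono_AE)
    show "AE w in tree. ennreal (mass (Suc n) w powr (- q)) \<le> ennreal (2 powr q) * ?f w + ?f w * (?g w * ?h w)"
      using AE_pos_tree
    proof eventually_elim
      case (elim w)
      define a b c where "a = mass n (subtree False w)" and "b = mass n (subtree True w)" and "c = w [] / 2"
      have nn: "0 < a" "0 < b" "0 < c"
        unfolding a_def b_def c_def using elim
        by (auto intro!: mass_pos pos_tree_subtree) (simp add: pos_tree_def)
      have "(a + b) powr (- q) \<le> 2 powr q + a powr (- q) * indicator ?A (subtree True w)"
      proof (cases "b < 1 / 2")
        case True
        have "(a + b) powr (- q) \<le> a powr (- q)"
          using nn q by (intro powr_mono2') auto
        moreover have "0 \<le> 2 powr q" "subtree True w \<in> ?A"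
          using True by (simp_all add: b_def)
        ultimately show ?thesis
          by (simp only: indicator_simps)
      next
        case False
        have "(a + b) powr (- q) \<le> (1 / 2) powr (- q)"
          using nn q False by (intro powr_mono2') auto
        then show ?thesis
          using False by (simp add: powr_minus powr_divide b_def indicator_def)
      qed
      then have "c powr (- q) * (a + b) powr (- q) \<le>
          c powr (- q) * (2 powr q + a powr (- q) * indicator ?A (subtree True w))"
        by (intro mult_left_mono) auto
      then have "(c * (a + b)) powr (- q) \<le>
          2 powr q * c powr (- q) + c powr (- q) * (a powr (- q) * indicator ?A (subtree True w))"
        unfolding powr_mult
        by (simp only: distrib_left mult.commute[of "2 powr q"])
      then have "ennreal ((c * (a + b)) powr (- q)) \<le>
          ennreal (2 powr q * c powr (- q) + c powr (- q) * (a powr (- q) * indicator ?A (subtree True w)))"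
        by (rule ennreal_leI)
      also have "\<dots> = ennreal (2 powr q) * ennreal (c powr (- q)) +
          ennreal (c powr (- q)) * (ennreal (a powr (- q)) * ?h w)"
        using nn by (simp add: ennreal_plus ennreal_mult ennreal_indicator)
      finally show ?case
        by (simp add: a_def b_def c_def mass_Suc)
    qed
  qed
  also have "\<dots> = ennreal (2 powr q) * (\<integral>\<^sup>+w. ?f w \<partial>tree) + (\<integral>\<^sup>+w. ?f w * (?g w * ?h w) \<partial>tree)"
    by (subst nn_integral_add) (auto simp: nn_integral_cmult)
  also have "(\<integral>\<^sup>+w. ?f w * (?g w * ?h w) \<partial>tree) =
      (\<integral>\<^sup>+x. ennreal ((x / 2) powr (- q)) \<partial>\<nu>) *
      ((\<integral>\<^sup>+w. ennreal (mass n w powr (- q)) \<partial>tree) * (\<integral>\<^sup>+w. indicator ?A w \<partial>tree))"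
    by (rule nn_integral_tree_split[of "\<lambda>x. ennreal ((x / 2) powr (- q))"
          "\<lambda>w. ennreal (mass n w powr (- q))" "indicator ?A"]) measurable
  also have "(\<integral>\<^sup>+w. ?f w \<partial>tree) = (\<integral>\<^sup>+x. ennreal ((x / 2) powr (- q)) \<partial>\<nu>)"
    by (rule nn_integral_root) measurable
  also have "(\<integral>\<^sup>+w. indicator ?A w \<partial>tree) = ennreal (measure tree ?A)"
    by (simp only: nn_integral_indicator[OF A] tree.emeasure_eq_measure)
  finally show ?thesis
    unfolding nn_integral_half_moment tmoment_def[symmetric]
    by (simp add: algebra_simps)
qed

text \<open>The recursion contracts for small q: as q tends to 0, the moment of order -q tends to 1,
  while the probability of a small mass stays below 1 - c.\<close>

lemma mass_moment_neg_start:
  assumes P: "0 < scaling P" "1 < P"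
  obtains q B where "0 < q" "\<And>n. tmoment (mass n) (- q) \<le> ennreal B" "0 \<le> B"
proof -
  obtain c where c: "0 < c" "\<And>n. measure tree {w. mass n w < 1 / 2} \<le> 1 - c"
    using mass_small_prob[OF P] by blast
  have c1: "c \<le> 1"
    using c(2)[of 0] measure_nonneg[of tree "{w. mass 0 w < 1 / 2}"] by linarith
  have "((\<lambda>q. 2 powr q * moment (- q) * (1 - c)) \<longlongrightarrow> 2 powr 0 * moment (- 0) * (1 - c)) (at_right 0)"
  proof (intro tendsto_intros)
    have "isCont moment 0"
      using DERIV_isCont[OF has_real_derivative_moment] .
    moreover have "((\<lambda>q::real. - q) \<longlongrightarrow> 0) (at_right 0)"
      using tendsto_minus[OF tendsto_ident_at, of "0::real" "{0<..}"] by simp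
    ultimately show "((\<lambda>q. moment (- q)) \<longlongrightarrow> moment (- 0)) (at_right 0)"
      by (simp add: isCont_tendsto_compose)
  qed auto
  then have "\<forall>\<^sub>F q in at_right 0. 2 powr q * moment (- q) * (1 - c) < 1"
    by (rule order_tendstoD) (use c in \<open>simp add: moment_0\<close>)
  moreover have "\<forall>\<^sub>F q in at_right (0::real). 0 < q"
    by (simp add: eventually_at_right_less)
  ultimately have "\<forall>\<^sub>F q in at_right 0. 0 < q \<and> 2 powr q * moment (- q) * (1 - c) < 1"
    by eventually_elim auto
  then obtain q where q: "0 < q" "2 powr q * moment (- q) * (1 - c) < 1"
    by (metis (mono_tags, lifting) eventually_happens' trivial_limit_at_right_real)
  define a where "a = 2 powr q * moment (- q)"
  have a: "0 < a" "a * (1 - c) < 1"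
    using q moment_pos[of "- q"] by (auto simp: a_def)
  have rec: "tmoment (mass (Suc n)) (- q) \<le> ennreal (a * (1 - c)) * tmoment (mass n) (- q) + ennreal (a * 2 powr q)" for n
  proof -
    have "tmoment (mass (Suc n)) (- q) \<le> ennreal a *
      (ennreal (2 powr q) + ennreal (measure tree {w. mass n w < 1 / 2}) * tmoment (mass n) (- q))"
      unfolding a_def by (rule tmoment_mass_Suc_neg[OF q(1)])
    also have "\<dots> \<le> ennreal a * (ennreal (2 powr q) + ennreal (1 - c) * tmoment (mass n) (- q))"
      using c by (intro mult_left_mono add_left_mono mult_right_mono ennreal_leI) auto
    also have "\<dots> = ennreal (a * (1 - c)) * tmoment (mass n) (- q) + ennreal (a * 2 powr q)"
      using a c1 by (simp add: ennreal_mult distrib_left ac_simps)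
    finally show ?thesis .
  qed
  obtain B where "\<And>n. tmoment (mass n) (- q) \<le> ennreal B" "0 \<le> B"
    by (rule affine_recursion_bounded[of "\<lambda>n. tmoment (mass n) (- q)" "moment (- q)" "a * (1 - c)" "a * 2 powr q"])
       (use rec a c1 in \<open>auto simp: tmoment_mass_initial\<close>)
  with q that show ?thesis
    by blast
qed

text \<open>From (a + b)^2 \<ge> a b, the order -2q of a sum splits into the order -q of each
  summand. By independence one level thus doubles the order of a finite negative moment.\<close>

lemma tmoment_mass_Suc_neg_double:
  assumes q: "0 < q"
  shows "tmoment (mass (Suc n)) (- (2 * q)) \<le>
    ennreal (2 powr (2 * q) * moment (- (2 * q))) * (tmoment (mass n) (- q) * tmoment (mass n) (- q))"
proof -
  let ?f = "\<lambda>w. ennreal ((w [] / 2) powr (- (2 * q)))"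
  let ?g = "\<lambda>b w. ennreal (mass n (subtree b w) powr (- q))"
  have "tmoment (mass (Suc n)) (- (2 * q)) \<le> (\<integral>\<^sup>+w. ?f w * (?g False w * ?g True w) \<partial>tree)"
    unfolding tmoment_def
  proof (rule nn_integral_mono_AE)
    show "AE w in tree. ennreal (mass (Suc n) w powr (- (2 * q))) \<le> ?f w * (?g False w * ?g True w)"
      using AE_pos_tree
    proof eventually_elim
      case (elim w)
      define a b c where "a = mass n (subtree False w)" and "b = mass n (subtree True w)" and "c = w [] / 2"
      have nn: "0 < a" "0 < b" "0 < c"
        unfolding a_def b_def c_def using elim
        by (auto intro!: mass_pos pos_tree_subtree) (simp add: pos_tree_def)
      have "(a + b) powr (- (2 * q)) = ((a + b) powr 2) powr (- q)"
        by (simp add: powr_powr)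
      also have "(a + b) powr 2 = (a + b)\<^sup>2"
        using nn powr_realpow[of "a + b" 2] by simp
      also have "((a + b)\<^sup>2) powr (- q) \<le> (a * b) powr (- q)"
      proof (rule powr_mono2')
        have "0 \<le> a * a" "0 \<le> b * b" "0 \<le> a * b"
          using nn by simp_all
        then show "a * b \<le> (a + b)\<^sup>2"
          by (simp add: power2_eq_square algebra_simps)
      qed (use nn q in auto)
      finally have "c powr (- (2 * q)) * (a + b) powr (- (2 * q)) \<le> c powr (- (2 * q)) * (a * b) powr (- q)"
        by (intro mult_left_mono) auto
      then have "(c * (a + b)) powr (- (2 * q)) \<le> c powr (- (2 * q)) * (a powr (- q) * b powr (- q))"
        using nn by (simp add: powr_mult)
      then have "ennreal ((c * (a + b)) powr (- (2 * q))) \<le> ennreal (c powr (- (2 * q)) * (a powr (- q) * b powr (- q)))"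
        by (rule ennreal_leI)
      then show ?case
        by (simp add: a_def b_def c_def mass_Suc ennreal_mult)
    qed
  qed
  also have "\<dots> = (\<integral>\<^sup>+x. ennreal ((x / 2) powr (- (2 * q))) \<partial>\<nu>) * (tmoment (mass n) (- q) * tmoment (mass n) (- q))"
    unfolding tmoment_def
    by (rule nn_integral_tree_split[of "\<lambda>x. ennreal ((x / 2) powr (- (2 * q)))"
          "\<lambda>w. ennreal (mass n w powr (- q))" "\<lambda>w. ennreal (mass n w powr (- q))"]) measurable
  finally show ?thesis
    unfolding nn_integral_half_moment by simp
qed

text \<open>Negative orders are reached by doubling the small order q until it passes -s; s then
  lies between that order and 0.\<close>

lemma mass_moment_bounded:
  assumes P: "0 < scaling P" "1 < P" and s: "s \<le> P"
  obtains B where "\<And>n. tmoment (mass n) s \<le> ennreal B" "0 \<le> B"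
proof (cases "0 \<le> s")
  case True
  with mass_moment_pos_bounded[OF P(1) _ s] that show ?thesis
    by blast
next
  case False
  obtain q B where q: "0 < q" "\<And>n. tmoment (mass n) (- q) \<le> ennreal B" "0 \<le> B"
    using mass_moment_neg_start[OF P] by blast
  have "\<exists>B. (\<forall>n. tmoment (mass n) (- (2 ^ k * q)) \<le> ennreal B) \<and> 0 \<le> B" for k :: nat
  proof (induction k)
    case 0
    then show ?case
      using q by auto
  next
    case (Suc k)
    then obtain B where B: "\<And>n. tmoment (mass n) (- (2 ^ k * q)) \<le> ennreal B" "0 \<le> B"
      by auto
    define t where "t = 2 ^ k * q"
    have t: "0 < t"
      using q by (simp add: t_def)
    \<comment> \<open>Level 0 has no level below it to which the doubling could apply; there the
      moment is that of the weight itself, hence the maximum.\<close>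
    define B' where "B' = max (moment (- (2 * t))) (2 powr (2 * t) * moment (- (2 * t)) * (B * B))"
    have "tmoment (mass n) (- (2 * t)) \<le> ennreal B'" for n
    proof (cases n)
      case 0
      then show ?thesis
        by (simp add: tmoment_mass_initial B'_def ennreal_leI)
    next
      case (Suc m)
      have "tmoment (mass n) (- (2 * t)) \<le>
          ennreal (2 powr (2 * t) * moment (- (2 * t))) * (tmoment (mass m) (- t) * tmoment (mass m) (- t))"
        unfolding Suc by (rule tmoment_mass_Suc_neg_double[OF t])
      also have "\<dots> \<le> ennreal (2 powr (2 * t) * moment (- (2 * t))) * (ennreal B * ennreal B)"
        using B by (intro mult_left_mono mult_mono) (auto simp: t_def)
      also have "\<dots> = ennreal (2 powr (2 * t) * moment (- (2 * t)) * (B * B))"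
        using B moment_pos[of "- (2 * t)"] by (simp add: ennreal_mult)
      also have "\<dots> \<le> ennreal B'"
        by (simp add: B'_def ennreal_leI)
      finally show ?thesis .
    qed
    moreover have "0 \<le> B'"
      using moment_pos[of "- (2 * t)"] by (simp add: B'_def le_max_iff_disj)
    ultimately show ?case
      by (intro exI[of _ B']) (auto simp: t_def mult.assoc)
  qed
  moreover obtain k :: nat where "- s / q < 2 ^ k"
    using real_arch_pow[of 2 "- s / q"] by auto
  ultimately obtain B where B: "\<And>n. tmoment (mass n) (- (2 ^ k * q)) \<le> ennreal B" "0 \<le> B"
    by blast
  have "- (2 ^ k * q) \<le> s"
    using \<open>- s / q < 2 ^ k\<close> q by (simp add: field_simps)
  have "tmoment (mass n) s \<le> ennreal (B + 1)" for n
  proof -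
    have "tmoment (mass n) s \<le> tmoment (mass n) (- (2 ^ k * q)) + tmoment (mass n) 0"
      using False \<open>- (2 ^ k * q) \<le> s\<close> by (intro tmoment_mono_interp AE_mass_nonneg) auto
    also have "\<dots> \<le> ennreal B + 1"
      using B by (intro add_mono) (auto simp: tmoment_0_le)
    finally show ?thesis
      using B by (simp add: ennreal_plus)
  qed
  with B that[of "B + 1"] show ?thesis
    by simp
qed

end

text \<open>Almost sure convergence is an assumption of this locale; it is discharged later from the
  weak convergence of the cascade measures, by equality in law.\<close>

locale nondegenerate_cascade = cascade_weight +
  fixes P :: real
  assumes P_gt_1: "1 < P" and scaling_P_pos: "0 < scaling P"
    and AE_convergent_mass: "AE w in tree. convergent (\<lambda>n. mass n w)"
begin

definition lmass :: "(bool list \<Rightarrow> real) \<Rightarrow> real" where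
  "lmass w = lim (\<lambda>n. mass n w)"

lemma measurable_lmass [measurable]: "lmass \<in> borel_measurable tree"
  unfolding lmass_def by (rule borel_measurable_lim_metric) measurable

text \<open>Fatou, stated for the lower limit of the powers: until the limit mass is known to be
  positive, a negative power of it is not the limit of the powers.\<close>

lemma nn_integral_liminf_mass_le:
  assumes "s \<le> P"
  shows "(\<integral>\<^sup>+w. liminf (\<lambda>n. ennreal (mass n w powr s)) \<partial>tree) < \<infinity>"
proof -
  obtain B where B: "\<And>n. tmoment (mass n) s \<le> ennreal B"
    using mass_moment_bounded[OF scaling_P_pos P_gt_1 assms] by blast
  have "(\<integral>\<^sup>+w. liminf (\<lambda>n. ennreal (mass n w powr s)) \<partial>tree) \<le> liminf (\<lambda>n. tmoment (mass n) s)"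
    unfolding tmoment_def by (rule nn_integral_liminf) measurable
  also have "\<dots> \<le> liminf (\<lambda>n. ennreal B)"
    by (rule Liminf_mono) (simp add: B)
  also have "\<dots> < \<infinity>"
    by (simp add: Liminf_const)
  finally show ?thesis .
qed

lemma AE_mass_tendsto: "AE w in tree. (\<lambda>n. mass n w) \<longlonglongrightarrow> lmass w"
  using AE_convergent_mass by eventually_elim (simp add: lmass_def convergent_LIMSEQ_iff)

text \<open>A vanishing limit would drive the inverse masses to infinity, which the finite lower
  limit of the power of order -1 excludes.\<close>

lemma AE_lmass_pos: "AE w in tree. 0 < lmass w"
proof -
  have "AE w in tree. liminf (\<lambda>n. ennreal (mass n w powr (- 1))) \<noteq> \<infinity>"
    by (rule nn_integral_PInf_AE) (use nn_integral_liminf_mass_le[of "- 1"] P_gt_1 in auto)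
  then show ?thesis
    using AE_mass_tendsto AE_pos_tree
  proof eventually_elim
    case (elim w)
    have "0 \<le> lmass w"
      using elim(2) by (rule LIMSEQ_le_const) (use elim(3) in \<open>auto intro: less_imp_le mass_pos\<close>)
    moreover have "lmass w \<noteq> 0"
    proof
      assume "lmass w = 0"
      with elim(2) have "filterlim (\<lambda>n. mass n w) (at_right 0) sequentially"
        using mass_pos[OF elim(3)] by (auto simp: filterlim_at less_imp_neq[symmetric] intro!: always_eventually)
      then have "filterlim (\<lambda>n. inverse (mass n w)) at_top sequentially"
        by (rule filterlim_compose[OF filterlim_inverse_at_top_right])
      then have "((\<lambda>n. ennreal (inverse (mass n w))) \<longlongrightarrow> \<infinity>) sequentially"
        by (simp add: ennreal_tendsto_top_eq_at_top)
      then have "liminf (\<lambda>n. ennreal (inverse (mass n w))) = \<infinity>"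
        by (intro lim_imp_Liminf) auto
      moreover have "mass n w powr (- 1) = inverse (mass n w)" for n
        using mass_pos[OF elim(3), of n] by (simp add: powr_minus)
      ultimately show False
        using elim(1) by simp
    qed
    ultimately show ?case
      by simp
  qed
qed

lemma tmoment_lmass_finite:
  assumes "s \<le> P"
  shows "tmoment lmass s < \<infinity>"
proof -
  have "tmoment lmass s = (\<integral>\<^sup>+w. liminf (\<lambda>n. ennreal (mass n w powr s)) \<partial>tree)"
    unfolding tmoment_def
  proof (rule nn_integral_cong_AE)
    show "AE w in tree. ennreal (lmass w powr s) = liminf (\<lambda>n. ennreal (mass n w powr s))"
      using AE_mass_tendsto AE_lmass_pos
    proof eventually_elim
      case (elim w)
      then have "(\<lambda>n. ennreal (mass n w powr s)) \<longlonglongrightarrow> ennreal (lmass w powr s)"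
        by (auto intro!: tendsto_intros)
      then show ?case
        by (intro lim_imp_Liminf[symmetric]) auto
    qed
  qed
  with nn_integral_liminf_mass_le[OF assms] show ?thesis
    by simp
qed

lemma tmoment_lmass_nonzero: "tmoment lmass s \<noteq> 0"
proof
  assume "tmoment lmass s = 0"
  then have "AE w in tree. ennreal (lmass w powr s) = 0"
    unfolding tmoment_def by (subst (asm) nn_integral_0_iff_AE) auto
  then have "AE w in tree. False"
    using AE_lmass_pos by eventually_elim auto
  then show False
    by simp
qed

end

section \<open>Partition sums\<close>

text \<open>The terms rescaled by \<open>2 powr (- (a + \<delta>) * j)\<close> have summable
  expectations, so their series converges almost surely and its terms are eventually below
  1.\<close>

lemma AE_eventually_le_geometric:
  fixes F :: "nat \<Rightarrow> 'a \<Rightarrow> real"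
  assumes [measurable]: "\<And>j. F j \<in> borel_measurable M"
    and le: "\<And>j. (\<integral>\<^sup>+\<omega>. ennreal (F j \<omega>) \<partial>M) \<le> ennreal (C * 2 powr (a * real j))"
    and \<delta>: "0 < \<delta>" and C: "0 \<le> C"
  shows "AE \<omega> in M. \<forall>\<^sub>F j in sequentially. F j \<omega> \<le> 2 powr ((a + \<delta>) * real j)"
proof -
  define g where "g j \<omega> = ennreal (2 powr (- ((a + \<delta>) * real j))) * ennreal (F j \<omega>)" for j \<omega>
  have [measurable]: "g j \<in> borel_measurable M" for j
    unfolding g_def by measurable
  have int_g: "(\<integral>\<^sup>+\<omega>. g j \<omega> \<partial>M) \<le> ennreal (C * (2 powr (- \<delta>)) ^ j)" for j
  proof -
    have "(\<integral>\<^sup>+\<omega>. g j \<omega> \<partial>M) = ennreal (2 powr (- ((a + \<delta>) * real j))) * (\<integral>\<^sup>+\<omega>. ennreal (F j \<omega>) \<partial>M)"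
      unfolding g_def by (rule nn_integral_cmult) auto
    also have "\<dots> \<le> ennreal (2 powr (- ((a + \<delta>) * real j))) * ennreal (C * 2 powr (a * real j))"
      by (intro mult_left_mono le) auto
    also have "\<dots> = ennreal (C * (2 powr (- ((a + \<delta>) * real j)) * 2 powr (a * real j)))"
      using C by (simp add: mult.assoc mult.left_commute flip: ennreal_mult)
    also have "2 powr (- ((a + \<delta>) * real j)) * 2 powr (a * real j) = (2 powr (- \<delta>)) ^ j"
      by (simp add: powr_realpow[symmetric] powr_powr algebra_simps flip: powr_add)
    finally show ?thesis .
  qed
  have sm: "summable (\<lambda>j. C * (2 powr (- \<delta>)) ^ j)"
    using \<delta> by (intro summable_mult summable_geometric) (simp add: powr_less_one)
  have "(\<integral>\<^sup>+\<omega>. (\<Sum>j. g j \<omega>) \<partial>M) = (\<Sum>j. \<integral>\<^sup>+\<omega>. g j \<omega> \<partial>M)"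
    by (rule nn_integral_suminf) auto
  also have "\<dots> \<le> (\<Sum>j. ennreal (C * (2 powr (- \<delta>)) ^ j))"
    by (intro suminf_le int_g) auto
  also have "\<dots> = ennreal (\<Sum>j. C * (2 powr (- \<delta>)) ^ j)"
    using C by (intro suminf_ennreal2 sm) auto
  also have "\<dots> < \<infinity>"
    by simp
  finally have "AE \<omega> in M. (\<Sum>j. g j \<omega>) \<noteq> \<infinity>"
    by (intro nn_integral_PInf_AE) auto
  then show ?thesis
  proof eventually_elim
    case (elim \<omega>)
    moreover have "ennreal (enn2real (g j \<omega>)) = g j \<omega>" for j
      by (simp add: g_def ennreal_mult_less_top)
    ultimately have "summable (\<lambda>j. enn2real (g j \<omega>))"
      by (intro summable_suminf_not_top) auto
    then have "(\<lambda>j. enn2real (g j \<omega>)) \<longlonglongrightarrow> 0"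
      by (rule summable_LIMSEQ_zero)
    then have "\<forall>\<^sub>F j in sequentially. enn2real (g j \<omega>) < 1"
      by (rule order_tendstoD) simp
    then show ?case
    proof eventually_elim
      case (elim j)
      show ?case
      proof (cases "0 \<le> F j \<omega>")
        case True
        then have "2 powr (- ((a + \<delta>) * real j)) * F j \<omega> < 1"
          using elim by (simp add: g_def flip: ennreal_mult)
        then have "F j \<omega> / 2 powr ((a + \<delta>) * real j) < 1"
          by (simp only: powr_minus divide_inverse mult.commute)
        then show ?thesis
          by (simp add: pos_divide_less_eq)
      next
        case False
        then show ?thesis
          by (meson less_imp_le linorder_not_le order.trans powr_ge_zero)
      qed
    qed
  qed
qed

text \<open>The constant is 1 / (1 + 1/4), from 1 / (1 + x) = 1 - x / (1 + x) on [0, 1/4].\<close>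

lemma exp_minus_le: "0 \<le> x \<Longrightarrow> x \<le> 1 / 4 \<Longrightarrow> exp (- x) \<le> 1 - 4 / 5 * (x::real)"
proof -
  assume x: "0 \<le> x" "x \<le> 1 / 4"
  have "exp (- x) = 1 / exp x"
    by (simp add: exp_minus divide_inverse)
  also have "\<dots> \<le> 1 / (1 + x)"
    using x exp_ge_add_one_self[of x] by (intro divide_left_mono) auto
  also have "\<dots> \<le> 1 - 4 / 5 * x"
  proof -
    have "x * x \<le> x * (1 / 4)"
      using x by (intro mult_left_mono) auto
    then show ?thesis
      using x by (simp add: field_simps)
  qed
  finally show ?thesis .
qed

lemma (in prob_space) AE_distr_pos:
  assumes "X \<in> borel_measurable M" "distr M borel X = \<nu>" "AE x in \<nu>. (0::real) < x"
  shows "AE \<omega> in M. 0 < X \<omega>"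
  using assms AE_distr_iff[of X M borel "\<lambda>x. 0 < x"] by auto

context nondegenerate_cascade
begin

text \<open>Sum over the words of length j of the p-th powers of the limit masses there, without the
  interval length. The weight at the end of a word is contained in \<open>lmass\<close> of the
  subtree.\<close>

definition psum :: "real \<Rightarrow> nat \<Rightarrow> (bool list \<Rightarrow> real) \<Rightarrow> real" where
  "psum p = branch (\<lambda>x. x powr p) (\<lambda>w. lmass w powr p)"

definition mass_moment :: "real \<Rightarrow> real" where
  "mass_moment p = enn2real (tmoment lmass p)"

text \<open>\<open>psum\<close> divided by its expectation. The normalisation is distributed over
  the factors so that the recursions for \<open>branch\<close> apply directly.\<close>

definition npsum :: "real \<Rightarrow> nat \<Rightarrow> (bool list \<Rightarrow> real) \<Rightarrow> real" where
  "npsum p = branch (\<lambda>x. x powr p / (2 * moment p)) (\<lambda>w. lmass w powr p / mass_moment p)"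

lemma measurable_psum [measurable]: "psum p j \<in> borel_measurable tree"
  unfolding psum_def by measurable

lemma measurable_npsum [measurable]: "npsum p j \<in> borel_measurable tree"
  unfolding npsum_def by measurable

lemma tmoment_lmass_eq: "p \<le> P \<Longrightarrow> tmoment lmass p = ennreal (mass_moment p)"
  unfolding mass_moment_def using tmoment_lmass_finite[of p] by simp

lemma mass_moment_pos: "p \<le> P \<Longrightarrow> 0 < mass_moment p"
  unfolding mass_moment_def using tmoment_lmass_finite[of p] tmoment_lmass_nonzero[of p]
  by (simp add: enn2real_positive_iff zero_less_iff_neq_zero)

lemma psum_eq_npsum:
  assumes "p \<le> P"
  shows "psum p j w = (2 * moment p) ^ j * mass_moment p * npsum p j w"
proof (induction j arbitrary: w)
  case 0
  show ?case
    using mass_moment_pos[OF assms] by (simp add: psum_def npsum_def)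
next
  case (Suc j)
  have "psum p (Suc j) w = w [] powr p * (psum p j (subtree False w) + psum p j (subtree True w))"
    by (simp add: psum_def)
  also have "\<dots> = w [] powr p * ((2 * moment p) ^ j * mass_moment p * (npsum p j (subtree False w) + npsum p j (subtree True w)))"
    by (simp add: Suc distrib_left)
  also have "\<dots> = (2 * moment p) ^ Suc j * mass_moment p *
      (w [] powr p / (2 * moment p) * (npsum p j (subtree False w) + npsum p j (subtree True w)))"
    using moment_pos[of p] by simp
  finally show ?case
    by (simp add: npsum_def)
qed

lemma psum_nonneg: "0 \<le> psum p j w"
  by (induction j arbitrary: w) (simp_all add: psum_def)

lemma npsum_nonneg: "p \<le> P \<Longrightarrow> 0 \<le> npsum p j w"
proof (induction j arbitrary: w)
  case (Suc j)
  then show ?case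
    using moment_pos[of p] by (simp add: npsum_def)
qed (use mass_moment_pos in \<open>simp add: npsum_def less_imp_le\<close>)

lemma tmoment_npsum_1:
  assumes p: "p \<le> P"
  shows "tmoment (npsum p j) 1 = 1"
proof (induction j)
  case 0
  have "tmoment (npsum p 0) 1 = (\<integral>\<^sup>+w. ennreal (1 / mass_moment p) * ennreal (lmass w powr p) \<partial>tree)"
    unfolding tmoment_def npsum_def using mass_moment_pos[OF p]
    by (intro nn_integral_cong) (simp flip: ennreal_mult)
  also have "\<dots> = ennreal (1 / mass_moment p) * tmoment lmass p"
    unfolding tmoment_def by (rule nn_integral_cmult) auto
  also have "\<dots> = 1"
    unfolding tmoment_lmass_eq[OF p] using mass_moment_pos[OF p] by (simp flip: ennreal_mult)
  finally show ?case .
next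
  case (Suc j)
  have "(\<integral>\<^sup>+x. ennreal (x powr p / (2 * moment p)) \<partial>\<nu>) =
      (\<integral>\<^sup>+x. ennreal (1 / (2 * moment p)) * ennreal (x powr p) \<partial>\<nu>)"
    using moment_pos[of p] by (intro nn_integral_cong) (simp flip: ennreal_mult)
  also have "\<dots> = ennreal (1 / (2 * moment p)) * ennreal (moment p)"
    unfolding nn_integral_moment[symmetric] by (rule nn_integral_cmult) auto
  also have "\<dots> = ennreal (1 / 2)"
    using moment_pos[of p] by (simp flip: ennreal_mult)
  finally have *: "2 * (\<integral>\<^sup>+x. ennreal (x powr p / (2 * moment p)) \<partial>\<nu>) = ennreal 2 * ennreal (1 / 2)"
    by simp
  also have "\<dots> = 1"
    by (subst ennreal_mult[symmetric]) auto
  finally have *: "2 * (\<integral>\<^sup>+x. ennreal (x powr p / (2 * moment p)) \<partial>\<nu>) = 1" .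
  have "tmoment (npsum p (Suc j)) 1 =
      2 * (\<integral>\<^sup>+x. ennreal (x powr p / (2 * moment p)) \<partial>\<nu>) * tmoment (npsum p j) 1"
    unfolding npsum_def using moment_pos[of p] mass_moment_pos[OF p]
    by (intro tmoment_branch_1) (auto simp: less_imp_le)
  then show ?case
    using * Suc by simp
qed

text \<open>With s = 1 + \<eta> the coefficient of the recursion is 2^(s \<tau>(p) - \<tau>(p s)),
  which the hypothesis bounds by \<open>\<theta>\<close>. The inhomogeneous term stays bounded
  because it involves the mean, which is 1, and the order \<eta> \<le> 1, at most 2.\<close>

lemma tmoment_npsum_bounded:
  assumes \<eta>: "0 < \<eta>" "\<eta> \<le> 1" and p: "p \<le> P" "p * (1 + \<eta>) \<le> P" and "0 < \<beta>"
    and \<beta>: "(1 + \<eta>) * scaling p - scaling (p * (1 + \<eta>)) \<le> \<eta> * \<beta>"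
  obtains C where "0 \<le> C" "\<And>j. tmoment (npsum p j) (1 + \<eta>) \<le> ennreal (C * 2 powr (\<eta> * \<beta> * real j))"
proof -
  define s where "s = 1 + \<eta>"
  define a where "a = moment (p * s) / (2 * moment p) powr s"
  define D where "D = a * ((2 * s * 2 powr (s - 1)) * 2)"
  define \<theta> where "\<theta> = 2 powr (\<eta> * \<beta>)"
  \<comment> \<open>Chosen so that \<open>\<theta> * E = E + D\<close>: after adding
    \<open>E\<close>, the affine recursion becomes purely multiplicative.\<close>
  define E where "E = D / (\<theta> - 1)"
  define A where "A = mass_moment (p * s) / mass_moment p powr s"
  have s: "1 < s" "s - 1 = \<eta>"
    using \<eta> by (auto simp: s_def)
  have a: "0 < a"
    using moment_pos[of p] moment_pos[of "p * s"] by (simp add: a_def)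
  have "\<theta> > 1"
    unfolding \<theta>_def using \<eta> \<open>0 < \<beta>\<close> by (intro gr_one_powr) auto
  have D: "0 \<le> D"
    using a s by (simp add: D_def)
  have E: "0 \<le> E" "\<theta> * E = E + D"
    using \<open>\<theta> > 1\<close> D by (auto simp: E_def field_simps)
  have A: "0 < A"
    using mass_moment_pos[OF p(1)] mass_moment_pos[OF p(2)] by (simp add: A_def s_def)
  have "2 * a = (2 * moment (p * s)) / (2 * moment p) powr s"
    by (simp add: a_def)
  also have "\<dots> = 2 powr (p * s - scaling (p * s)) / 2 powr ((p - scaling p) * s)"
    by (simp only: two_moment_eq powr_powr)
  also have "\<dots> = 2 powr (s * scaling p - scaling (p * s))"
    by (simp add: powr_diff[symmetric] algebra_simps)
  also have "\<dots> \<le> \<theta>"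
    unfolding \<theta>_def using \<beta> by (intro powr_mono) (auto simp: s_def)
  finally have a\<theta>: "2 * a \<le> \<theta>" .
  have \<Phi>: "(\<integral>\<^sup>+x. ennreal ((x powr p / (2 * moment p)) powr s) \<partial>\<nu>) = ennreal a"
  proof -
    have "(\<integral>\<^sup>+x. ennreal ((x powr p / (2 * moment p)) powr s) \<partial>\<nu>) =
        (\<integral>\<^sup>+x. ennreal (1 / (2 * moment p) powr s) * ennreal (x powr (p * s)) \<partial>\<nu>)"
      using moment_pos[of p]
      by (intro nn_integral_cong) (simp add: powr_divide powr_powr flip: ennreal_mult)
    also have "\<dots> = ennreal (1 / (2 * moment p) powr s) * ennreal (moment (p * s))"
      unfolding nn_integral_moment[symmetric] by (rule nn_integral_cmult) auto
    also have "\<dots> = ennreal a"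
      using moment_pos[of "p * s"] by (simp add: a_def flip: ennreal_mult)
    finally show ?thesis .
  qed
  have bound: "tmoment (npsum p j) s + ennreal E \<le> ennreal ((A + E) * \<theta> ^ j)" for j
  proof (induction j)
    case 0
    have "tmoment (npsum p 0) s = (\<integral>\<^sup>+w. ennreal (1 / mass_moment p powr s) * ennreal (lmass w powr (p * s)) \<partial>tree)"
      unfolding tmoment_def npsum_def using mass_moment_pos[OF p(1)]
      by (intro nn_integral_cong) (simp add: powr_divide powr_powr flip: ennreal_mult)
    also have "\<dots> = ennreal (1 / mass_moment p powr s) * tmoment lmass (p * s)"
      unfolding tmoment_def by (rule nn_integral_cmult) auto
    also have "\<dots> = ennreal A"
      using p mass_moment_pos[OF p(2)] by (simp add: A_def tmoment_lmass_eq s_def flip: ennreal_mult)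
    finally show ?case
      using A E by (simp flip: ennreal_plus)
  next
    case (Suc j)
    have "tmoment (npsum p (Suc j)) s \<le> ennreal a *
      (2 * tmoment (npsum p j) s +
       ennreal (2 * s * 2 powr (s - 1)) * (tmoment (npsum p j) 1 * tmoment (npsum p j) (s - 1)))"
      unfolding \<Phi>[symmetric] npsum_def using moment_pos[of p] mass_moment_pos[OF p(1)] s
      by (intro tmoment_branch_le) (auto simp: less_imp_le)
    also have "\<dots> \<le> ennreal a * (2 * tmoment (npsum p j) s + ennreal (2 * s * 2 powr (s - 1)) * (1 * 2))"
    proof (intro mult_left_mono add_left_mono mult_mono)
      have "tmoment (npsum p j) (s - 1) \<le> tmoment (npsum p j) 0 + tmoment (npsum p j) 1"
        using s \<eta> by (intro tmoment_mono_interp AE_I2 npsum_nonneg p) auto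
      also have "\<dots> \<le> 1 + 1"
        by (intro add_mono) (simp_all add: tmoment_npsum_1 p tmoment_0_le)
      finally show "tmoment (npsum p j) (s - 1) \<le> 2"
        by simp
    qed (auto simp: tmoment_npsum_1 p)
    also have "\<dots> = ennreal (2 * a) * tmoment (npsum p j) s + ennreal D"
      unfolding D_def using a s by (simp add: ennreal_mult distrib_left ac_simps)
    also have "\<dots> \<le> ennreal \<theta> * tmoment (npsum p j) s + ennreal D"
      using a\<theta> by (intro add_right_mono mult_right_mono ennreal_leI) auto
    finally have "tmoment (npsum p (Suc j)) s + ennreal E \<le> ennreal \<theta> * tmoment (npsum p j) s + ennreal D + ennreal E"
      by (rule add_right_mono)
    also have "\<dots> = ennreal \<theta> * (tmoment (npsum p j) s + ennreal E)"
      using D E \<open>\<theta> > 1\<close> by (simp add: distrib_left ennreal_mult[symmetric] add.assoc add.commute[of E] flip: ennreal_plus)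
    also have "\<dots> \<le> ennreal \<theta> * ennreal ((A + E) * \<theta> ^ j)"
      by (intro mult_left_mono Suc) auto
    also have "\<dots> = ennreal ((A + E) * \<theta> ^ Suc j)"
      using A E \<open>\<theta> > 1\<close> by (simp add: ac_simps flip: ennreal_mult)
    finally show ?case .
  qed
  show ?thesis
  proof (rule that)
    show "0 \<le> A + E"
      using A E by simp
    fix j
    have "tmoment (npsum p j) s \<le> tmoment (npsum p j) s + ennreal E"
      by simp
    also have "\<dots> \<le> ennreal ((A + E) * \<theta> ^ j)"
      by (rule bound)
    also have "\<theta> ^ j = 2 powr (\<eta> * \<beta> * real j)"
      by (simp add: \<theta>_def powr_realpow[symmetric] powr_powr)
    finally show "tmoment (npsum p j) (1 + \<eta>) \<le> ennreal ((A + E) * 2 powr (\<eta> * \<beta> * real j))"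
      by (simp add: s_def)
  qed
qed

text \<open>The difference of the two sides of the last inequality vanishes at \<eta> = 0 with
  derivative \<tau>(p) - p \<tau>'(p) - \<beta>. The condition on p leaves room for a \<beta> below
  \<chi> that makes this derivative negative.\<close>

lemma small_exponent:
  assumes p: "p < P" and chi: "0 < chi" "- chi < p * deriv scaling p - scaling p"
  obtains \<eta> \<beta> where "0 < \<eta>" "\<eta> \<le> 1" "p * (1 + \<eta>) \<le> P" "0 < \<beta>" "\<beta> < chi"
    "(1 + \<eta>) * scaling p - scaling (p * (1 + \<eta>)) \<le> \<eta> * \<beta>"
proof -
  define g where "g = scaling p - p * deriv scaling p"
  obtain \<beta> where \<beta>: "max 0 g < \<beta>" "\<beta> < chi"
    using dense[of "max 0 g" chi] chi by (auto simp: g_def)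
  define f where "f \<eta> = (1 + \<eta>) * scaling p - scaling (p * (1 + \<eta>)) - \<eta> * \<beta>" for \<eta>
  have "(f has_real_derivative g - \<beta>) (at 0)"
    unfolding f_def g_def
    by (auto intro!: derivative_eq_intros DERIV_chain2[where f = scaling] has_real_derivative_scaling)
  then obtain d where d: "0 < d" "\<And>h. 0 < h \<Longrightarrow> h < d \<Longrightarrow> f h < f 0"
    using DERIV_neg_dec_right[of f "g - \<beta>" 0] \<beta> by auto
  \<comment> \<open>The three bounds keep the order at most 2, stay where the difference is
    negative, and ensure p (1 + \<eta>) \<le> P; adding 1 to \<bar>p\<bar> covers p = 0.\<close>
  define \<eta> where "\<eta> = min (min 1 (d / 2)) ((P - p) / (\<bar>p\<bar> + 1))"
  have "0 < (P - p) / (\<bar>p\<bar> + 1)"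
    using p by (intro divide_pos_pos) auto
  then have "0 < \<eta>"
    using d by (simp add: \<eta>_def)
  moreover have "\<eta> \<le> 1" "\<eta> \<le> d / 2" "\<eta> \<le> (P - p) / (\<bar>p\<bar> + 1)"
    unfolding \<eta>_def by linarith+
  ultimately have \<eta>: "0 < \<eta>" "\<eta> \<le> 1" "\<eta> < d" "\<eta> \<le> (P - p) / (\<bar>p\<bar> + 1)"
    using d by linarith+
  have "p * \<eta> \<le> (\<bar>p\<bar> + 1) * \<eta>"
    using \<eta> by (intro mult_right_mono) auto
  also have "\<dots> \<le> P - p"
    using \<eta>(4) by (simp add: pos_le_divide_eq mult.commute)
  finally have "p * (1 + \<eta>) \<le> P"
    by (simp add: algebra_simps)
  moreover have "(1 + \<eta>) * scaling p - scaling (p * (1 + \<eta>)) \<le> \<eta> * \<beta>"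
    using d(2)[OF \<eta>(1,3)] by (simp add: f_def)
  ultimately show ?thesis
    using that[of \<eta> \<beta>] \<eta> \<beta> by auto
qed

end

section \<open>Independent cascades on a probability space\<close>

locale cascade_system = cascade_weight +
  fixes M :: "'a measure" and X :: "nat \<Rightarrow> bool list \<Rightarrow> 'a \<Rightarrow> real"
  assumes prob_space_M: "prob_space M"
    and indep_X: "prob_space.indep_vars M (\<lambda>_. borel) (\<lambda>(m, r). X m r) {(m, r). r \<noteq> []}"
    and distr_X: "\<And>m r. r \<noteq> [] \<Longrightarrow> distr M borel (X m r) = \<nu>"
begin

sublocale M: prob_space M
  by (rule prob_space_M)

abbreviation weights :: "nat \<Rightarrow> 'a \<Rightarrow> bool list \<Rightarrow> real" where
  "weights m \<omega> \<equiv> \<lambda>r. X m r \<omega>"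

text \<open>A tree carries a weight at its root, whereas \<open>X m []\<close> is unconstrained; so only the trees
  \<open>node m r\<close> with \<open>r \<noteq> []\<close> are copies of the canonical one, and a cascade consists of the two trees
  at \<open>[False]\<close> and \<open>[True]\<close>.\<close>

definition node :: "nat \<Rightarrow> bool list \<Rightarrow> 'a \<Rightarrow> bool list \<Rightarrow> real" where
  "node m r \<omega> = (\<lambda>u. X m (r @ u) \<omega>)"

lemma measurable_X: "r \<noteq> [] \<Longrightarrow> X m r \<in> borel_measurable M"
  using indep_X by (auto simp: M.indep_vars_def)

lemma measurable_node:
  assumes "r \<noteq> []"
  shows "node m r \<in> measurable M tree"
  unfolding measurable_cong_sets[OF refl sets_tree] node_def
  by (rule measurable_PiM_single') (use assms in \<open>auto simp: space_PiM measurable_X\<close>)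

lemma distr_node:
  assumes "r \<noteq> []"
  shows "distr M tree (node m r) = tree"
proof -
  have "distr M (PiM UNIV (\<lambda>_. borel)) (\<lambda>\<omega> u. (case (m, r @ u) of (m, r) \<Rightarrow> X m r) \<omega>) = PiM UNIV (\<lambda>_. \<nu>)"
    by (rule M.distr_reindexed_family[OF indep_X]) (use assms in \<open>auto simp: distr_X intro!: injI\<close>)
  then have "distr M (PiM UNIV (\<lambda>_. borel)) (node m r) = tree"
    by (simp add: tree_def node_def[abs_def])
  moreover have "distr M tree (node m r) = distr M (PiM UNIV (\<lambda>_. borel)) (node m r)"
    by (intro distr_cong) (auto simp: sets_tree)
  ultimately show ?thesis
    by simp
qed

lemma nn_integral_node:
  assumes "r \<noteq> []" "g \<in> borel_measurable tree"
  shows "(\<integral>\<^sup>+\<omega>. g (node m r \<omega>) \<partial>M) = (\<integral>\<^sup>+w. g w \<partial>tree)"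
  using nn_integral_distr[OF measurable_node[OF assms(1)], of g m] assms(2)
  by (simp add: distr_node[OF assms(1)])

lemma AE_node:
  assumes "r \<noteq> []" "AE w in tree. Q w"
  shows "AE \<omega> in M. Q (node m r \<omega>)"
  by (rule AE_distrD[OF measurable_node[OF assms(1)]]) (unfold distr_node[OF assms(1)], rule assms(2))

lemma AE_X_pos: "AE \<omega> in M. \<forall>m r. r \<noteq> [] \<longrightarrow> 0 < X m r \<omega>"
  unfolding AE_all_countable
proof (intro allI)
  fix m and r :: "bool list"
  show "AE \<omega> in M. r \<noteq> [] \<longrightarrow> 0 < X m r \<omega>"
  proof (cases "r = []")
    case False
    have "AE \<omega> in M. 0 < X m r \<omega>"
      by (rule M.AE_distr_pos[OF measurable_X[OF False] distr_X[OF False] weight_pos])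
    then show ?thesis
      by eventually_elim auto
  qed auto
qed

text \<open>One tree per cascade is enough for the lower bound, which may drop the right
  halves.\<close>

lemma nn_integral_prod_nodes:
  assumes G: "\<And>m. G m \<in> borel_measurable tree"
  shows "(\<integral>\<^sup>+\<omega>. (\<Prod>m<n. G m (node m [False] \<omega>)) \<partial>M) = (\<Prod>m<n. \<integral>\<^sup>+w. G m w \<partial>tree)"
proof -
  define B where "B m = range (\<lambda>r. (m, False # r))" for m :: nat
  define pick where "pick m x = (\<lambda>r. x (m, False # r))" for m :: nat and x :: "nat \<times> bool list \<Rightarrow> real"
  have pick: "pick m \<in> measurable (PiM (B m) (\<lambda>_. borel)) tree" for m
    unfolding measurable_cong_sets[OF refl sets_tree] pick_def
    by (rule measurable_PiM_single') (auto simp: space_PiM B_def intro!: measurable_component_singleton)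
  have pick_node: "pick m (\<lambda>i\<in>B m. (case i of (m, r) \<Rightarrow> X m r) \<omega>) = node m [False] \<omega>" for m \<omega>
    by (auto simp: pick_def B_def node_def fun_eq_iff)
  have "(\<integral>\<^sup>+\<omega>. (\<Prod>m\<in>{..<n}. G m (pick m (\<lambda>i\<in>B m. (case i of (m, r) \<Rightarrow> X m r) \<omega>))) \<partial>M) =
      (\<Prod>m\<in>{..<n}. \<integral>\<^sup>+\<omega>. G m (pick m (\<lambda>i\<in>B m. (case i of (m, r) \<Rightarrow> X m r) \<omega>)) \<partial>M)"
    by (rule M.nn_integral_prod_blocks[OF indep_X, where G = "\<lambda>m x. G m (pick m x)"])
       (auto simp: B_def disjoint_family_on_def intro!: measurable_compose[OF pick[unfolded B_def] G])
  then show ?thesis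
    by (simp add: pick_node nn_integral_node G)
qed

end

locale nondegenerate_system = cascade_system + nondegenerate_cascade
begin

abbreviation psums :: "real \<Rightarrow> nat \<Rightarrow> nat \<Rightarrow> 'a \<Rightarrow> real" where
  "psums p j n \<omega> \<equiv> (\<Sum>m<n. psum p j (node m [False] \<omega>) + psum p j (node m [True] \<omega>))"

text \<open>The number of cascades at level j + 1: depth j below the trees at \<open>[False]\<close>
  and \<open>[True]\<close> is level j + 1 of the cascade.\<close>

definition n_cascades :: "real \<Rightarrow> nat \<Rightarrow> nat" where
  "n_cascades chi j = nat \<lfloor>2 powr (real (Suc j) * chi)\<rfloor>"

lemma n_cascades_le: "real (n_cascades chi j) \<le> 2 powr (real (Suc j) * chi)"
proof -
  have "real (n_cascades chi j) = real_of_int \<lfloor>2 powr (real (Suc j) * chi)\<rfloor>"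
    by (simp add: n_cascades_def)
  then show ?thesis
    by linarith
qed

lemma n_cascades_ge:
  assumes "0 < chi"
  shows "2 powr (real j * chi) / 2 \<le> real (n_cascades chi j)"
proof -
  have "2 powr (real j * chi) \<le> 2 powr (real (Suc j) * chi)"
    using assms by (intro powr_mono) (auto simp: algebra_simps)
  moreover have "1 \<le> 2 powr (real j * chi)"
    using assms by (intro ge_one_powr_ge_zero) auto
  moreover have "2 powr (real (Suc j) * chi) - 1 < real (n_cascades chi j)"
    by (simp add: n_cascades_def)
  moreover have "1 \<le> real (n_cascades chi j)"
  proof -
    have "1 \<le> 2 powr (real (Suc j) * chi)"
      using calculation(1,2) by linarith
    then show ?thesis
      by (simp add: n_cascades_def)
  qed
  ultimately show ?thesis
    by linarith
qed

section \<open>Growth of sums over many independent cascades\<close>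

lemma psum_upper:
  assumes p: "p \<le> P" and \<delta>: "0 < \<delta>"
  shows "AE \<omega> in M. \<forall>\<^sub>F j in sequentially.
    psums p j (n_cascades chi j) \<omega>
      \<le> 2 powr ((chi + p - scaling p + \<delta>) * real j)"
proof (rule AE_eventually_le_geometric[OF _ _ \<delta>])
  note [measurable] = measurable_node
  \<comment> \<open>The factor 2 counts the two halves of each cascade, and
    \<open>2 powr chi\<close> comes from using the number of cascades of level j + 1.\<close>
  define C where "C = 2 * 2 powr chi * mass_moment p"
  show "0 \<le> C"
    using mass_moment_pos[OF p] by (simp add: C_def)
  show "(\<lambda>\<omega>. \<Sum>m<n_cascades chi j. psum p j (node m [False] \<omega>) + psum p j (node m [True] \<omega>))
      \<in> borel_measurable M" for j
    by (intro borel_measurable_sum borel_measurable_add measurable_compose[OF measurable_node measurable_psum]) auto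
  show "(\<integral>\<^sup>+\<omega>. ennreal (psums p j (n_cascades chi j) \<omega>) \<partial>M)
      \<le> ennreal (C * 2 powr ((chi + p - scaling p) * real j))" for j
  proof -
    define e where "e = (2 * moment p) ^ j * mass_moment p"
    have e: "0 \<le> e"
      using moment_pos[of p] mass_moment_pos[OF p] by (simp add: e_def)
    have "(\<integral>\<^sup>+w. ennreal (psum p j w) \<partial>tree) = (\<integral>\<^sup>+w. ennreal e * ennreal (npsum p j w powr 1) \<partial>tree)"
      using e npsum_nonneg[OF p, of j]
      by (intro nn_integral_cong) (simp add: psum_eq_npsum[OF p] e_def flip: ennreal_mult)
    also have "\<dots> = ennreal e * tmoment (npsum p j) 1"
      unfolding tmoment_def by (rule nn_integral_cmult) auto
    finally have int: "(\<integral>\<^sup>+w. ennreal (psum p j w) \<partial>tree) = ennreal e"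
      by (simp add: tmoment_npsum_1[OF p])
    have "(\<integral>\<^sup>+\<omega>. ennreal (psums p j (n_cascades chi j) \<omega>) \<partial>M) =
        (\<integral>\<^sup>+\<omega>. (\<Sum>m<n_cascades chi j. ennreal (psum p j (node m [False] \<omega>)) + ennreal (psum p j (node m [True] \<omega>))) \<partial>M)"
      by (simp add: psum_nonneg sum_ennreal[symmetric] ennreal_plus del: sum_ennreal)
    also have "\<dots> = (\<Sum>m<n_cascades chi j. (\<integral>\<^sup>+\<omega>. ennreal (psum p j (node m [False] \<omega>)) \<partial>M) + (\<integral>\<^sup>+\<omega>. ennreal (psum p j (node m [True] \<omega>)) \<partial>M))"
      by (subst nn_integral_sum, intro borel_measurable_add measurable_compose[OF measurable_node] , simp, measurable)
         (intro sum.cong refl nn_integral_add measurable_compose[OF measurable_node], auto)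
    also have "\<dots> = (\<Sum>m<n_cascades chi j. ennreal e + ennreal e)"
      by (intro sum.cong refl) (simp add: nn_integral_node[of _ "\<lambda>w. ennreal (psum p j w)"] int)
    also have "\<dots> = ennreal (real (n_cascades chi j) * (2 * e))"
      using e by (simp add: ennreal_of_nat_eq_real_of_nat flip: ennreal_plus ennreal_mult)
    also have "\<dots> \<le> ennreal (2 powr (real (Suc j) * chi) * (2 * e))"
      using e by (intro ennreal_leI mult_right_mono n_cascades_le) auto
    also have "2 powr (real (Suc j) * chi) * (2 * e) = C * 2 powr ((chi + p - scaling p) * real j)"
    proof -
      have "(2 * moment p) ^ j = 2 powr ((p - scaling p) * real j)"
        by (simp only: two_moment_eq) (simp add: powr_realpow[symmetric] powr_powr)
      then show ?thesis
        by (simp add: e_def C_def algebra_simps powr_add powr_diff)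
    qed
    finally show ?thesis .
  qed
qed

text \<open>Above K the sum is at most \<open>K powr (- \<eta>)\<close> times its power of order 1 +
  \<eta>, so truncation at K removes at most 1/4 of the unit mean. With parameter 1 / (4 K) the
  exponent stays in [0, 1/4], where \<open>exp_minus_le\<close> applies, and 4/5 * 3/4 =
  3/5.\<close>

lemma truncated_laplace_le:
  assumes p: "p \<le> P" and K: "0 < K" and \<eta>: "0 < \<eta>"
    and mom: "tmoment (npsum p j) (1 + \<eta>) \<le> ennreal (K powr \<eta> / 4)"
  shows "(\<integral>\<^sup>+w. ennreal (exp (- (1 / (4 * K) * min (npsum p j w) K))) \<partial>tree) \<le> ennreal (exp (- (3 / 5) * (1 / (4 * K))))"
proof -
  define V where "V = npsum p j"
  define f where "f w = min (V w) K" for w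
  define l where "l = 1 / (4 * K)"
  have [measurable]: "V \<in> borel_measurable tree" "f \<in> borel_measurable tree"
    unfolding V_def f_def by measurable
  have V: "0 \<le> V w" for w
    unfolding V_def by (rule npsum_nonneg[OF p])
  have f: "0 \<le> f w" "f w \<le> K" for w
    using V[of w] K by (auto simp: f_def)
  have int_f: "integrable tree f"
    by (rule tree.integrable_const_bound[of _ K]) (use f in auto)
  define e where "e = (\<integral>w. f w \<partial>tree)"
  have "0 \<le> e"
    unfolding e_def using f by (intro integral_nonneg_AE) auto
  have "1 = tmoment V 1"
    unfolding V_def by (rule tmoment_npsum_1[OF p, symmetric])
  also have "\<dots> \<le> (\<integral>\<^sup>+w. ennreal (f w) + ennreal (K powr (- \<eta>)) * ennreal (V w powr (1 + \<eta>)) \<partial>tree)"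
    unfolding tmoment_def
  proof (rule nn_integral_mono)
    fix w
    have "V w \<le> f w + K powr (- \<eta>) * V w powr (1 + \<eta>)"
    proof (cases "V w \<le> K")
      case False
      have "1 = K powr (- \<eta>) * K powr \<eta>"
        using K by (simp flip: powr_add)
      also have "\<dots> \<le> K powr (- \<eta>) * V w powr \<eta>"
        using False K \<eta> by (intro mult_left_mono powr_mono2) auto
      finally have "V w * 1 \<le> V w * (K powr (- \<eta>) * V w powr \<eta>)"
        by (intro mult_left_mono V)
      also have "\<dots> = K powr (- \<eta>) * V w powr (1 + \<eta>)"
        using V[of w] by (simp add: powr_add)
      finally show ?thesis
        using f(1)[of w] by simp
    qed (simp add: f_def)
    then have "ennreal (V w) \<le> ennreal (f w + K powr (- \<eta>) * V w powr (1 + \<eta>))"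
      by (rule ennreal_leI)
    then show "ennreal (V w powr 1) \<le> ennreal (f w) + ennreal (K powr (- \<eta>)) * ennreal (V w powr (1 + \<eta>))"
      using V[of w] f(1)[of w] by (simp add: ennreal_plus ennreal_mult)
  qed
  also have "\<dots> = ennreal e + ennreal (K powr (- \<eta>)) * tmoment V (1 + \<eta>)"
    unfolding tmoment_def e_def using f
    by (simp add: nn_integral_add nn_integral_cmult nn_integral_eq_integral[OF int_f])
  also have "\<dots> \<le> ennreal e + ennreal (K powr (- \<eta>)) * ennreal (K powr \<eta> / 4)"
    using mom unfolding V_def by (intro add_left_mono mult_left_mono) auto
  also have "\<dots> = ennreal (e + K powr (- \<eta>) * (K powr \<eta> / 4))"
    using \<open>0 \<le> e\<close> by (subst ennreal_mult[symmetric]) (auto simp: ennreal_plus)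
  also have "K powr (- \<eta>) * (K powr \<eta> / 4) = 1 / 4"
    using K by (simp flip: powr_add)
  finally have "ennreal 1 \<le> ennreal (e + 1 / 4)"
    by (simp only: ennreal_1)
  then have e: "3 / 4 \<le> e"
    by (subst (asm) ennreal_le_iff) (use \<open>0 \<le> e\<close> in auto)
  have "(\<integral>\<^sup>+w. ennreal (exp (- (l * f w))) \<partial>tree) \<le> (\<integral>\<^sup>+w. ennreal (1 - 4 / 5 * (l * f w)) \<partial>tree)"
  proof (intro nn_integral_mono ennreal_leI exp_minus_le)
    fix w
    show "0 \<le> l * f w"
      using K f by (simp add: l_def)
    have "l * f w \<le> l * K"
      using K f by (intro mult_left_mono) (auto simp: l_def)
    then show "l * f w \<le> 1 / 4"
      using K by (simp add: l_def)
  qed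
  also have "\<dots> = ennreal (\<integral>w. 1 - 4 / 5 * (l * f w) \<partial>tree)"
  proof (rule nn_integral_eq_integral)
    show "AE w in tree. 0 \<le> 1 - 4 / 5 * (l * f w)"
    proof (rule AE_I2)
      fix w
      have "l * f w \<le> l * K"
        using K f by (intro mult_left_mono) (auto simp: l_def)
      then show "0 \<le> 1 - 4 / 5 * (l * f w)"
        using K by (simp add: l_def)
    qed
  qed (use int_f in auto)
  also have "(\<integral>w. 1 - 4 / 5 * (l * f w) \<partial>tree) = 1 - 4 / 5 * (l * e)"
    unfolding e_def using int_f by (simp add: tree.prob_space[unfolded space_tree])
  also have "ennreal (1 - 4 / 5 * (l * e)) \<le> ennreal (exp (- (3 / 5) * l))"
  proof (rule ennreal_leI)
    have "l * (3 / 4) \<le> l * e"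
      using e K by (intro mult_left_mono) (auto simp: l_def)
    then have "1 - 4 / 5 * (l * e) \<le> 1 + (- (3 / 5) * l)"
      by simp
    also have "\<dots> \<le> exp (- (3 / 5) * l)"
      by (rule exp_ge_add_one_self)
    finally show "1 - 4 / 5 * (l * e) \<le> exp (- (3 / 5) * l)" .
  qed
  finally show ?thesis
    by (simp add: l_def f_def V_def)
qed

text \<open>Exponential Chebyshev for the truncated sums, which only decreases them. The exponents
  combine to n l (1/2 - 3/5) = - n l / 10, and l = 1 / (4 K) gives the 40.\<close>

lemma npsum_lower_tail:
  assumes p: "p \<le> P" and K: "0 < K" and \<eta>: "0 < \<eta>"
    and mom: "tmoment (npsum p j) (1 + \<eta>) \<le> ennreal (K powr \<eta> / 4)"
  shows "measure M {\<omega> \<in> space M. (\<Sum>m<n. npsum p j (node m [False] \<omega>)) \<le> real n / 2} \<le> exp (- (real n / (40 * K)))"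
proof -
  let ?A = "{\<omega> \<in> space M. (\<Sum>m<n. npsum p j (node m [False] \<omega>)) \<le> real n / 2}"
  define l where "l = 1 / (4 * K)"
  have l: "0 < l"
    using K by (simp add: l_def)
  define G where "G w = ennreal (exp (- (l * min (npsum p j w) K)))" for w
  have [measurable]: "G \<in> borel_measurable tree"
    unfolding G_def by measurable
  have [measurable]: "(\<lambda>\<omega>. npsum p j (node m [False] \<omega>)) \<in> borel_measurable M" for m
    by (rule measurable_compose[OF measurable_node measurable_npsum]) simp
  have A: "?A \<in> sets M"
    by measurable
  have "emeasure M ?A = (\<integral>\<^sup>+\<omega>. indicator ?A \<omega> \<partial>M)"
    by (rule nn_integral_indicator[OF A, symmetric])
  also have "\<dots> \<le> (\<integral>\<^sup>+\<omega>. ennreal (exp (l * (real n / 2))) * (\<Prod>m<n. G (node m [False] \<omega>)) \<partial>M)"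
  proof (rule nn_integral_mono)
    fix \<omega>
    show "indicator ?A \<omega> \<le> ennreal (exp (l * (real n / 2))) * (\<Prod>m<n. G (node m [False] \<omega>))"
    proof (cases "\<omega> \<in> ?A")
      case True
      have "(\<Sum>m<n. min (npsum p j (node m [False] \<omega>)) K) \<le> (\<Sum>m<n. npsum p j (node m [False] \<omega>))"
        by (intro sum_mono) auto
      also have "\<dots> \<le> real n / 2"
        using True by simp
      finally have "l * (\<Sum>m<n. min (npsum p j (node m [False] \<omega>)) K) \<le> l * (real n / 2)"
        using l by (intro mult_left_mono) auto
      then have "1 \<le> exp (l * (real n / 2) - l * (\<Sum>m<n. min (npsum p j (node m [False] \<omega>)) K))"
        by simp
      also have "\<dots> = exp (l * (real n / 2)) * (\<Prod>m<n. exp (- (l * min (npsum p j (node m [False] \<omega>)) K)))"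
      proof -
        have "(\<Prod>m<n. exp (- (l * min (npsum p j (node m [False] \<omega>)) K))) =
            exp (\<Sum>m<n. - (l * min (npsum p j (node m [False] \<omega>)) K))"
          by (rule exp_sum[symmetric]) simp
        also have "(\<Sum>m<n. - (l * min (npsum p j (node m [False] \<omega>)) K)) =
            - (l * (\<Sum>m<n. min (npsum p j (node m [False] \<omega>)) K))"
          by (simp only: sum_negf sum_distrib_left)
        finally show ?thesis
          by (simp only: exp_add[symmetric] add_uminus_conv_diff)
      qed
      finally have "ennreal 1 \<le> ennreal (exp (l * (real n / 2)) * (\<Prod>m<n. exp (- (l * min (npsum p j (node m [False] \<omega>)) K))))"
        by (rule ennreal_leI)
      also have "\<dots> = ennreal (exp (l * (real n / 2))) * (\<Prod>m<n. G (node m [False] \<omega>))"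
        unfolding G_def by (subst prod_ennreal) (auto simp: ennreal_mult prod_nonneg)
      finally show ?thesis
        using True by simp
    qed simp
  qed
  also have "\<dots> = ennreal (exp (l * (real n / 2))) * (\<integral>\<^sup>+\<omega>. (\<Prod>m<n. G (node m [False] \<omega>)) \<partial>M)"
    by (intro nn_integral_cmult borel_measurable_prod_ennreal measurable_compose[OF measurable_node]) auto
  also have "(\<integral>\<^sup>+\<omega>. (\<Prod>m<n. G (node m [False] \<omega>)) \<partial>M) = (\<integral>\<^sup>+w. G w \<partial>tree) ^ n"
    by (subst nn_integral_prod_nodes) auto
  also have "ennreal (exp (l * (real n / 2))) * \<dots> \<le> ennreal (exp (l * (real n / 2))) * ennreal (exp (- (3 / 5) * l)) ^ n"
    unfolding G_def l_def by (intro mult_left_mono power_mono truncated_laplace_le[OF assms]) auto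
  also have "\<dots> = ennreal (exp (l * (real n / 2)) * exp (- (3 / 5) * l) ^ n)"
    by (simp add: ennreal_power ennreal_mult)
  also have "exp (l * (real n / 2)) * exp (- (3 / 5) * l) ^ n = exp (- (real n / (40 * K)))"
    by (simp add: l_def field_simps flip: exp_add exp_of_nat_mult)
  finally show ?thesis
    by (simp add: M.emeasure_eq_measure)
qed

lemma npsum_lower:
  assumes p: "p < P" and chi: "0 < chi" "- chi < p * deriv scaling p - scaling p"
  shows "AE \<omega> in M. \<forall>\<^sub>F j in sequentially.
    real (n_cascades chi j) / 2 < (\<Sum>m<n_cascades chi j. npsum p j (node m [False] \<omega>))"
proof -
  obtain \<eta> \<beta> where \<eta>: "0 < \<eta>" "\<eta> \<le> 1" "p * (1 + \<eta>) \<le> P" and \<beta>: "0 < \<beta>" "\<beta> < chi"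
    and \<eta>\<beta>: "(1 + \<eta>) * scaling p - scaling (p * (1 + \<eta>)) \<le> \<eta> * \<beta>"
    using small_exponent[OF p chi] by blast
  obtain C where C: "0 \<le> C" "\<And>j. tmoment (npsum p j) (1 + \<eta>) \<le> ennreal (C * 2 powr (\<eta> * \<beta> * real j))"
    using tmoment_npsum_bounded[OF \<eta>(1,2) _ \<eta>(3) \<beta>(1) \<eta>\<beta>] p by auto
  \<comment> \<open>The truncation level will be 2^(b j): b > \<beta> makes the moment condition
    hold for large j, and b < \<chi> makes the number of cascades exceed the level
    exponentially.\<close>
  obtain b where b: "\<beta> < b" "b < chi"
    using dense[OF \<beta>(2)] by blast
  define A where "A j = {\<omega> \<in> space M. (\<Sum>m<n_cascades chi j. npsum p j (node m [False] \<omega>)) \<le> real (n_cascades chi j) / 2}" for j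
  have [measurable]: "(\<lambda>\<omega>. npsum p j (node m [False] \<omega>)) \<in> borel_measurable M" for m j
    by (rule measurable_compose[OF measurable_node measurable_npsum]) simp
  have A: "A j \<in> sets M" for j
    unfolding A_def by measurable
  have "\<forall>\<^sub>F j in sequentially. 4 * C * (2 powr (\<eta> * (\<beta> - b))) ^ j \<le> 1"
  proof -
    have "(\<lambda>j. 4 * C * (2 powr (\<eta> * (\<beta> - b))) ^ j) \<longlonglongrightarrow> 4 * C * 0"
      using \<eta> b by (intro tendsto_mult tendsto_const LIMSEQ_realpow_zero) (auto simp: powr_less_one mult_pos_neg)
    then have "\<forall>\<^sub>F j in sequentially. 4 * C * (2 powr (\<eta> * (\<beta> - b))) ^ j < 1"
      by (rule order_tendstoD) simp
    then show ?thesis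
      by eventually_elim simp
  qed
  then obtain J where J: "\<And>j. J \<le> j \<Longrightarrow> 4 * C * (2 powr (\<eta> * (\<beta> - b))) ^ j \<le> 1"
    by (auto simp: eventually_sequentially)
  have le: "measure M (A j) \<le> 80 * (2 powr (b - chi)) ^ j" if "J \<le> j" for j
  proof -
    define K where "K = 2 powr (b * real j)"
    have K: "0 < K"
      by (simp add: K_def)
    have "C * 2 powr (\<eta> * \<beta> * real j) \<le> K powr \<eta> / 4"
    proof -
      have "C * 2 powr (\<eta> * \<beta> * real j) = C * (2 powr (\<eta> * (\<beta> - b))) ^ j * K powr \<eta>"
        by (simp add: K_def powr_realpow[symmetric] powr_powr mult.assoc algebra_simps flip: powr_add)
      also have "\<dots> \<le> 1 / 4 * K powr \<eta>"
        using J[OF that] by (intro mult_right_mono) auto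
      finally show ?thesis
        by simp
    qed
    then have mom: "tmoment (npsum p j) (1 + \<eta>) \<le> ennreal (K powr \<eta> / 4)"
      using C(2)[of j] by (meson ennreal_leI order.trans)
    have "measure M (A j) \<le> exp (- (real (n_cascades chi j) / (40 * K)))"
      unfolding A_def using p by (intro npsum_lower_tail[OF _ K \<eta>(1) mom]) auto
    also have "\<dots> \<le> exp (- ((2 powr (chi - b)) ^ j / 80))"
    proof -
      have "(2 powr (chi - b)) ^ j / 80 = (2 powr (real j * chi) / 2) / (40 * K)"
        by (simp add: K_def powr_realpow[symmetric] powr_powr mult.commute flip: powr_diff)
           (simp add: algebra_simps)
      also have "\<dots> \<le> real (n_cascades chi j) / (40 * K)"
        using K n_cascades_ge[OF chi(1)] by (intro divide_right_mono) auto
      finally show ?thesis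
        by simp
    qed
    \<comment> \<open>A crude bound suffices: it turns the doubly exponential decay into a geometric
      series, ready for Borel-Cantelli.\<close>
    also have "\<dots> \<le> 1 / ((2 powr (chi - b)) ^ j / 80)"
    proof -
      have "exp (- y) \<le> 1 / y" if "0 < y" for y :: real
      proof -
        have "y \<le> exp y"
          using exp_ge_add_one_self[of y] by linarith
        with that show ?thesis
          by (simp add: exp_minus field_simps)
      qed
      from this[of "(2 powr (chi - b)) ^ j / 80"] show ?thesis
        by simp
    qed
    also have "\<dots> = 80 * (2 powr (b - chi)) ^ j"
      by (simp add: powr_diff power_divide)
    finally show ?thesis .
  qed
  have "summable (\<lambda>j. measure M (A j))"
  proof (rule summable_comparison_test')
    show "summable (\<lambda>j. 80 * (2 powr (b - chi)) ^ j)"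
      using b by (intro summable_mult summable_geometric) (simp add: powr_less_one)
  qed (use le in auto)
  then have "AE \<omega> in M. \<forall>\<^sub>F j in sequentially. \<omega> \<in> space M - A j"
    by (intro borel_cantelli_AE1 A) (auto simp: M.emeasure_eq_measure)
  then show ?thesis
    by eventually_elim (auto simp: A_def elim!: eventually_mono)
qed

end

section \<open>Interval masses of the limit measure\<close>

text \<open>Portmanteau by continuous functions above and below. The approximants are measured on
  half-open intervals, which add up over cells, the limit on the closed one; both lie between the
  open and the closed interval, and the end points carry no limit mass.\<close>

lemma weak_conv_fin_interval:
  assumes conv: "weak_conv_fin Ms L"
    and Ms: "\<And>n. finite_measure (Ms n)" "\<And>n. sets (Ms n) = sets borel"
    and L: "finite_measure L" "sets L = sets borel"
    and ab: "a < b" and atoms: "measure L {a} = 0" "measure L {b} = 0"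
  shows "(\<lambda>n. measure (Ms n) {a..<b}) \<longlonglongrightarrow> measure L {a..b}"
proof -
  interpret L: finite_measure L by fact
  note [measurable_cong] = Ms(2) L(2)
  \<comment> \<open>Positive inside (a, b), zero at the end points, negative outside;
    \<open>g k\<close> and \<open>h k\<close> differ only in the value 1 or 0 taken where
    \<open>u\<close> vanishes.\<close>
  define u where "u x = min (x - a) (b - x)" for x
  define g where "g k x = max 0 (min 1 (1 + u x * real (Suc k)))" for k x
  define h where "h k x = max 0 (min 1 (u x * real (Suc k)))" for k x
  have cont: "continuous_on UNIV (g k)" "continuous_on UNIV (h k)" for k
    unfolding g_def h_def u_def by (intro continuous_intros)+
  then have [measurable]: "g k \<in> borel_measurable borel" "h k \<in> borel_measurable borel" for k
    by (auto intro: borel_measurable_continuous_onI)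
  have range: "0 \<le> g k x" "g k x \<le> 1" "0 \<le> h k x" "h k x \<le> 1" for k x
    by (auto simp: g_def h_def)
  have "bounded (range (g k))" "bounded (range (h k))" for k
    by (rule boundedI[of _ 1]; use range in force)+
  with cont conv have lim: "(\<lambda>n. \<integral>x. g k x \<partial>Ms n) \<longlonglongrightarrow> (\<integral>x. g k x \<partial>L)"
      "(\<lambda>n. \<integral>x. h k x \<partial>Ms n) \<longlonglongrightarrow> (\<integral>x. h k x \<partial>L)" for k
    unfolding weak_conv_fin_def by auto
  have int: "integrable N (g k)" "integrable N (h k)" "integrable N (indicator A :: real \<Rightarrow> real)"
    if "finite_measure N" "sets N = sets borel" "A \<in> sets borel" for N :: "real measure" and k A
  proof -
    interpret N: finite_measure N by fact
    note [measurable_cong] = that(2)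
    show "integrable N (g k)" "integrable N (h k)"
      by (rule N.integrable_const_bound[of _ 1]; use range in auto)+
    show "integrable N (indicator A :: real \<Rightarrow> real)"
      using that by (intro integrable_real_indicator) (auto simp: less_top[symmetric])
  qed
  have upper: "measure (Ms n) {a..<b} \<le> (\<integral>x. g k x \<partial>Ms n)" for n k
  proof -
    have "measure (Ms n) {a..<b} = (\<integral>x. indicator {a..<b} x \<partial>Ms n)"
      using Ms(2)[of n] sets_eq_imp_space_eq[OF Ms(2)[of n]] by simp
    also have "\<dots> \<le> (\<integral>x. g k x \<partial>Ms n)"
    proof (intro integral_mono int Ms)
      fix x
      show "indicator {a..<b} x \<le> g k x"
        by (auto simp: indicator_def g_def u_def)
    qed auto
    finally show ?thesis .
  qed
  have lower: "(\<integral>x. h k x \<partial>Ms n) \<le> measure (Ms n) {a..<b}" for n k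
  proof -
    have "(\<integral>x. h k x \<partial>Ms n) \<le> (\<integral>x. indicator {a..<b} x \<partial>Ms n)"
    proof (intro integral_mono int Ms)
      fix x
      have "h k x = 0" if "\<not> (a < x \<and> x < b)"
      proof -
        have "u x \<le> 0"
          using that by (auto simp: u_def)
        then have "u x * real (Suc k) \<le> 0"
          by (intro mult_nonpos_nonneg) auto
        then show ?thesis
          unfolding h_def by linarith
      qed
      then show "h k x \<le> indicator {a..<b} x"
        using range[of k x] by (auto simp: indicator_def)
    qed auto
    also have "\<dots> = measure (Ms n) {a..<b}"
      using Ms(2)[of n] sets_eq_imp_space_eq[OF Ms(2)[of n]] by simp
    finally show ?thesis .
  qed
  have space_L: "space L = UNIV"
    using sets_eq_imp_space_eq[OF L(2)] by simp
  \<comment> \<open>One limit for both families: c = 1 produces the indicator of the closed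
    interval, c = 0 that of the open one.\<close>
  have clamp: "(\<lambda>k. max 0 (min 1 (c + z * real (Suc k)))) \<longlonglongrightarrow> (if 0 < z then 1 else if z < 0 then 0 else c)"
    if c: "0 \<le> c" "c \<le> 1" for c z :: real
  proof (cases "z = 0")
    case False
    obtain K where "1 / \<bar>z\<bar> < real K"
      using reals_Archimedean2 by blast
    then have K: "1 < \<bar>z\<bar> * real K"
      using False by (simp add: field_simps)
    have "max 0 (min 1 (c + z * real (Suc k))) = (if 0 < z then 1 else 0)" if "K \<le> k" for k
    proof -
      have "\<bar>z\<bar> * real K \<le> \<bar>z\<bar> * real (Suc k)"
        using that by (intro mult_left_mono) auto
      with K have "1 < \<bar>z\<bar> * real (Suc k)"
        by linarith
      with c False show ?thesis
        by (cases "0 < z") (auto simp: abs_if)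
    qed
    then have "\<forall>\<^sub>F k in sequentially. max 0 (min 1 (c + z * real (Suc k))) = (if 0 < z then 1 else 0)"
      by (rule eventually_sequentiallyI)
    then have "(\<lambda>k. max 0 (min 1 (c + z * real (Suc k)))) \<longlonglongrightarrow> (if 0 < z then 1 else 0)"
      by (rule tendsto_eventually)
    then show ?thesis
      using False by (cases "0 < z") simp_all
  qed (use c in simp)
  have "(\<lambda>k. \<integral>x. g k x \<partial>L) \<longlonglongrightarrow> (\<integral>x. indicator {a..b} x \<partial>L)"
  proof (rule integral_dominated_convergence[where w = "\<lambda>_. 1"])
    have "(\<lambda>k. g k x) \<longlonglongrightarrow> indicator {a..b} x" for x
      using clamp[of 1 "u x"] unfolding g_def by (auto simp: u_def indicator_def min_def split: if_splits)
    then show "AE x in L. (\<lambda>k. g k x) \<longlonglongrightarrow> indicator {a..b} x"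
      by simp
  qed (use range in \<open>auto intro!: always_eventually\<close>)
  then have limg: "(\<lambda>k. \<integral>x. g k x \<partial>L) \<longlonglongrightarrow> measure L {a..b}"
    by (simp add: space_L)
  have "(\<lambda>k. \<integral>x. h k x \<partial>L) \<longlonglongrightarrow> (\<integral>x. indicator {a<..<b} x \<partial>L)"
  proof (rule integral_dominated_convergence[where w = "\<lambda>_. 1"])
    have "(\<lambda>k. h k x) \<longlonglongrightarrow> indicator {a<..<b} x" for x
      using clamp[of 0 "u x"] unfolding h_def by (auto simp: u_def indicator_def min_def split: if_splits)
    then show "AE x in L. (\<lambda>k. h k x) \<longlonglongrightarrow> indicator {a<..<b} x"
      by simp
  qed (use range in \<open>auto intro!: always_eventually\<close>)
  then have limh: "(\<lambda>k. \<integral>x. h k x \<partial>L) \<longlonglongrightarrow> measure L {a<..<b}"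
    by (simp add: space_L)
  have "measure L {a..b} = measure L ({a<..<b} \<union> ({a} \<union> {b}))"
    using ab by (intro arg_cong[where f = "measure L"]) auto
  also have "\<dots> = measure L {a<..<b}"
  proof (rule measure_Un_null_set)
    have "{a} \<in> null_sets L" "{b} \<in> null_sets L"
      using atoms L(2) by (auto simp: null_sets_def L.emeasure_eq_measure)
    then show "{a} \<union> {b} \<in> null_sets L"
      by (rule null_sets.Un)
  qed (simp add: L)
  finally have eq: "measure L {a<..<b} = measure L {a..b}" ..
  show ?thesis
  proof (rule order_tendstoI)
    fix y
    assume "y < measure L {a..b}"
    then have "\<forall>\<^sub>F k in sequentially. y < (\<integral>x. h k x \<partial>L)"
      using limh unfolding eq by (intro order_tendstoD(1))
    then obtain k where "y < (\<integral>x. h k x \<partial>L)"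
      by (auto simp: eventually_sequentially)
    then have "\<forall>\<^sub>F n in sequentially. y < (\<integral>x. h k x \<partial>Ms n)"
      by (rule order_tendstoD(1)[OF lim(2)])
    then show "\<forall>\<^sub>F n in sequentially. y < measure (Ms n) {a..<b}"
      by eventually_elim (use lower order.strict_trans2 in blast)
  next
    fix y
    assume "measure L {a..b} < y"
    then have "\<forall>\<^sub>F k in sequentially. (\<integral>x. g k x \<partial>L) < y"
      by (rule order_tendstoD(2)[OF limg])
    then obtain k where "(\<integral>x. g k x \<partial>L) < y"
      by (auto simp: eventually_sequentially)
    then have "\<forall>\<^sub>F n in sequentially. (\<integral>x. g k x \<partial>Ms n) < y"
      by (rule order_tendstoD(2)[OF lim(1)])
    then show "\<forall>\<^sub>F n in sequentially. measure (Ms n) {a..<b} < y"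
      by eventually_elim (use upper order.strict_trans1 in blast)
  qed
qed

section \<open>Dyadic words and masses of dyadic cells\<close>

definition path_prod :: "(bool list \<Rightarrow> real) \<Rightarrow> bool list \<Rightarrow> real" where
  "path_prod w r = (\<Prod>i\<in>{1..length r}. w (take i r))"

lemma length_dyadic_word [simp]: "length (dyadic_word j k) = j"
  by (simp add: dyadic_word_def)

lemma dyadic_word_Suc: "dyadic_word (Suc j) k = dyadic_word j (k div 2) @ [odd k]"
proof -
  have "k div 2 ^ (Suc j - i) = k div 2 div 2 ^ (j - i)" if "i \<in> set [1..<Suc j]" for i
  proof -
    have "Suc j - i = Suc (j - i)"
      using that by auto
    then show ?thesis
      by (simp add: div_mult2_eq)
  qed
  then have "map (\<lambda>i. odd (k div 2 ^ (Suc j - i))) [1..<Suc j] = map (\<lambda>i. odd (k div 2 div 2 ^ (j - i))) [1..<Suc j]"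
    by (intro map_cong) auto
  then show ?thesis
    by (simp add: dyadic_word_def)
qed

lemma path_prod_snoc: "path_prod w (r @ [b]) = path_prod w r * w (r @ [b])"
proof -
  have "{1..length (r @ [b])} = insert (Suc (length r)) {1..length r}"
    by auto
  then have "path_prod w (r @ [b]) = w (r @ [b]) * (\<Prod>i\<in>{1..length r}. w (take i (r @ [b])))"
    by (simp add: path_prod_def)
  then show ?thesis
    by (simp add: path_prod_def)
qed

lemma path_prod_butlast: "r \<noteq> [] \<Longrightarrow> path_prod w r = path_prod w (butlast r) * w r"
  using path_prod_snoc[of w "butlast r" "last r"] by simp

lemma path_prod_pos:
  assumes "\<And>r. r \<noteq> [] \<Longrightarrow> 0 < w r"
  shows "0 < path_prod w r"
  unfolding path_prod_def
proof (intro prod_pos ballI)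
  fix i
  assume "i \<in> {1..length r}"
  then have "take i r \<noteq> []"
    by auto
  then show "0 < w (take i r)"
    by (rule assms)
qed

lemma sum_lessThan_double:
  fixes f :: "nat \<Rightarrow> real"
  shows "(\<Sum>l<2 * n. f l) = (\<Sum>l<n. f l) + (\<Sum>l<n. f (n + l))"
proof -
  have "(\<Sum>l<2 * n. f l) = (\<Sum>l<n. f l) + (\<Sum>l=n..<n + n. f l)"
    using sum.atLeastLessThan_concat[of 0 n "n + n" f] by (simp add: atLeast0LessThan mult_2)
  also have "(\<Sum>l=n..<n + n. f l) = (\<Sum>l<n. f (n + l))"
    using sum.shift_bounds_nat_ivl[of f 0 n n] by (simp add: atLeast0LessThan add.commute)
  finally show ?thesis .
qed

text \<open>Identifies the recursive sum over a subtree with a sum over the numbered descendants of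
  a cell. The path products stop one letter early because the weight at the last word is the root
  weight of the tree to which \<psi> is applied.\<close>

lemma sum_descendants_branch:
  fixes w :: "bool list \<Rightarrow> real"
  assumes "0 < j"
  shows "(\<Sum>l<2 ^ q. path_prod (\<lambda>r. \<phi> (w r)) (butlast (dyadic_word (j + q) (k * 2 ^ q + l))) *
      \<psi> (\<lambda>u. w (dyadic_word (j + q) (k * 2 ^ q + l) @ u))) =
    path_prod (\<lambda>r. \<phi> (w r)) (butlast (dyadic_word j k)) * branch \<phi> \<psi> q (\<lambda>u. w (dyadic_word j k @ u))"
  using assms
proof (induction q arbitrary: j k)
  case (Suc q)
  let ?r = "dyadic_word j k"
  let ?Q = "path_prod (\<lambda>r. \<phi> (w r))"
  let ?f = "\<lambda>l. ?Q (butlast (dyadic_word (j + Suc q) (k * 2 ^ Suc q + l))) *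
      \<psi> (\<lambda>u. w (dyadic_word (j + Suc q) (k * 2 ^ Suc q + l) @ u))"
  have word0: "dyadic_word (Suc j) (2 * k) = ?r @ [False]"
    and word1: "dyadic_word (Suc j) (Suc (2 * k)) = ?r @ [True]"
    by (simp_all add: dyadic_word_Suc)
  have "?r \<noteq> []"
    using Suc.prems by (metis length_dyadic_word length_0_conv less_numeral_extra(3))
  have "(\<Sum>l<2 ^ Suc q. ?f l) = (\<Sum>l<2 ^ q. ?f l) + (\<Sum>l<2 ^ q. ?f (2 ^ q + l))"
    using sum_lessThan_double[of ?f "2 ^ q"] by simp
  also have "(\<Sum>l<2 ^ q. ?f l) = ?Q ?r * branch \<phi> \<psi> q (\<lambda>u. w (?r @ [False] @ u))"
    using Suc.IH[of "Suc j" "2 * k"] by (simp add: word0 mult.assoc mult.left_commute)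
  also have "(\<Sum>l<2 ^ q. ?f (2 ^ q + l)) = ?Q ?r * branch \<phi> \<psi> q (\<lambda>u. w (?r @ [True] @ u))"
  proof -
    have "k * 2 ^ Suc q + (2 ^ q + l) = Suc (2 * k) * 2 ^ q + l" for l
      by (simp add: algebra_simps)
    then show ?thesis
      using Suc.IH[of "Suc j" "Suc (2 * k)"] by (simp only: word1) (simp add: mult.assoc)
  qed
  also have "?Q ?r = ?Q (butlast ?r) * \<phi> (w ?r)"
    using \<open>?r \<noteq> []\<close> by (rule path_prod_butlast)
  finally show ?case
    by (simp add: subtree_def algebra_simps)
qed simp

lemma measurable_cascade_density [measurable]: "cascade_density T w n \<in> borel_measurable borel"
proof -
  have "(\<lambda>x. nat \<lfloor>x * 2 ^ n / T\<rfloor>) \<in> measurable borel (count_space UNIV)"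
    by measurable
  from measurable_compose[OF this, of "\<lambda>k. \<Prod>i\<in>{1..n}. w (take i (dyadic_word n k))" borel]
  have [measurable]: "(\<lambda>x. \<Prod>i\<in>{1..n}. w (take i (dyadic_word n (nat \<lfloor>x * 2 ^ n / T\<rfloor>)))) \<in> borel_measurable borel"
    by simp
  show ?thesis
    unfolding cascade_density_def by measurable
qed

lemma emeasure_cascade_approx:
  assumes "0 < T" "b \<le> 2 ^ n" "a \<le> b" and w: "\<And>r. r \<noteq> [] \<Longrightarrow> 0 < w r"
  shows "emeasure (cascade_approx T w n) {real a * T / 2 ^ n..<real b * T / 2 ^ n} =
    ennreal (\<Sum>k=a..<b. T / 2 ^ n * path_prod w (dyadic_word n k))"
  using assms(3,2)
proof (induction b rule: dec_induct)
  case base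
  then show ?case
    by simp
next
  case (step b)
  let ?x = "\<lambda>k::nat. real k * T / 2 ^ n"
  have mono: "?x i \<le> ?x k" if "i \<le> k" for i k
    using that assms by (intro divide_right_mono mult_right_mono) auto
  have meas: "{?x i..<?x k} \<in> sets (cascade_approx T w n)" for i k
    by (simp add: cascade_approx_def)
  have "{?x a..<?x (Suc b)} = {?x a..<?x b} \<union> {?x b..<?x (Suc b)}"
    using mono[of a b] mono[of b "Suc b"] step by (intro ivl_disj_un_two(3)[symmetric]) auto
  then have "emeasure (cascade_approx T w n) {?x a..<?x (Suc b)} =
      emeasure (cascade_approx T w n) {?x a..<?x b} + emeasure (cascade_approx T w n) {?x b..<?x (Suc b)}"
    by (simp only:) (rule plus_emeasure[symmetric, OF meas meas], auto)
  also have "emeasure (cascade_approx T w n) {?x b..<?x (Suc b)} =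
      (\<integral>\<^sup>+x. ennreal (cascade_density T w n x) * indicator {?x b..<?x (Suc b)} x \<partial>lborel)"
    unfolding cascade_approx_def by (rule emeasure_density) auto
  also have "\<dots> = (\<integral>\<^sup>+x. ennreal (path_prod w (dyadic_word n b)) * indicator {?x b..<?x (Suc b)} x \<partial>lborel)"
  proof (intro nn_integral_cong)
    fix x
    show "ennreal (cascade_density T w n x) * indicator {?x b..<?x (Suc b)} x =
        ennreal (path_prod w (dyadic_word n b)) * indicator {?x b..<?x (Suc b)} x"
    proof (cases "x \<in> {?x b..<?x (Suc b)}")
      case True
      then have x: "real b \<le> x * 2 ^ n / T" "x * 2 ^ n / T < real b + 1"
        using assms(1) by (auto simp: field_simps)
      then have "\<lfloor>x * 2 ^ n / T\<rfloor> = int b"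
        by (intro floor_unique) auto
      moreover have "0 \<le> x"
        using True mono[of 0 b] by auto
      moreover have "x \<le> T"
      proof -
        have "?x (Suc b) \<le> ?x (2 ^ n)"
          using step by (intro mono) auto
        with True show ?thesis
          using assms(1) by auto
      qed
      ultimately show ?thesis
        by (simp add: cascade_density_def path_prod_def)
    qed simp
  qed
  also have "\<dots> = ennreal (path_prod w (dyadic_word n b)) * ennreal (T / 2 ^ n)"
  proof -
    have "emeasure lborel {?x b..<?x (Suc b)} = ennreal (?x (Suc b) - ?x b)"
      by (rule emeasure_lborel_Ico) (rule mono, simp)
    also have "?x (Suc b) - ?x b = T / 2 ^ n"
      by (simp add: field_simps)
    finally show ?thesis
      by (simp add: nn_integral_cmult)
  qed
  finally have "emeasure (cascade_approx T w n) {?x a..<?x (Suc b)} =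
      ennreal (\<Sum>k=a..<b. T / 2 ^ n * path_prod w (dyadic_word n k)) +
      ennreal (path_prod w (dyadic_word n b)) * ennreal (T / 2 ^ n)"
    using step by simp
  then show ?case
    using step assms(1) path_prod_pos[of w, OF w]
    by (simp add: ennreal_plus[symmetric] sum_nonneg less_imp_le ennreal_mult[symmetric] mult.commute
        del: ennreal_plus)
qed

lemma finite_measure_cascade_approx:
  assumes T: "0 < T" and w: "\<And>r. r \<noteq> [] \<Longrightarrow> 0 < w r"
  shows "finite_measure (cascade_approx T w n)"
proof
  have "emeasure (cascade_approx T w n) UNIV = (\<integral>\<^sup>+x. ennreal (cascade_density T w n x) * indicator UNIV x \<partial>lborel)"
    unfolding cascade_approx_def by (rule emeasure_density) auto
  \<comment> \<open>At x = T the floor gives \<open>2 ^ n\<close>, beyond the last cell; the single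
    point is a Lebesgue null set.\<close>
  also have "\<dots> = (\<integral>\<^sup>+x. ennreal (cascade_density T w n x) * indicator {0..<T} x \<partial>lborel)"
  proof (rule nn_integral_cong_AE)
    show "AE x in lborel. ennreal (cascade_density T w n x) * indicator UNIV x =
        ennreal (cascade_density T w n x) * indicator {0..<T} x"
      using AE_lborel_singleton[of T]
      by eventually_elim (auto simp: cascade_density_def indicator_def)
  qed
  also have "\<dots> = emeasure (cascade_approx T w n) {0..<T}"
    unfolding cascade_approx_def by (rule emeasure_density[symmetric]) auto
  also have "\<dots> \<noteq> \<infinity>"
    using emeasure_cascade_approx[OF T, of "2 ^ n" n 0 w] w by simp
  finally show "emeasure (cascade_approx T w n) (space (cascade_approx T w n)) \<noteq> \<infinity>"
    by (simp add: cascade_approx_def)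
qed

lemma AE_cascade_approx: "AE x in cascade_approx T w n. 0 \<le> x \<and> x < T"
proof -
  have "AE x in lborel. 0 < ennreal (cascade_density T w n x) \<longrightarrow> 0 \<le> x \<and> x < T"
    using AE_lborel_singleton[of T]
    by eventually_elim (auto simp: cascade_density_def split: if_splits)
  then show ?thesis
    unfolding cascade_approx_def by (subst AE_density) auto
qed

text \<open>A tent function centred at the dyadic point dominates its indicator and lives on the two
  adjacent cells of level i. The truncated \<open>k - 1\<close> and the minimum with
  \<open>2 ^ i\<close> discard the missing neighbour at 0 and at T, outside of which the
  approximants have no mass.\<close>

lemma weak_conv_fin_atom_le:
  assumes conv: "weak_conv_fin (cascade_approx T w) L"
    and L: "finite_measure L" "sets L = sets borel"
    and T: "0 < T" and w: "\<And>r. r \<noteq> [] \<Longrightarrow> 0 < w r"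
    and k: "k \<le> 2 ^ i"
  shows "ennreal (measure L {real k * T / 2 ^ i}) \<le>
    liminf (\<lambda>q. ennreal (\<Sum>l=(k - 1) * 2 ^ q..<min (k + 1) (2 ^ i) * 2 ^ q.
      T / 2 ^ (i + q) * path_prod w (dyadic_word (i + q) l)))"
proof -
  define d where "d = real k * T / 2 ^ i"
  define f where "f x = max 0 (1 - \<bar>x - d\<bar> * 2 ^ i / T)" for x
  let ?Ms = "cascade_approx T w"
  interpret L: finite_measure L by fact
  note [measurable_cong] = L(2)
  have cont: "continuous_on UNIV f"
    unfolding f_def by (intro continuous_intros) (use T in auto)
  then have [measurable]: "f \<in> borel_measurable borel"
    by (rule borel_measurable_continuous_onI)
  have range: "0 \<le> f x" "f x \<le> 1" for x
    using T by (auto simp: f_def)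
  have "bounded (range f)"
    by (rule boundedI[of _ 1]) (use range in force)
  with cont conv have lim: "(\<lambda>n. \<integral>x. f x \<partial>?Ms n) \<longlonglongrightarrow> (\<integral>x. f x \<partial>L)"
    unfolding weak_conv_fin_def by auto
  have space_L: "space L = UNIV"
    using sets_eq_imp_space_eq[OF L(2)] by simp
  have int_f: "integrable N f" if "finite_measure N" "sets N = sets borel" for N :: "real measure"
  proof -
    interpret N: finite_measure N by fact
    note [measurable_cong] = that(2)
    show ?thesis
      by (rule N.integrable_const_bound[of _ 1]) (use range in auto)
  qed
  have "measure L {d} = (\<integral>x. indicator {d} x \<partial>L)"
    by (simp add: space_L)
  also have "\<dots> \<le> (\<integral>x. f x \<partial>L)"
  proof (intro integral_mono int_f L integrable_real_indicator)
    fix x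
    show "indicator {d} x \<le> f x"
      using range[of x] by (auto simp: indicator_def f_def)
  qed (auto simp: L less_top[symmetric])
  finally have "ennreal (measure L {d}) \<le> ennreal (\<integral>x. f x \<partial>L)"
    by (rule ennreal_leI)
  also have "\<dots> = liminf (\<lambda>q. ennreal (\<integral>x. f x \<partial>?Ms (q + i)))"
    by (intro lim_imp_Liminf[symmetric] tendsto_ennrealI LIMSEQ_ignore_initial_segment lim) simp
  also have "\<dots> \<le> liminf (\<lambda>q. ennreal (\<Sum>l=(k - 1) * 2 ^ q..<min (k + 1) (2 ^ i) * 2 ^ q.
      T / 2 ^ (i + q) * path_prod w (dyadic_word (i + q) l)))"
  proof (intro Liminf_mono always_eventually allI)
    fix q
    let ?a = "(k - 1) * 2 ^ q" and ?b = "min (k + 1) (2 ^ i) * 2 ^ q"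
    let ?I = "{real ?a * T / 2 ^ (i + q)..<real ?b * T / 2 ^ (i + q)}"
    interpret N: finite_measure "?Ms (i + q)"
      by (rule finite_measure_cascade_approx[OF T w])
    have sets_N: "sets (?Ms (i + q)) = sets borel"
      by (simp add: cascade_approx_def)
    have "(\<integral>x. f x \<partial>?Ms (i + q)) \<le> (\<integral>x. indicator ?I x \<partial>?Ms (i + q))"
    proof (intro integral_mono_AE int_f sets_N integrable_real_indicator)
      show "AE x in ?Ms (i + q). f x \<le> indicator ?I x"
        using AE_cascade_approx
      proof eventually_elim
        case (elim x)
        show ?case
        proof (cases "f x = 0")
          case False
          then have "\<bar>x - d\<bar> * 2 ^ i / T < 1"
            by (auto simp: f_def split: if_splits)
          then have "\<bar>x - d\<bar> * 2 ^ i < T"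
            using T by (simp add: field_simps)
          moreover have "x * 2 ^ i - real k * T = (x - d) * 2 ^ i"
            by (simp add: d_def field_simps)
          ultimately have "\<bar>x * 2 ^ i - real k * T\<bar> < T"
            by (simp add: abs_mult)
          then have x: "(real k - 1) * T < x * 2 ^ i" "x * 2 ^ i < (real k + 1) * T"
            by (auto simp: algebra_simps abs_less_iff)
          have "real (k - 1) * T \<le> x * 2 ^ i"
            using x(1) elim by (cases k) auto
          moreover have "x * 2 ^ i < real (min (k + 1) (2 ^ i)) * T"
            using x(2) elim by (auto simp: min_def mult.commute add.commute)
          ultimately have "x \<in> ?I"
            by (auto simp: field_simps power_add)
          then show ?thesis
            using range[of x] by simp
        qed simp
      qed
    qed (auto simp: sets_N N.finite_measure_axioms less_top[symmetric])
    also have "\<dots> = measure (?Ms (i + q)) ?I"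
      by (simp add: cascade_approx_def)
    finally have "ennreal (\<integral>x. f x \<partial>?Ms (i + q)) \<le> emeasure (?Ms (i + q)) ?I"
      by (simp add: N.emeasure_eq_measure ennreal_leI)
    also have "\<dots> = ennreal (\<Sum>l=?a..<?b. T / 2 ^ (i + q) * path_prod w (dyadic_word (i + q) l))"
    proof (rule emeasure_cascade_approx[OF T _ _ w])
      have "min (k + 1) (2 ^ i) * 2 ^ q \<le> 2 ^ i * (2::nat) ^ q"
        by (intro mult_right_mono) auto
      then show "?b \<le> 2 ^ (i + q)"
        by (simp add: power_add)
      show "?a \<le> ?b"
        using k by (intro mult_right_mono) auto
    qed
    finally show "ennreal (\<integral>x. f x \<partial>?Ms (q + i)) \<le>
        ennreal (\<Sum>l=?a..<?b. T / 2 ^ (i + q) * path_prod w (dyadic_word (i + q) l))"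
      by (simp add: add.commute)
  qed
  finally show ?thesis
    by (simp add: d_def)
qed

text \<open>The closed interval lies in the period of one cascade; shifted into another period it
  can meet [0, T] only at 0 or at T, which are not charged.\<close>

lemma mu_tilde_dyadic:
  assumes T: "0 < T" and mu: "\<And>m. sets (mus m) = sets borel"
    and atoms: "\<And>m. emeasure (mus m) {0} = 0" "\<And>m. emeasure (mus m) {T} = 0"
    and k: "k < 2 ^ j"
  shows "mu_tilde T mus (dyadic_interval T j (m * 2 ^ j + k)) = emeasure (mus m) (dyadic_interval T j k)"
proof -
  let ?I = "dyadic_interval T j (m * 2 ^ j + k)"
  let ?A = "\<lambda>m'. (\<lambda>x. x - real m' * T) ` ?I \<inter> {0..T}"
  have shift: "(\<lambda>x. x - real m' * T) ` ?I =
      {(real m - real m') * T + real k * T / 2 ^ j..(real m - real m') * T + (real k + 1) * T / 2 ^ j}" for m'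
  proof -
    have "real (m * 2 ^ j + k) * T / 2 ^ j - real m' * T = (real m - real m') * T + real k * T / 2 ^ j"
      "(real (m * 2 ^ j + k) + 1) * T / 2 ^ j - real m' * T = (real m - real m') * T + (real k + 1) * T / 2 ^ j"
      by (simp_all add: add_divide_distrib distrib_right left_diff_distrib)
    then show ?thesis
      unfolding dyadic_interval_def image_minus_const_atLeastAtMost' by (simp only:)
  qed
  have k1: "(real k + 1) * T / 2 ^ j \<le> T"
  proof -
    have "real (Suc k) \<le> real (2 ^ j)"
      using k by (intro of_nat_mono) auto
    then have "(real k + 1) * T \<le> 2 ^ j * T"
      using T by (intro mult_right_mono) auto
    then show ?thesis
      by (simp add: field_simps)
  qed
  have k0: "0 \<le> real k * T / 2 ^ j"
    using T by simp
  have "emeasure (mus m') (?A m') = (if m' = m then emeasure (mus m) (dyadic_interval T j k) else 0)" for m'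
  proof -
    consider "m' = m" | "m' < m" | "m < m'"
      by linarith
    then show ?thesis
    proof cases
      case 1
      have "?A m = dyadic_interval T j k"
      proof -
        have "?A m = {real k * T / 2 ^ j..(real k + 1) * T / 2 ^ j} \<inter> {0..T}"
          unfolding shift by simp
        also have "\<dots> = {real k * T / 2 ^ j..(real k + 1) * T / 2 ^ j}"
          using k0 k1 by (intro Int_absorb2) auto
        finally show ?thesis
          by (simp add: dyadic_interval_def)
      qed
      with 1 show ?thesis
        by simp
    next
      case 2
      then have "1 * T \<le> (real m - real m') * T"
        using T by (intro mult_right_mono) auto
      then have "?A m' \<subseteq> {T}"
      proof (intro subsetI)
        fix x
        assume "x \<in> ?A m'"
        then have "(real m - real m') * T + real k * T / 2 ^ j \<le> x" "x \<le> T"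
          unfolding shift by (simp_all only: Int_iff atLeastAtMost_iff)
        with \<open>1 * T \<le> (real m - real m') * T\<close> k0 have "x = T"
          by linarith
        then show "x \<in> {T}"
          by simp
      qed
      then have "emeasure (mus m') (?A m') \<le> emeasure (mus m') {T}"
        by (intro emeasure_mono) (auto simp: mu)
      with 2 show ?thesis
        by (simp add: atoms)
    next
      case 3
      then have "(real m - real m') * T \<le> (- 1) * T"
        using T by (intro mult_right_mono) auto
      then have "?A m' \<subseteq> {0}"
      proof (intro subsetI)
        fix x
        assume "x \<in> ?A m'"
        then have "x \<le> (real m - real m') * T + (real k + 1) * T / 2 ^ j" "0 \<le> x"
          unfolding shift by (simp_all only: Int_iff atLeastAtMost_iff)
        with \<open>(real m - real m') * T \<le> (- 1) * T\<close> k1 have "x = 0"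
          by linarith
        then show "x \<in> {0}"
          by simp
      qed
      then have "emeasure (mus m') (?A m') \<le> emeasure (mus m') {0}"
        by (intro emeasure_mono) (auto simp: mu)
      with 3 show ?thesis
        by (simp add: atoms)
    qed
  qed
  then have "mu_tilde T mus ?I = (\<Sum>m'. if m' = m then emeasure (mus m) (dyadic_interval T j k) else 0)"
    by (simp add: mu_tilde_def)
  also have "\<dots> = emeasure (mus m) (dyadic_interval T j k)"
    using suminf_finite[of "{m}" "\<lambda>m'. if m' = m then emeasure (mus m) (dyadic_interval T j k) else 0"] by simp
  finally show ?thesis .
qed

lemma path_prod_half: "path_prod (\<lambda>r. w r / 2) r = path_prod w r / 2 ^ length r"
  by (simp add: path_prod_def prod_dividef)

lemma path_prod_powr: "path_prod (\<lambda>r. w r powr p) r = path_prod w r powr p"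
  by (simp add: path_prod_def prod_powr_distrib)

section \<open>Absence of atoms and convergence of interval masses\<close>

locale cascade_limit = cascade_system +
  fixes T :: real and mu :: "nat \<Rightarrow> 'a \<Rightarrow> real measure"
  assumes T_pos: "0 < T"
    and mu: "\<And>m \<omega>. sets (mu m \<omega>) = sets borel \<and> finite_measure (mu m \<omega>)"
    and weak_limit: "AE \<omega> in M. \<forall>m. weak_conv_fin (cascade_approx T (\<lambda>r. X m r \<omega>)) (mu m \<omega>)"
begin

abbreviation cell :: "nat \<Rightarrow> nat \<Rightarrow> nat \<Rightarrow> 'a \<Rightarrow> real" where
  "cell m j k \<omega> \<equiv> T / 2 ^ j * path_prod (weights m \<omega>) (butlast (dyadic_word j k))"

lemma measurable_path_prod [measurable]: "(\<lambda>\<omega>. path_prod (weights m \<omega>) r) \<in> borel_measurable M"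
  unfolding path_prod_def by (intro borel_measurable_prod measurable_X) auto

text \<open>The weights along a path sit at distinct words, so they are independent, each of mean
  one.\<close>

lemma nn_integral_path_prod: "(\<integral>\<^sup>+\<omega>. ennreal (path_prod (weights m \<omega>) r) \<partial>M) = 1"
proof -
  define B where "B i = {(m, take i r)}" for i
  define G where "G i x = ennreal (x (m, take i r))" for i and x :: "nat \<times> bool list \<Rightarrow> real"
  let ?Y = "\<lambda>i \<omega>. (case i of (m, r) \<Rightarrow> X m r) \<omega>"
  have "(\<integral>\<^sup>+\<omega>. ennreal (path_prod (weights m \<omega>) r) \<partial>M) =
      (\<integral>\<^sup>+\<omega>. (\<Prod>i\<in>{1..length r}. G i (\<lambda>j\<in>B i. ?Y j \<omega>)) \<partial>M)"
  proof (rule nn_integral_cong_AE)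
    show "AE \<omega> in M. ennreal (path_prod (weights m \<omega>) r) = (\<Prod>i\<in>{1..length r}. G i (\<lambda>j\<in>B i. ?Y j \<omega>))"
      using AE_X_pos
    proof eventually_elim
      case (elim \<omega>)
      then have "0 \<le> X m (take i r) \<omega>" if "i \<in> {1..length r}" for i
      proof -
        have "take i r \<noteq> []"
          using that by auto
        with elim show ?thesis
          by (auto intro: less_imp_le)
      qed
      then have "(\<Prod>i\<in>{1..length r}. ennreal (X m (take i r) \<omega>)) = ennreal (\<Prod>i\<in>{1..length r}. X m (take i r) \<omega>)"
        by (rule prod_ennreal)
      then show ?case
        by (simp add: path_prod_def G_def B_def)
    qed
  qed
  also have "\<dots> = (\<Prod>i\<in>{1..length r}. \<integral>\<^sup>+\<omega>. G i (\<lambda>j\<in>B i. ?Y j \<omega>) \<partial>M)"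
  proof (rule M.nn_integral_prod_blocks[OF indep_X, where G = G and B = B])
    show "disjoint_family_on B {1..length r}"
      unfolding disjoint_family_on_def
    proof (intro ballI impI)
      fix i i'
      assume "i \<in> {1..length r}" "i' \<in> {1..length r}" "i \<noteq> i'"
      then have "take i r \<noteq> take i' r"
        by (metis atLeastAtMost_iff length_take min.absorb2)
      then show "B i \<inter> B i' = {}"
        by (simp add: B_def)
    qed
    show "G i \<in> borel_measurable (PiM (B i) (\<lambda>_. borel))" if "i \<in> {1..length r}" for i
      unfolding G_def B_def by measurable
  qed (auto simp: B_def)
  also have "\<dots> = (\<Prod>i\<in>{1..length r}. 1)"
  proof (rule prod.cong)
    fix i
    assume "i \<in> {1..length r}"
    then have ne: "take i r \<noteq> []"
      by auto
    have "(\<integral>\<^sup>+\<omega>. G i (\<lambda>j\<in>B i. ?Y j \<omega>) \<partial>M) = (\<integral>\<^sup>+\<omega>. ennreal (X m (take i r) \<omega>) \<partial>M)"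
      by (simp add: G_def B_def)
    also have "\<dots> = (\<integral>\<^sup>+x. ennreal x \<partial>\<nu>)"
      by (subst distr_X[OF ne, of m, symmetric], subst nn_integral_distr) (auto simp: measurable_X[OF ne])
    also have "\<dots> = (\<integral>\<^sup>+x. ennreal (x powr 1) \<partial>\<nu>)"
      by (rule nn_integral_cong_AE) (use weight_pos in \<open>auto elim!: eventually_mono\<close>)
    also have "\<dots> = 1"
      by (simp only: nn_integral_moment moment_1) simp
    finally show "(\<integral>\<^sup>+\<omega>. G i (\<lambda>j\<in>B i. ?Y j \<omega>) \<partial>M) = 1" .
  qed simp
  finally show ?thesis
    by simp
qed

text \<open>The atom is bounded by the mass of the adjacent cells at every finer level j + i. Their
  expected mass is at most 2 T / 2^(j + i), uniformly in the stage q of the approximation, so Fatou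
  in q followed by i to infinity leaves nothing.\<close>

lemma AE_no_atom:
  assumes k: "k \<le> 2 ^ j"
  shows "AE \<omega> in M. measure (mu m \<omega>) {real k * T / 2 ^ j} = 0"
proof -
  \<comment> \<open>The same point seen at level j + i, where it is the left end of the cell number
    \<open>a i\<close>, or T itself.\<close>
  define a where "a i = k * 2 ^ i" for i
  define S where "S i q \<omega> = ennreal (\<Sum>l=(a i - 1) * 2 ^ q..<min (a i + 1) (2 ^ (j + i)) * 2 ^ q.
      T / 2 ^ (j + i + q) * path_prod (weights m \<omega>) (dyadic_word (j + i + q) l))" for i q \<omega>
  have [measurable]: "S i q \<in> borel_measurable M" for i q
    unfolding S_def by measurable
  have int_S: "(\<integral>\<^sup>+\<omega>. S i q \<omega> \<partial>M) \<le> ennreal (2 * T / 2 ^ (j + i))" for i q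
  proof -
    let ?J = "{(a i - 1) * 2 ^ q..<min (a i + 1) (2 ^ (j + i)) * 2 ^ q}"
    have "(\<integral>\<^sup>+\<omega>. S i q \<omega> \<partial>M) = (\<integral>\<^sup>+\<omega>. (\<Sum>l\<in>?J. ennreal (T / 2 ^ (j + i + q)) *
        ennreal (path_prod (weights m \<omega>) (dyadic_word (j + i + q) l))) \<partial>M)"
    proof (rule nn_integral_cong_AE)
      show "AE \<omega> in M. S i q \<omega> = (\<Sum>l\<in>?J. ennreal (T / 2 ^ (j + i + q)) *
        ennreal (path_prod (weights m \<omega>) (dyadic_word (j + i + q) l)))"
        using AE_X_pos
      proof eventually_elim
        case (elim \<omega>)
        then have "0 \<le> path_prod (weights m \<omega>) r" for r
          by (intro less_imp_le path_prod_pos) auto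
        then have "S i q \<omega> = (\<Sum>l\<in>?J. ennreal (T / 2 ^ (j + i + q) * path_prod (weights m \<omega>) (dyadic_word (j + i + q) l)))"
          unfolding S_def using T_pos by (intro sum_ennreal[symmetric] mult_nonneg_nonneg) auto
        also have "\<dots> = (\<Sum>l\<in>?J. ennreal (T / 2 ^ (j + i + q)) *
            ennreal (path_prod (weights m \<omega>) (dyadic_word (j + i + q) l)))"
          using T_pos \<open>\<And>r. 0 \<le> path_prod (weights m \<omega>) r\<close> by (intro sum.cong refl ennreal_mult) auto
        finally show ?case .
      qed
    qed
    also have "\<dots> = (\<Sum>l\<in>?J. ennreal (T / 2 ^ (j + i + q)))"
      by (subst nn_integral_sum) (auto simp: nn_integral_cmult nn_integral_path_prod)
    also have "\<dots> = ennreal (real (card ?J) * (T / 2 ^ (j + i + q)))"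
      using T_pos by (simp add: ennreal_of_nat_eq_real_of_nat flip: ennreal_mult)
    also have "\<dots> \<le> ennreal (2 * 2 ^ q * (T / 2 ^ (j + i + q)))"
    proof (intro ennreal_leI mult_right_mono)
      have "card ?J = (min (a i + 1) (2 ^ (j + i)) - (a i - 1)) * 2 ^ q"
        by (simp add: diff_mult_distrib)
      also have "\<dots> \<le> 2 * 2 ^ q"
        by (intro mult_right_mono) auto
      finally have "real (card ?J) \<le> real (2 * 2 ^ q)"
        by (rule of_nat_mono)
      then show "real (card ?J) \<le> 2 * 2 ^ q"
        by simp
    qed (use T_pos in auto)
    also have "2 * 2 ^ q * (T / 2 ^ (j + i + q)) = 2 * T / 2 ^ (j + i)"
      by (simp add: power_add)
    finally show ?thesis .
  qed
  define g where "g i \<omega> = liminf (\<lambda>q. S i q \<omega>)" for i \<omega>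
  have [measurable]: "g i \<in> borel_measurable M" for i
    unfolding g_def by measurable
  have int_g: "(\<integral>\<^sup>+\<omega>. g i \<omega> \<partial>M) \<le> ennreal (2 * T / 2 ^ (j + i))" for i
  proof -
    have "(\<integral>\<^sup>+\<omega>. g i \<omega> \<partial>M) \<le> liminf (\<lambda>q. \<integral>\<^sup>+\<omega>. S i q \<omega> \<partial>M)"
      unfolding g_def by (rule nn_integral_liminf) measurable
    also have "\<dots> \<le> liminf (\<lambda>q. ennreal (2 * T / 2 ^ (j + i)))"
      by (intro Liminf_mono always_eventually allI int_S)
    finally show ?thesis
      by (simp add: Liminf_const)
  qed
  have "(\<integral>\<^sup>+\<omega>. (INF i. g i \<omega>) \<partial>M) \<le> ennreal (2 * T / 2 ^ (j + i))" for i
    by (rule order.trans[OF nn_integral_mono int_g[of i]]) (auto intro: INF_lower)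
  moreover have "(\<lambda>i. ennreal (2 * T / 2 ^ (j + i))) \<longlonglongrightarrow> ennreal 0"
  proof (intro tendsto_ennrealI)
    have "(\<lambda>i. 2 * T / 2 ^ j * (1 / 2) ^ i) \<longlonglongrightarrow> 2 * T / 2 ^ j * 0"
      by (intro tendsto_intros LIMSEQ_realpow_zero) auto
    then show "(\<lambda>i. 2 * T / 2 ^ (j + i)) \<longlonglongrightarrow> 0"
      by (simp add: power_add power_divide)
  qed
  ultimately have "(\<integral>\<^sup>+\<omega>. (INF i. g i \<omega>) \<partial>M) \<le> ennreal 0"
    by (intro LIMSEQ_le_const[of "\<lambda>i. ennreal (2 * T / 2 ^ (j + i))"]) auto
  then have "AE \<omega> in M. (INF i. g i \<omega>) = 0"
    by (subst nn_integral_0_iff_AE[symmetric]) auto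
  then show ?thesis
    using AE_X_pos weak_limit
  proof eventually_elim
    case (elim \<omega>)
    have "ennreal (measure (mu m \<omega>) {real k * T / 2 ^ j}) \<le> g i \<omega>" for i
    proof -
      have "real (a i) * T / 2 ^ (j + i) = real k * T / 2 ^ j"
        by (simp add: a_def power_add)
      moreover have "ennreal (measure (mu m \<omega>) {real (a i) * T / 2 ^ (j + i)}) \<le> g i \<omega>"
        unfolding g_def S_def
        by (rule weak_conv_fin_atom_le) (use elim mu T_pos k in \<open>auto simp: a_def power_add\<close>)
      ultimately show ?thesis
        by simp
    qed
    then have "ennreal (measure (mu m \<omega>) {real k * T / 2 ^ j}) \<le> (INF i. g i \<omega>)"
      by (intro INF_greatest)
    then show ?case
      using elim(1) by simp
  qed
qed

lemma AE_no_atoms: "AE \<omega> in M. \<forall>m j k. k \<le> 2 ^ j \<longrightarrow> measure (mu m \<omega>) {real k * T / 2 ^ j} = 0"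
  unfolding AE_all_countable
proof (intro allI)
  fix m j k
  show "AE \<omega> in M. k \<le> 2 ^ j \<longrightarrow> measure (mu m \<omega>) {real k * T / 2 ^ j} = 0"
    by (cases "k \<le> 2 ^ j") (use AE_no_atom in auto)
qed

lemma measure_cascade_approx_node:
  assumes pos: "\<And>r. r \<noteq> [] \<Longrightarrow> 0 < X m r \<omega>" and j: "0 < j" and k: "k < 2 ^ j"
  shows "measure (cascade_approx T (weights m \<omega>) (j + q)) {real k * T / 2 ^ j..<(real k + 1) * T / 2 ^ j} =
    cell m j k \<omega> * mass q (node m (dyadic_word j k) \<omega>)"
proof -
  define w where "w = (weights m \<omega>)"
  define r where "r = dyadic_word j k"
  have w: "\<And>r. r \<noteq> [] \<Longrightarrow> 0 < w r"
    using pos by (simp add: w_def)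
  have eq: "{real (k * 2 ^ q) * T / 2 ^ (j + q)..<real ((k + 1) * 2 ^ q) * T / 2 ^ (j + q)} =
      {real k * T / 2 ^ j..<(real k + 1) * T / 2 ^ j}"
  proof -
    have "real (k * 2 ^ q) * T / 2 ^ (j + q) = real k * T / 2 ^ j"
      "real ((k + 1) * 2 ^ q) * T / 2 ^ (j + q) = (real k + 1) * T / 2 ^ j"
      by (simp_all add: power_add field_simps)
    then show ?thesis
      by (simp only:)
  qed
  have "emeasure (cascade_approx T w (j + q)) {real k * T / 2 ^ j..<(real k + 1) * T / 2 ^ j} =
      ennreal (\<Sum>l=k * 2 ^ q..<(k + 1) * 2 ^ q. T / 2 ^ (j + q) * path_prod w (dyadic_word (j + q) l))"
    unfolding eq[symmetric]
  proof (rule emeasure_cascade_approx[OF T_pos _ _ w])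
    have "(k + 1) * 2 ^ q \<le> 2 ^ j * (2::nat) ^ q"
      using k by (intro mult_right_mono) auto
    then show "(k + 1) * 2 ^ q \<le> 2 ^ (j + q)"
      by (simp add: power_add)
  qed auto
  moreover have "0 \<le> (\<Sum>l=k * 2 ^ q..<(k + 1) * 2 ^ q. T / 2 ^ (j + q) * path_prod w (dyadic_word (j + q) l))"
    using T_pos path_prod_pos[of w, OF w] by (intro sum_nonneg) (auto intro!: less_imp_le mult_pos_pos)
  ultimately have "measure (cascade_approx T w (j + q)) {real k * T / 2 ^ j..<(real k + 1) * T / 2 ^ j} =
      (\<Sum>l=k * 2 ^ q..<(k + 1) * 2 ^ q. T / 2 ^ (j + q) * path_prod w (dyadic_word (j + q) l))"
    by (simp add: measure_def)
  also have "\<dots> = (\<Sum>l<2 ^ q. T / 2 ^ (j + q) * path_prod w (dyadic_word (j + q) (k * 2 ^ q + l)))"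
    using sum.shift_bounds_nat_ivl[of "\<lambda>l. T / 2 ^ (j + q) * path_prod w (dyadic_word (j + q) l)" 0 "k * 2 ^ q" "2 ^ q"]
    by (simp add: atLeast0LessThan add.commute)
  also have "\<dots> = (\<Sum>l<2 ^ q. T / 2 * (path_prod (\<lambda>r. w r / 2) (butlast (dyadic_word (j + q) (k * 2 ^ q + l))) *
      w (dyadic_word (j + q) (k * 2 ^ q + l) @ [])))"
  proof (rule sum.cong)
    fix l
    let ?s = "dyadic_word (j + q) (k * 2 ^ q + l)"
    have "?s \<noteq> []"
      using j by (metis length_dyadic_word length_0_conv add_is_0 less_numeral_extra(3))
    then have "path_prod w ?s = path_prod w (butlast ?s) * w ?s"
      by (rule path_prod_butlast)
    \<comment> \<open>The word without its last letter has length j + q - 1, so the halved path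
      product supplies one factor 2 less than the cell length needs.\<close>
    moreover have "2 ^ (j + q) = 2 * (2::real) ^ (j + q - 1)"
      using j by (cases j) auto
    ultimately show "T / 2 ^ (j + q) * path_prod w ?s =
        T / 2 * (path_prod (\<lambda>r. w r / 2) (butlast ?s) * w (?s @ []))"
      by (simp add: path_prod_half)
  qed simp
  also have "\<dots> = T / 2 * (path_prod (\<lambda>r. w r / 2) (butlast r) * mass q (\<lambda>u. w (r @ u)))"
    unfolding sum_distrib_left[symmetric] mass_def r_def
    using sum_descendants_branch[OF j, of "\<lambda>x. x / 2" w q k "\<lambda>w. w []"] by simp
  also have "\<dots> = T / 2 ^ j * path_prod w (butlast r) * mass q (\<lambda>u. w (r @ u))"
  proof -
    have "2 ^ j = 2 * (2::real) ^ (j - 1)"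
      using j by (cases j) auto
    then show ?thesis
      by (simp add: path_prod_half r_def)
  qed
  finally show ?thesis
    by (simp add: w_def r_def node_def[abs_def])
qed

lemma AE_mass_limit: "AE \<omega> in M. \<forall>m j k. 0 < j \<longrightarrow> k < 2 ^ j \<longrightarrow>
  (\<lambda>q. cell m j k \<omega> * mass q (node m (dyadic_word j k) \<omega>))
    \<longlonglongrightarrow> measure (mu m \<omega>) (dyadic_interval T j k)"
  using AE_no_atoms AE_X_pos weak_limit
proof eventually_elim
  case (elim \<omega>)
  show ?case
  proof (intro allI impI)
    fix m j k :: nat
    assume j: "0 < j" and k: "k < 2 ^ j"
    have "(\<lambda>n. measure (cascade_approx T (weights m \<omega>) n) {real k * T / 2 ^ j..<(real k + 1) * T / 2 ^ j})
        \<longlonglongrightarrow> measure (mu m \<omega>) {real k * T / 2 ^ j..(real k + 1) * T / 2 ^ j}"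
    proof (rule weak_conv_fin_interval)
      show "weak_conv_fin (cascade_approx T (weights m \<omega>)) (mu m \<omega>)"
        using elim by simp
      show "finite_measure (cascade_approx T (weights m \<omega>) n)" for n
        using elim T_pos by (intro finite_measure_cascade_approx) auto
      show "sets (cascade_approx T (weights m \<omega>) n) = sets borel" for n
        by (simp add: cascade_approx_def)
      show "finite_measure (mu m \<omega>)" "sets (mu m \<omega>) = sets borel"
        using mu by auto
      show "real k * T / 2 ^ j < (real k + 1) * T / 2 ^ j"
        using T_pos by (intro divide_strict_right_mono mult_strict_right_mono) auto
      show "measure (mu m \<omega>) {real k * T / 2 ^ j} = 0"
        using elim(1) k by auto
      show "measure (mu m \<omega>) {(real k + 1) * T / 2 ^ j} = 0"
        using elim(1)[rule_format, of "Suc k" j m] k by (simp add: add.commute)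
    qed
    from LIMSEQ_ignore_initial_segment[OF this, of j]
    show "(\<lambda>q. cell m j k \<omega> * mass q (node m (dyadic_word j k) \<omega>))
      \<longlonglongrightarrow> measure (mu m \<omega>) (dyadic_interval T j k)"
      using measure_cascade_approx_node[of m \<omega> j k] elim j k
      by (simp add: add.commute[of _ j] dyadic_interval_def)
  qed
qed

text \<open>For a fixed cell the factor in front of \<open>mass q\<close> is positive and does not
  depend on q, so it can be divided out.\<close>

lemma AE_convergent_mass_node: "AE \<omega> in M. \<forall>m j k. 0 < j \<longrightarrow> k < 2 ^ j \<longrightarrow>
  convergent (\<lambda>q. mass q (node m (dyadic_word j k) \<omega>))"
  using AE_mass_limit AE_X_pos
proof eventually_elim
  case (elim \<omega>)
  show ?case
  proof (intro allI impI)
    fix m j k :: nat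
    assume j: "0 < j" and k: "k < 2 ^ j"
    define c where "c = cell m j k \<omega>"
    have "0 < c"
      unfolding c_def using T_pos elim(2) by (intro mult_pos_pos path_prod_pos) auto
    have "(\<lambda>q. c * mass q (node m (dyadic_word j k) \<omega>)) \<longlonglongrightarrow> measure (mu m \<omega>) (dyadic_interval T j k)"
      using elim(1) j k by (simp add: c_def)
    then have "(\<lambda>q. 1 / c * (c * mass q (node m (dyadic_word j k) \<omega>))) \<longlonglongrightarrow>
        1 / c * measure (mu m \<omega>) (dyadic_interval T j k)"
      by (rule tendsto_mult_left)
    then show "convergent (\<lambda>q. mass q (node m (dyadic_word j k) \<omega>))"
      using \<open>0 < c\<close> by (auto simp: convergent_def)
  qed
qed

text \<open>Convergence is a property of the law, so one tree on the original space decides it for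
  the canonical one. Measurability of the event comes from the Cauchy criterion.\<close>

lemma AE_tree_convergent: "AE w in tree. convergent (\<lambda>n. mass n w)"
proof -
  have "{w \<in> space tree. convergent (\<lambda>n. mass n w)} \<in> sets tree"
    unfolding Cauchy_convergent_iff[symmetric] by measurable
  then have "(AE w in distr M tree (node 0 [False]). convergent (\<lambda>n. mass n w)) \<longleftrightarrow>
      (AE \<omega> in M. convergent (\<lambda>n. mass n (node 0 [False] \<omega>)))"
    by (intro AE_distr_iff measurable_node) auto
  moreover have "AE \<omega> in M. convergent (\<lambda>n. mass n (node 0 [False] \<omega>))"
    using AE_convergent_mass_node
  proof eventually_elim
    case (elim \<omega>)
    have "dyadic_word 1 0 = [False]"
      by (simp add: dyadic_word_def)
    then show ?case
      using elim[rule_format, of 1 0 0] by simp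
  qed
  ultimately show ?thesis
    by (simp only: distr_node[OF not_Cons_self2])
qed

end

section \<open>Counting intervals\<close>

lemma eventually_const_powr_le:
  fixes c a \<delta> :: real
  assumes "0 < \<delta>"
  shows "\<forall>\<^sub>F j in sequentially. c * 2 powr (a * real j) \<le> 2 powr ((a + \<delta>) * real j)"
proof -
  have "(\<lambda>j. c * (2 powr (- \<delta>)) ^ j) \<longlonglongrightarrow> c * 0"
    using assms by (intro tendsto_intros LIMSEQ_realpow_zero) (auto simp: powr_less_one)
  then have "\<forall>\<^sub>F j in sequentially. c * (2 powr (- \<delta>)) ^ j < 1"
    by (rule order_tendstoD) simp
  then show ?thesis
  proof eventually_elim
    case (elim j)
    have "c * 2 powr (a * real j) = (c * (2 powr (- \<delta>)) ^ j) * 2 powr ((a + \<delta>) * real j)"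
      by (simp add: powr_realpow[symmetric] powr_powr mult.assoc distrib_right flip: powr_add)
    also have "\<dots> \<le> 1 * 2 powr ((a + \<delta>) * real j)"
      using elim by (intro mult_right_mono) auto
    finally show ?case
      by simp
  qed
qed

text \<open>The count is read off from the growth of the sums of \<open>v powr q\<close> for \<open>q\<close> near \<open>p\<close>: by the
  differentiability of \<open>t\<close> at \<open>p\<close>, values \<open>v\<close> away from \<open>2 powr (- j h)\<close> contribute an exponentially
  small fraction of the sum of order \<open>p\<close>.\<close>

lemma count_growth:
  fixes v :: "nat \<Rightarrow> nat \<Rightarrow> real" and NN :: "nat \<Rightarrow> nat" and t :: "real \<Rightarrow> real"
  assumes pos: "\<And>j k. 0 < j \<Longrightarrow> k < NN j \<Longrightarrow> 0 < v j k"
    and upper: "\<And>q \<delta>. q \<in> Q \<Longrightarrow> 0 < \<delta> \<Longrightarrow>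
      \<forall>\<^sub>F j in sequentially. (\<Sum>k<NN j. v j k powr q) \<le> 2 powr ((chi - t q + \<delta>) * real j)"
    and Q: "p \<in> Q" "\<And>n. n0 \<le> n \<Longrightarrow> p + 1 / real (Suc n) \<in> Q \<and> p - 1 / real (Suc n) \<in> Q"
    and lower: "\<And>\<delta>. 0 < \<delta> \<Longrightarrow>
      \<forall>\<^sub>F j in sequentially. 2 powr ((chi - t p - \<delta>) * real j) \<le> (\<Sum>k<NN j. v j k powr p)"
    and der: "(t has_real_derivative h) (at p)" and \<epsilon>: "0 < \<epsilon>"
  defines "C \<equiv> \<lambda>j. card {k \<in> {0..<NN j}. 2 powr (- (real j * (h + \<epsilon>))) \<le> v j k \<and> v j k \<le> 2 powr (- (real j * (h - \<epsilon>)))}"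
    and "L \<equiv> chi + (p * h - t p)"
  shows "\<forall>\<^sub>F j in sequentially. real (C j) \<le> 2 powr ((L + (\<bar>p\<bar> + 1) * \<epsilon>) * real j)"
    and "\<forall>\<^sub>F j in sequentially. 2 powr ((L - (\<bar>p\<bar> + 1) * \<epsilon>) * real j) \<le> real (C j)"
proof -
  \<comment> \<open>The local exponent: \<open>v j k = 2 powr (- j * y j k)\<close>.\<close>
  define y where "y j k = - log 2 (v j k) / real j" for j k
  define good where "good j = {k \<in> {0..<NN j}. \<bar>y j k - h\<bar> \<le> \<epsilon>}" for j
  have v: "v j k = 2 powr (- (real j * y j k))" if "0 < j" "k < NN j" for j k
    using pos[OF that] that by (simp add: y_def)
  have vp: "v j k powr q = 2 powr (- (real j * y j k * q))" if "0 < j" "k < NN j" for j k q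
    by (simp add: v[OF that] powr_powr)
  have C: "C j = card (good j)" if "0 < j" for j
    unfolding C_def good_def
  proof (intro arg_cong[where f = card] Collect_cong conj_cong refl)
    fix k
    assume "k \<in> {0..<NN j}"
    then have "v j k = 2 powr (- (real j * y j k))"
      using v[OF that] by simp
    then show "(2 powr (- (real j * (h + \<epsilon>))) \<le> v j k \<and> v j k \<le> 2 powr (- (real j * (h - \<epsilon>)))) \<longleftrightarrow>
        \<bar>y j k - h\<bar> \<le> \<epsilon>"
      using that by (simp add: abs_le_iff) linarith
  qed
  have fin: "finite (good j)" and sub: "good j \<subseteq> {..<NN j}" for j
    by (auto simp: good_def)
  have yp: "\<bar>y j k * p - p * h\<bar> \<le> \<bar>p\<bar> * \<epsilon>" if "k \<in> good j" for j k
  proof -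
    have "\<bar>y j k * p - p * h\<bar> = \<bar>p\<bar> * \<bar>y j k - h\<bar>"
      by (simp add: algebra_simps flip: abs_mult)
    also have "\<dots> \<le> \<bar>p\<bar> * \<epsilon>"
      using that by (intro mult_left_mono) (auto simp: good_def)
    finally show ?thesis .
  qed
  show "\<forall>\<^sub>F j in sequentially. real (C j) \<le> 2 powr ((L + (\<bar>p\<bar> + 1) * \<epsilon>) * real j)"
    using upper[OF Q(1) \<epsilon>] eventually_gt_at_top[of 0]
  proof eventually_elim
    case (elim j)
    \<comment> \<open>A lower bound for the power of order p on every counted interval; the modulus
      of p makes it valid for either sign of p.\<close>
    define b where "b = 2 powr (- (real j * (p * h + \<bar>p\<bar> * \<epsilon>)))"
    have "real (C j) * b = (\<Sum>k\<in>good j. b)"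
      using elim by (simp add: C)
    also have "\<dots> \<le> (\<Sum>k\<in>good j. v j k powr p)"
    proof (rule sum_mono)
      fix k
      assume k: "k \<in> good j"
      then have "v j k powr p = 2 powr (- (real j * (y j k * p)))"
        using sub elim vp[of j k p] by (auto simp: mult.assoc)
      moreover have "real j * (y j k * p) \<le> real j * (p * h + \<bar>p\<bar> * \<epsilon>)"
        using yp[OF k] by (intro mult_left_mono) auto
      ultimately show "b \<le> v j k powr p"
        by (simp add: b_def)
    qed
    also have "\<dots> \<le> (\<Sum>k<NN j. v j k powr p)"
      by (intro sum_mono2 sub) auto
    also have "\<dots> \<le> 2 powr ((chi - t p + \<epsilon>) * real j)"
      by (rule elim)
    finally have "real (C j) \<le> 2 powr ((chi - t p + \<epsilon>) * real j) / b"
      by (simp add: pos_le_divide_eq b_def)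
    also have "\<dots> = 2 powr ((L + (\<bar>p\<bar> + 1) * \<epsilon>) * real j)"
      by (simp add: b_def L_def powr_diff[symmetric] algebra_simps)
    finally show ?case .
  qed
  obtain d where d: "0 < d" "\<And>s. s \<noteq> 0 \<Longrightarrow> \<bar>s\<bar> < d \<Longrightarrow> \<bar>(t (p + s) - t p) / s - h\<bar> < \<epsilon> / 2"
  proof -
    have "((\<lambda>s. (t (p + s) - t p) / s) \<longlongrightarrow> h) (at 0)"
      using der by (simp add: DERIV_def)
    then have "\<forall>\<^sub>F s in at 0. dist ((t (p + s) - t p) / s) h < \<epsilon> / 2"
      by (rule tendstoD) (use \<epsilon> in simp)
    then show ?thesis
      using that by (auto simp: eventually_at dist_real_def)
  qed
  obtain n where n: "n0 \<le> n" "1 / real (Suc n) < d"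
  proof -
    obtain n1 where "1 / real (Suc n1) < d"
      using reals_Archimedean[OF d(1)] by (auto simp: inverse_eq_divide)
    moreover have "1 / real (Suc (max n0 n1)) \<le> 1 / real (Suc n1)"
      by (intro divide_left_mono) auto
    ultimately show ?thesis
      using that[of "max n0 n1"] by simp
  qed
  \<comment> \<open>A reciprocal of an integer, so that the shifted orders belong to the set
    \<open>Q\<close>, which is countable in the application.\<close>
  define \<eta> where "\<eta> = 1 / real (Suc n)"
  have \<eta>: "0 < \<eta>" "\<eta> \<le> 1" "\<eta> < d" "p + \<eta> \<in> Q" "p - \<eta> \<in> Q"
    using n Q(2)[OF n(1)] by (auto simp: \<eta>_def)
  have t: "t p + s * h - \<eta> * \<epsilon> / 2 \<le> t (p + s)" if "\<bar>s\<bar> = \<eta>" for s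
  proof -
    have "s \<noteq> 0"
      using that \<eta> by auto
    then have "t (p + s) - t p - s * h = s * ((t (p + s) - t p) / s - h)"
      by (simp add: field_simps)
    then have "\<bar>t (p + s) - t p - s * h\<bar> = \<eta> * \<bar>(t (p + s) - t p) / s - h\<bar>"
      by (simp only: abs_mult that)
    also have "\<dots> \<le> \<eta> * (\<epsilon> / 2)"
      using that \<eta> by (intro mult_left_mono less_imp_le[OF d(2)]) auto
    finally show ?thesis
      by linarith
  qed
  \<comment> \<open>Shifting the order by \<eta> gains \<eta> \<epsilon> on the bad intervals; the
    tangent error costs half of it and the growth bound another \<delta>. As \<eta> \<epsilon> / 2 =
    4 \<delta>, a gain of 3 \<delta> remains.\<close>
  define \<delta> where "\<delta> = \<eta> * \<epsilon> / 8"
  have \<delta>: "0 < \<delta>" "\<delta> \<le> \<epsilon> / 8"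
    using \<eta> \<epsilon> by (auto simp: \<delta>_def mult_left_le_one_le)
  define a where "a = chi - t p"
  have ev1: "\<forall>\<^sub>F j in sequentially. 4 * 2 powr ((a - 3 * \<delta>) * real j) \<le> 2 powr ((a - 3 * \<delta> + 2 * \<delta>) * real j)"
    using \<delta> by (intro eventually_const_powr_le) auto
  \<comment> \<open>The exponent actually reached is L - \<bar>p\<bar> \<epsilon> - \<delta>; the
    surplus \<epsilon> - \<delta> absorbs a factor 2.\<close>
  have ev2: "\<forall>\<^sub>F j in sequentially. 2 * 2 powr ((L - (\<bar>p\<bar> + 1) * \<epsilon>) * real j) \<le>
      2 powr ((L - (\<bar>p\<bar> + 1) * \<epsilon> + (\<epsilon> - \<delta>)) * real j)"
    using \<delta> \<epsilon> by (intro eventually_const_powr_le) auto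
  show "\<forall>\<^sub>F j in sequentially. 2 powr ((L - (\<bar>p\<bar> + 1) * \<epsilon>) * real j) \<le> real (C j)"
    using ev1 ev2 upper[OF \<eta>(4) \<delta>(1)] upper[OF \<eta>(5) \<delta>(1)] lower[OF \<delta>(1)] eventually_gt_at_top[of 0]
  proof eventually_elim
    case (elim j)
    \<comment> \<open>Intervals with too large a mass, to be handled by raising the order to p +
      \<eta>; those in \<open>B2\<close> have too small a mass and are handled by lowering it to p -
      \<eta>.\<close>
    define B1 where "B1 = {k \<in> {..<NN j}. y j k < h - \<epsilon>}"
    define B2 where "B2 = {k \<in> {..<NN j}. h + \<epsilon> < y j k}"
    have bad: "(\<Sum>k\<in>B. v j k powr p) \<le> 2 powr ((a - 3 * \<delta>) * real j)"
      if s: "\<bar>s\<bar> = \<eta>" "p + s \<in> Q" and B: "B \<subseteq> {..<NN j}" "\<And>k. k \<in> B \<Longrightarrow> s * y j k \<le> s * h - \<eta> * \<epsilon>"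
        and up: "(\<Sum>k<NN j. v j k powr (p + s)) \<le> 2 powr ((chi - t (p + s) + \<delta>) * real j)" for s B
    proof -
      define e where "e = real j * (s * h - \<eta> * \<epsilon>)"
      have "(\<Sum>k\<in>B. v j k powr p) \<le> (\<Sum>k\<in>B. 2 powr e * v j k powr (p + s))"
      proof (rule sum_mono)
        fix k
        assume k: "k \<in> B"
        have "real j * (s * y j k) \<le> e"
          unfolding e_def using B(2)[OF k] by (intro mult_left_mono) auto
        then have "- (real j * y j k * p) \<le> e + - (real j * y j k * (p + s))"
          by (simp add: algebra_simps)
        then have "2 powr (- (real j * y j k * p)) \<le> 2 powr (e + - (real j * y j k * (p + s)))"
          by (intro powr_mono) auto
        moreover have "k < NN j"
          using k B(1) by auto
        ultimately show "v j k powr p \<le> 2 powr e * v j k powr (p + s)"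
          using elim(6) by (simp only: vp powr_add[of 2 e])
      qed
      also have "\<dots> = 2 powr e * (\<Sum>k\<in>B. v j k powr (p + s))"
        by (simp only: sum_distrib_left)
      also have "\<dots> \<le> 2 powr e * (\<Sum>k<NN j. v j k powr (p + s))"
        using B(1) by (intro mult_left_mono sum_mono2) auto
      also have "\<dots> \<le> 2 powr e * 2 powr ((chi - t (p + s) + \<delta>) * real j)"
        using up by (rule mult_left_mono) simp
      also have "\<dots> = 2 powr (((s * h - \<eta> * \<epsilon>) + (chi - t (p + s) + \<delta>)) * real j)"
        by (simp add: e_def algebra_simps flip: powr_add)
      also have "\<dots> \<le> 2 powr ((a - 3 * \<delta>) * real j)"
        using t[OF s(1)] by (intro powr_mono mult_right_mono) (simp_all add: a_def \<delta>_def algebra_simps)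
      finally show ?thesis .
    qed
    have bad1: "(\<Sum>k\<in>B1. v j k powr p) \<le> 2 powr ((a - 3 * \<delta>) * real j)"
    proof (rule bad[of \<eta>])
      fix k
      assume "k \<in> B1"
      then have "\<eta> * y j k \<le> \<eta> * (h - \<epsilon>)"
        using \<eta> by (intro mult_left_mono) (auto simp: B1_def)
      then show "\<eta> * y j k \<le> \<eta> * h - \<eta> * \<epsilon>"
        by (simp add: right_diff_distrib)
    qed (use \<eta> elim(3) in \<open>auto simp: B1_def\<close>)
    have bad2: "(\<Sum>k\<in>B2. v j k powr p) \<le> 2 powr ((a - 3 * \<delta>) * real j)"
    proof (rule bad[of "- \<eta>"])
      fix k
      assume "k \<in> B2"
      then have "\<eta> * (h + \<epsilon>) \<le> \<eta> * y j k"
        using \<eta> by (intro mult_left_mono) (auto simp: B2_def)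
      then show "- \<eta> * y j k \<le> - \<eta> * h - \<eta> * \<epsilon>"
        by (simp add: distrib_left)
    qed (use \<eta> elim(4) in \<open>auto simp: B2_def\<close>)
    define b where "b = 2 powr (- (real j * (p * h - \<bar>p\<bar> * \<epsilon>)))"
    have goods: "(\<Sum>k\<in>good j. v j k powr p) \<le> real (C j) * b"
    proof -
      have "(\<Sum>k\<in>good j. v j k powr p) \<le> (\<Sum>k\<in>good j. b)"
      proof (rule sum_mono)
        fix k
        assume k: "k \<in> good j"
        then have "v j k powr p = 2 powr (- (real j * (y j k * p)))"
          using sub elim vp[of j k p] by (auto simp: mult.assoc)
        moreover have "real j * (p * h - \<bar>p\<bar> * \<epsilon>) \<le> real j * (y j k * p)"
          using yp[OF k] by (intro mult_left_mono) auto
        ultimately show "v j k powr p \<le> b"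
          by (simp add: b_def)
      qed
      then show ?thesis
        using elim by (simp add: C)
    qed
    have "{..<NN j} = good j \<union> (B1 \<union> B2)"
      by (auto simp: good_def B1_def B2_def abs_le_iff)
    then have "(\<Sum>k<NN j. v j k powr p) = (\<Sum>k\<in>good j \<union> (B1 \<union> B2). v j k powr p)"
      by simp
    also have "\<dots> = (\<Sum>k\<in>good j. v j k powr p) + (\<Sum>k\<in>B1 \<union> B2. v j k powr p)"
      by (rule sum.union_disjoint) (auto simp: good_def B1_def B2_def abs_le_iff)
    also have "(\<Sum>k\<in>B1 \<union> B2. v j k powr p) = (\<Sum>k\<in>B1. v j k powr p) + (\<Sum>k\<in>B2. v j k powr p)"
      using \<epsilon> by (intro sum.union_disjoint) (auto simp: B1_def B2_def)
    finally have total: "(\<Sum>k<NN j. v j k powr p) \<le> real (C j) * b + 2 * 2 powr ((a - 3 * \<delta>) * real j)"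
      using bad1 bad2 goods by linarith
    \<comment> \<open>The two bad parts together make up at most half of the lower bound for the
      full sum, so the good part carries the other half.\<close>
    have "4 * 2 powr ((a - 3 * \<delta>) * real j) \<le> 2 powr ((a - \<delta>) * real j)"
      using elim(1) by (simp add: algebra_simps)
    with total elim(5) have "2 powr ((a - \<delta>) * real j) \<le> 2 * (real (C j) * b)"
      by (simp add: a_def)
    then have "2 powr ((a - \<delta>) * real j) / b \<le> 2 * real (C j)"
      by (simp add: pos_divide_le_eq b_def mult.assoc)
    moreover have "2 powr ((a - \<delta>) * real j) / b = 2 powr ((L - (\<bar>p\<bar> + 1) * \<epsilon> + (\<epsilon> - \<delta>)) * real j)"
      by (simp add: b_def L_def a_def powr_diff[symmetric] algebra_simps)
    ultimately show ?case
      using elim(2) by linarith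
  qed
qed

text \<open>The lower bound also makes the count eventually positive, so that the value of
  \<open>elog2\<close> at 0 does not interfere; both limits in j then lie within c \<epsilon> of
  L.\<close>

lemma liminf_limsup_elog2:
  fixes C :: "real \<Rightarrow> nat \<Rightarrow> nat" and L c :: real
  assumes upper: "\<And>\<epsilon>. 0 < \<epsilon> \<Longrightarrow> \<forall>\<^sub>F j in sequentially. real (C \<epsilon> j) \<le> 2 powr ((L + c * \<epsilon>) * real j)"
    and lower: "\<And>\<epsilon>. 0 < \<epsilon> \<Longrightarrow> \<forall>\<^sub>F j in sequentially. 2 powr ((L - c * \<epsilon>) * real j) \<le> real (C \<epsilon> j)"
  shows "((\<lambda>\<epsilon>. liminf (\<lambda>j. ereal (1 / real j) * elog2 (C \<epsilon> j))) \<longlongrightarrow> ereal L) (at_right 0) \<and>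
    ((\<lambda>\<epsilon>. limsup (\<lambda>j. ereal (1 / real j) * elog2 (C \<epsilon> j))) \<longlongrightarrow> ereal L) (at_right 0)"
proof -
  define Z where "Z \<epsilon> j = ereal (1 / real j) * elog2 (C \<epsilon> j)" for \<epsilon> j
  have Z: "\<forall>\<^sub>F j in sequentially. ereal (L - c * \<epsilon>) \<le> Z \<epsilon> j \<and> Z \<epsilon> j \<le> ereal (L + c * \<epsilon>)" if "0 < \<epsilon>" for \<epsilon>
    using upper[OF that] lower[OF that] eventually_gt_at_top[of 0]
  proof eventually_elim
    case (elim j)
    have "0 < 2 powr ((L - c * \<epsilon>) * real j)"
      by simp
    then have C: "0 < real (C \<epsilon> j)"
      using elim(2) by linarith
    then have "Z \<epsilon> j = ereal (log 2 (real (C \<epsilon> j)) / real j)"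
      by (simp add: Z_def elog2_def)
    moreover have "(L - c * \<epsilon>) * real j \<le> log 2 (real (C \<epsilon> j))"
      using elim(2) C by (simp add: le_log_iff)
    moreover have "log 2 (real (C \<epsilon> j)) \<le> (L + c * \<epsilon>) * real j"
      using elim(1) C by (simp add: log_le_iff)
    ultimately show ?case
      using elim(3) by (simp add: pos_le_divide_eq pos_divide_le_eq)
  qed
  have liminf_ge: "ereal (L - c * \<epsilon>) \<le> liminf (Z \<epsilon>)" if "0 < \<epsilon>" for \<epsilon>
    using Z[OF that] by (intro Liminf_bounded) (auto elim: eventually_mono)
  have limsup_le: "limsup (Z \<epsilon>) \<le> ereal (L + c * \<epsilon>)" if "0 < \<epsilon>" for \<epsilon>
    using Z[OF that] by (intro Limsup_bounded) (auto elim: eventually_mono)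
  have le: "liminf (Z \<epsilon>) \<le> limsup (Z \<epsilon>)" for \<epsilon>
    by (intro Liminf_le_Limsup) simp
  have lim: "((\<lambda>\<epsilon>. ereal (L - c * \<epsilon>)) \<longlongrightarrow> ereal L) (at_right 0)" "((\<lambda>\<epsilon>. ereal (L + c * \<epsilon>)) \<longlongrightarrow> ereal L) (at_right 0)"
    by (auto intro!: tendsto_eq_intros)
  have ev: "\<forall>\<^sub>F \<epsilon> in at_right (0::real). 0 < \<epsilon>"
    by (simp add: eventually_at_right_less)
  have "((\<lambda>\<epsilon>. liminf (Z \<epsilon>)) \<longlongrightarrow> ereal L) (at_right 0)"
    by (rule tendsto_sandwich[OF _ _ lim]; rule eventually_mono[OF ev])
       (use liminf_ge limsup_le le order.trans in blast)+
  moreover have "((\<lambda>\<epsilon>. limsup (Z \<epsilon>)) \<longlongrightarrow> ereal L) (at_right 0)"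
    by (rule tendsto_sandwich[OF _ _ lim]; rule eventually_mono[OF ev])
       (use liminf_ge limsup_le le order.trans in blast)+
  ultimately show ?thesis
    unfolding Z_def by blast
qed

section \<open>Growth of sums of interval masses and the spectrum\<close>

locale mixed_cascade = cascade_limit + nondegenerate_system
begin

lemma dyadic_word_nonempty: "0 < j \<Longrightarrow> dyadic_word j k \<noteq> []"
  by (metis length_dyadic_word length_0_conv less_numeral_extra(3))

lemma AE_node_pos: "AE \<omega> in M. \<forall>m r. r \<noteq> [] \<longrightarrow> 0 < lmass (node m r \<omega>)"
  unfolding AE_all_countable
proof (intro allI)
  fix m and r :: "bool list"
  show "AE \<omega> in M. r \<noteq> [] \<longrightarrow> 0 < lmass (node m r \<omega>)"
    by (cases "r = []") (auto intro: AE_node AE_lmass_pos)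
qed

lemma AE_interval_mass: "AE \<omega> in M. \<forall>m j k. 0 < j \<longrightarrow> k < 2 ^ j \<longrightarrow>
  measure (mu m \<omega>) (dyadic_interval T j k) =
    T / 2 ^ j * (path_prod (weights m \<omega>) (butlast (dyadic_word j k)) * lmass (node m (dyadic_word j k) \<omega>))"
  using AE_mass_limit AE_convergent_mass_node
proof eventually_elim
  case (elim \<omega>)
  show ?case
  proof (intro allI impI)
    fix m j k :: nat
    assume jk: "0 < j" "k < 2 ^ j"
    have "(\<lambda>q. mass q (node m (dyadic_word j k) \<omega>)) \<longlonglongrightarrow> lmass (node m (dyadic_word j k) \<omega>)"
      using elim(2) jk by (simp add: lmass_def convergent_LIMSEQ_iff)
    then have "(\<lambda>q. cell m j k \<omega> * mass q (node m (dyadic_word j k) \<omega>))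
        \<longlonglongrightarrow> cell m j k \<omega> * lmass (node m (dyadic_word j k) \<omega>)"
      by (rule tendsto_mult_left)
    moreover have "(\<lambda>q. cell m j k \<omega> * mass q (node m (dyadic_word j k) \<omega>))
        \<longlonglongrightarrow> measure (mu m \<omega>) (dyadic_interval T j k)"
      using elim(1) jk by blast
    ultimately show "measure (mu m \<omega>) (dyadic_interval T j k) =
      T / 2 ^ j * (path_prod (weights m \<omega>) (butlast (dyadic_word j k)) * lmass (node m (dyadic_word j k) \<omega>))"
      by (metis LIMSEQ_unique mult.assoc)
  qed
qed

lemma sum_path_prod_lmass:
  "(\<Sum>k<2 ^ Suc j. (path_prod (weights m \<omega>) (butlast (dyadic_word (Suc j) k)) *
      lmass (node m (dyadic_word (Suc j) k) \<omega>)) powr p) =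
    psum p j (node m [False] \<omega>) + psum p j (node m [True] \<omega>)"
proof -
  let ?f = "\<lambda>k. (path_prod (weights m \<omega>) (butlast (dyadic_word (Suc j) k)) *
      lmass (node m (dyadic_word (Suc j) k) \<omega>)) powr p"
  have half: "(\<Sum>l<2 ^ j. ?f (k * 2 ^ j + l)) = psum p j (node m (dyadic_word 1 k) \<omega>)" for k
  proof -
    have "?f (k * 2 ^ j + l) =
        path_prod (\<lambda>r. X m r \<omega> powr p) (butlast (dyadic_word (1 + j) (k * 2 ^ j + l))) *
        lmass (\<lambda>u. X m (dyadic_word (1 + j) (k * 2 ^ j + l) @ u) \<omega>) powr p" for l
      by (simp add: powr_mult path_prod_powr node_def[abs_def])
    then have "(\<Sum>l<2 ^ j. ?f (k * 2 ^ j + l)) =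
        path_prod (\<lambda>r. X m r \<omega> powr p) (butlast (dyadic_word 1 k)) * psum p j (\<lambda>u. X m (dyadic_word 1 k @ u) \<omega>)"
      unfolding psum_def
      using sum_descendants_branch[of 1 "\<lambda>x. x powr p" "\<lambda>r. X m r \<omega>" j k "\<lambda>w. lmass w powr p"] by simp
    also have "path_prod (\<lambda>r. X m r \<omega> powr p) (butlast (dyadic_word 1 k)) = 1"
      by (simp add: dyadic_word_def path_prod_def)
    finally show ?thesis
      by (simp add: node_def[abs_def])
  qed
  have "(\<Sum>k<2 ^ Suc j. ?f k) = (\<Sum>l<2 ^ j. ?f l) + (\<Sum>l<2 ^ j. ?f (2 ^ j + l))"
    using sum_lessThan_double[of ?f "2 ^ j"] by simp
  moreover have "dyadic_word 1 0 = [False]" "dyadic_word 1 1 = [True]"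
    by (simp_all add: dyadic_word_def)
  ultimately show ?thesis
    using half[of 0] half[of 1] by simp
qed

text \<open>The real-valued mass of the k-th interval under the concatenated measure; agreement with
  \<open>mu_tilde\<close> holds where dyadic points are not atoms, hence almost surely.\<close>

definition interval_mass :: "'a \<Rightarrow> nat \<Rightarrow> nat \<Rightarrow> real" where
  "interval_mass \<omega> j k = measure (mu (k div 2 ^ j) \<omega>) (dyadic_interval T j (k mod 2 ^ j))"

lemma AE_interval_mass_pos: "AE \<omega> in M. \<forall>j k. 0 < j \<longrightarrow> 0 < interval_mass \<omega> j k"
  using AE_interval_mass AE_node_pos AE_X_pos
proof eventually_elim
  case (elim \<omega>)
  show ?case
  proof (intro allI impI)
    fix j k :: nat
    assume j: "0 < j"
    have "0 < path_prod (weights (k div 2 ^ j) \<omega>) r" for r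
      using elim(3) by (intro path_prod_pos) auto
    moreover have "0 < lmass (node (k div 2 ^ j) (dyadic_word j (k mod 2 ^ j)) \<omega>)"
      using elim(2) dyadic_word_nonempty[OF j] by auto
    ultimately show "0 < interval_mass \<omega> j k"
      using elim(1) j T_pos by (simp add: interval_mass_def)
  qed
qed

lemma AE_sum_interval_mass: "AE \<omega> in M. \<forall>j p n.
  (\<Sum>k<n * 2 ^ Suc j. interval_mass \<omega> (Suc j) k powr p) =
    (T / 2 ^ Suc j) powr p * psums p j n \<omega>"
  using AE_interval_mass
proof eventually_elim
  case (elim \<omega>)
  show ?case
  proof (intro allI)
    fix j n :: nat and p :: real
    have "(\<Sum>k<n * 2 ^ Suc j. interval_mass \<omega> (Suc j) k powr p) =
        (\<Sum>m<n. \<Sum>k=m * 2 ^ Suc j..<m * 2 ^ Suc j + 2 ^ Suc j. interval_mass \<omega> (Suc j) k powr p)"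
      by (rule sum.nat_group[symmetric])
    also have "\<dots> = (\<Sum>m<n. (T / 2 ^ Suc j) powr p * (psum p j (node m [False] \<omega>) + psum p j (node m [True] \<omega>)))"
    proof (rule sum.cong)
      fix m
      have "(\<Sum>k=m * 2 ^ Suc j..<m * 2 ^ Suc j + 2 ^ Suc j. interval_mass \<omega> (Suc j) k powr p) =
          (\<Sum>k<2 ^ Suc j. interval_mass \<omega> (Suc j) (m * 2 ^ Suc j + k) powr p)"
        using sum.shift_bounds_nat_ivl[of "\<lambda>k. interval_mass \<omega> (Suc j) k powr p" 0 "m * 2 ^ Suc j" "2 ^ Suc j"]
        by (simp add: atLeast0LessThan add.commute)
      also have "\<dots> = (\<Sum>k<2 ^ Suc j. (T / 2 ^ Suc j) powr p *
          (path_prod (weights m \<omega>) (butlast (dyadic_word (Suc j) k)) * lmass (node m (dyadic_word (Suc j) k) \<omega>)) powr p)"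
      proof (rule sum.cong)
        fix k :: nat
        assume "k \<in> {..<2 ^ Suc j}"
        then have k: "k < 2 ^ Suc j"
          by simp
        then have "(m * 2 ^ Suc j + k) div 2 ^ Suc j = m" "(m * 2 ^ Suc j + k) mod 2 ^ Suc j = k"
          by (simp_all only: mult.commute[of m] mod_mult_self4 div_mult_self4 mod_less div_less)
        then have "interval_mass \<omega> (Suc j) (m * 2 ^ Suc j + k) = T / 2 ^ Suc j *
            (path_prod (weights m \<omega>) (butlast (dyadic_word (Suc j) k)) * lmass (node m (dyadic_word (Suc j) k) \<omega>))"
          using elim[rule_format, of "Suc j" k m] k by (simp only: interval_mass_def)
        then show "interval_mass \<omega> (Suc j) (m * 2 ^ Suc j + k) powr p = (T / 2 ^ Suc j) powr p *
          (path_prod (weights m \<omega>) (butlast (dyadic_word (Suc j) k)) * lmass (node m (dyadic_word (Suc j) k) \<omega>)) powr p"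
          by (simp only: powr_mult)
      qed simp
      also have "\<dots> = (T / 2 ^ Suc j) powr p * (psum p j (node m [False] \<omega>) + psum p j (node m [True] \<omega>))"
        by (simp only: sum_distrib_left[symmetric] sum_path_prod_lmass)
      finally show "(\<Sum>k=m * 2 ^ Suc j..<m * 2 ^ Suc j + 2 ^ Suc j. interval_mass \<omega> (Suc j) k powr p) =
          (T / 2 ^ Suc j) powr p * (psum p j (node m [False] \<omega>) + psum p j (node m [True] \<omega>))" .
    qed simp
    finally show "(\<Sum>k<n * 2 ^ Suc j. interval_mass \<omega> (Suc j) k powr p) =
        (T / 2 ^ Suc j) powr p * psums p j n \<omega>"
      by (simp only: sum_distrib_left)
  qed
qed

lemma N_mixed_Suc: "N_mixed chi (Suc j) = n_cascades chi j * 2 ^ Suc j"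
  by (simp add: N_mixed_def n_cascades_def)

lemma level_powr: "(T / 2 ^ Suc j) powr q = (T powr q * 2 powr (- q)) * 2 powr (- q * real j)"
proof -
  have "(T / 2 ^ Suc j) powr q = T powr q / (2 powr real (Suc j)) powr q"
    by (simp only: powr_divide powr_realpow[symmetric, OF zero_less_numeral])
  also have "\<dots> = T powr q * 2 powr (- (real (Suc j) * q))"
    by (simp only: powr_powr powr_minus divide_inverse)
  also have "- (real (Suc j) * q) = - q + - q * real j"
    by (simp add: algebra_simps)
  finally show ?thesis
    by (simp only: powr_add mult.assoc)
qed

lemma interval_mass_upper:
  assumes q: "q \<le> P"
  shows "AE \<omega> in M. \<forall>\<delta>>0. \<forall>\<^sub>F j in sequentially.
    (\<Sum>k<N_mixed chi j. interval_mass \<omega> j k powr q) \<le> 2 powr ((chi - scaling q + \<delta>) * real j)"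
proof -
  \<comment> \<open>The errors 1 / (n + 1) give countably many null sets, so that the quantifier
    over all \<delta> can stand inside the almost sure event.\<close>
  have "AE \<omega> in M. \<forall>n. \<forall>\<^sub>F j in sequentially.
    psums q j (n_cascades chi j) \<omega>
      \<le> 2 powr ((chi + q - scaling q + 1 / real (Suc n)) * real j)"
    unfolding AE_all_countable by (intro allI psum_upper q) simp
  then show ?thesis
    using AE_sum_interval_mass
  proof eventually_elim
    case (elim \<omega>)
    note sums = elim(2)
    show ?case
    proof (intro allI impI)
      fix \<delta> :: real
      assume \<delta>: "0 < \<delta>"
      obtain n where n: "1 / real (Suc n) < \<delta>"
        using reals_Archimedean[OF \<delta>] by (auto simp: inverse_eq_divide)
      define a where "a = chi - scaling q + 1 / real (Suc n)"
      define b where "b = chi - scaling q + \<delta>"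
      \<comment> \<open>Dividing by \<open>2 powr b\<close> prepares the passage from exponent b j
        to b (j + 1), as the sums are computed at level j + 1.\<close>
      define c where "c = T powr q * 2 powr (- q) / 2 powr b"
      have "\<forall>\<^sub>F j in sequentially. c * 2 powr (a * real j) \<le> 2 powr ((a + (b - a)) * real j)"
        using n by (intro eventually_const_powr_le) (simp add: a_def b_def)
      with elim(1)[rule_format, of n]
      have "\<forall>\<^sub>F j in sequentially. (\<Sum>k<N_mixed chi (Suc j). interval_mass \<omega> (Suc j) k powr q) \<le> 2 powr (b * real (Suc j))"
      proof eventually_elim
        case (elim j)
        have "(\<Sum>k<N_mixed chi (Suc j). interval_mass \<omega> (Suc j) k powr q) =
            (T / 2 ^ Suc j) powr q * psums q j (n_cascades chi j) \<omega>"
          unfolding N_mixed_Suc using sums by blast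
        also have "\<dots> \<le> (T / 2 ^ Suc j) powr q * 2 powr ((chi + q - scaling q + 1 / real (Suc n)) * real j)"
          by (intro mult_left_mono elim) simp
        also have "\<dots> = (T powr q * 2 powr (- q)) * (2 powr (- q * real j) * 2 powr ((chi + q - scaling q + 1 / real (Suc n)) * real j))"
          by (simp only: level_powr mult.assoc)
        also have "2 powr (- q * real j) * 2 powr ((chi + q - scaling q + 1 / real (Suc n)) * real j) = 2 powr (a * real j)"
          by (simp add: a_def algebra_simps flip: powr_add)
        also have "(T powr q * 2 powr (- q)) * 2 powr (a * real j) = 2 powr b * (c * 2 powr (a * real j))"
          by (simp add: c_def)
        also have "\<dots> \<le> 2 powr b * 2 powr (b * real j)"
          using elim(2) by (intro mult_left_mono) auto
        also have "\<dots> = 2 powr (b * real (Suc j))"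
          by (simp add: algebra_simps flip: powr_add)
        finally show ?case .
      qed
      then show "\<forall>\<^sub>F j in sequentially. (\<Sum>k<N_mixed chi j. interval_mass \<omega> j k powr q) \<le> 2 powr ((chi - scaling q + \<delta>) * real j)"
        unfolding b_def
        by (rule eventually_sequentially_Suc[THEN iffD1])
    qed
  qed
qed

lemma interval_mass_lower:
  assumes p: "p < P" and chi: "0 < chi" "- chi < p * deriv scaling p - scaling p"
  shows "AE \<omega> in M. \<forall>\<delta>>0. \<forall>\<^sub>F j in sequentially.
    2 powr ((chi - scaling p - \<delta>) * real j) \<le> (\<Sum>k<N_mixed chi j. interval_mass \<omega> j k powr p)"
  using npsum_lower[OF p chi] AE_sum_interval_mass
proof eventually_elim
  case (elim \<omega>)
  note sums = elim(2)
  show ?case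
  proof (intro allI impI)
    fix \<delta> :: real
    assume \<delta>: "0 < \<delta>"
    have pP: "p \<le> P"
      using p by simp
    define a where "a = chi - scaling p - \<delta>"
    \<comment> \<open>Of the 4, one factor 2 is lost to the integer part in the number of cascades,
      the other in \<open>npsum_lower\<close>, which gives half of the expected sum.\<close>
    define c where "c = T powr p * 2 powr (- p) * mass_moment p / 4"
    have c: "0 < c"
      using T_pos mass_moment_pos[OF pP] by (simp add: c_def)
    have "\<forall>\<^sub>F j in sequentially. (2 powr a / c) * 2 powr (a * real j) \<le> 2 powr ((a + \<delta>) * real j)"
      using \<delta> by (rule eventually_const_powr_le)
    with elim(1)
    have "\<forall>\<^sub>F j in sequentially. 2 powr (a * real (Suc j)) \<le> (\<Sum>k<N_mixed chi (Suc j). interval_mass \<omega> (Suc j) k powr p)"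
    proof eventually_elim
      case (elim j)
      define e where "e = (2 * moment p) ^ j * mass_moment p"
      have e: "0 \<le> e"
        using moment_pos[of p] mass_moment_pos[OF pP] by (simp add: e_def)
      have e': "e = 2 powr ((p - scaling p) * real j) * mass_moment p"
        unfolding e_def by (simp only: two_moment_eq) (simp add: powr_realpow[symmetric] powr_powr)
      have "2 powr (a * real (Suc j)) = 2 powr a * 2 powr (a * real j)"
        by (simp add: algebra_simps flip: powr_add)
      also have "\<dots> \<le> c * 2 powr ((a + \<delta>) * real j)"
        using elim(2) c by (simp add: field_simps)
      also have "\<dots> = (T powr p * 2 powr (- p)) * 2 powr (- p * real j) * (e * (2 powr (real j * chi) / 2 / 2))"
        by (simp add: c_def e' a_def algebra_simps powr_add powr_diff powr_minus divide_simps)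
      also have "\<dots> \<le> (T powr p * 2 powr (- p)) * 2 powr (- p * real j) * (e * (real (n_cascades chi j) / 2))"
        using n_cascades_ge[OF chi(1), of j] e by (intro mult_left_mono divide_right_mono) auto
      also have "\<dots> \<le> (T powr p * 2 powr (- p)) * 2 powr (- p * real j) *
          (e * (\<Sum>m<n_cascades chi j. npsum p j (node m [False] \<omega>)))"
        using elim(1) e by (intro mult_left_mono) auto
      also have "\<dots> = (T / 2 ^ Suc j) powr p * (\<Sum>m<n_cascades chi j. psum p j (node m [False] \<omega>))"
        by (simp only: level_powr psum_eq_npsum[OF pP] sum_distrib_left e_def)
      also have "\<dots> \<le> (T / 2 ^ Suc j) powr p * psums p j (n_cascades chi j) \<omega>"
        by (intro mult_left_mono sum_mono) (simp_all add: psum_nonneg)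
      also have "\<dots> = (\<Sum>k<N_mixed chi (Suc j). interval_mass \<omega> (Suc j) k powr p)"
        unfolding N_mixed_Suc using sums by simp
      finally show ?case .
    qed
    then show "\<forall>\<^sub>F j in sequentially. 2 powr ((chi - scaling p - \<delta>) * real j) \<le> (\<Sum>k<N_mixed chi j. interval_mass \<omega> j k powr p)"
      unfolding a_def by (rule eventually_sequentially_Suc[THEN iffD1])
  qed
qed

lemma AE_count_C_eq: "AE \<omega> in M. \<forall>chi h \<epsilon> j. count_C T (\<lambda>m. mu m \<omega>) chi h \<epsilon> j =
  card {k \<in> {0..<N_mixed chi j}. 2 powr (- (real j * (h + \<epsilon>))) \<le> interval_mass \<omega> j k \<and>
    interval_mass \<omega> j k \<le> 2 powr (- (real j * (h - \<epsilon>)))}"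
  using AE_no_atoms
proof eventually_elim
  case (elim \<omega>)
  have em: "emeasure (mu m \<omega>) A = ennreal (measure (mu m \<omega>) A)" for m A
    using mu[of m \<omega>] by (simp add: finite_measure.emeasure_eq_measure)
  have "mu_tilde T (\<lambda>m. mu m \<omega>) (dyadic_interval T j k) = ennreal (interval_mass \<omega> j k)" for j k
  proof -
    have "mu_tilde T (\<lambda>m. mu m \<omega>) (dyadic_interval T j ((k div 2 ^ j) * 2 ^ j + k mod 2 ^ j)) =
        emeasure (mu (k div 2 ^ j) \<omega>) (dyadic_interval T j (k mod 2 ^ j))"
    proof (rule mu_tilde_dyadic[OF T_pos])
      show "emeasure (mu m \<omega>) {0} = 0" "emeasure (mu m \<omega>) {T} = 0" for m
        using elim[rule_format, of 0 0 m] elim[rule_format, of 1 0 m] by (simp_all add: em)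
    qed (use mu in auto)
    then show ?thesis
      by (simp only: div_mult_mod_eq em interval_mass_def)
  qed
  then show ?case
    by (simp add: count_C_def interval_mass_def)
qed

lemma AE_count_C_limit:
  assumes p: "p < P" and chi: "0 < chi" "- chi < p * deriv scaling p - scaling p"
  defines "h \<equiv> deriv scaling p"
  shows "AE \<omega> in M.
     ((\<lambda>\<epsilon>. liminf (\<lambda>j. ereal (1 / real j) * elog2 (count_C T (\<lambda>m. mu m \<omega>) chi h \<epsilon> j)))
        \<longlongrightarrow> ereal (chi + (p * h - scaling p))) (at_right 0) \<and>
     ((\<lambda>\<epsilon>. limsup (\<lambda>j. ereal (1 / real j) * elog2 (count_C T (\<lambda>m. mu m \<omega>) chi h \<epsilon> j)))
        \<longlongrightarrow> ereal (chi + (p * h - scaling p))) (at_right 0)"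
proof -
  obtain n0 where n0: "1 / real (Suc n0) < P - p"
    using reals_Archimedean[of "P - p"] p by (auto simp: inverse_eq_divide)
  \<comment> \<open>The order p with a sequence approaching it from each side, started late enough
    to stay below P; being countable, it admits a common almost sure event.\<close>
  define Q where "Q = insert p ((\<lambda>n. p + 1 / real (Suc n)) ` {n0..} \<union> (\<lambda>n. p - 1 / real (Suc n)) ` {n0..})"
  have "countable Q"
    by (simp add: Q_def)
  have Q_le: "q \<le> P" if "q \<in> Q" for q
  proof -
    have "1 / real (Suc n) \<le> 1 / real (Suc n0)" if "n0 \<le> n" for n
      using that by (intro divide_left_mono) auto
    then have "p + 1 / real (Suc n) \<le> P" if "n0 \<le> n" for n
      using n0 that by (metis add.commute less_diff_eq less_imp_le order.strict_trans1)
    moreover have "p - 1 / real (Suc n) \<le> P" for n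
    proof -
      have "0 \<le> 1 / real (Suc n)"
        by simp
      with p show ?thesis
        by linarith
    qed
    ultimately show ?thesis
      using that p unfolding Q_def by auto
  qed
  have "AE \<omega> in M. \<forall>q\<in>Q. \<forall>\<delta>>0. \<forall>\<^sub>F j in sequentially.
      (\<Sum>k<N_mixed chi j. interval_mass \<omega> j k powr q) \<le> 2 powr ((chi - scaling q + \<delta>) * real j)"
    by (subst AE_ball_countable[OF \<open>countable Q\<close>]) (intro ballI interval_mass_upper Q_le)
  then show ?thesis
    using interval_mass_lower[OF p chi] AE_count_C_eq AE_interval_mass_pos
  proof eventually_elim
    case (elim \<omega>)
    note growth = count_growth[of "N_mixed chi" "interval_mass \<omega>" Q chi scaling p n0 h]
    have der: "(scaling has_real_derivative h) (at p)"
      unfolding h_def by (rule has_real_derivative_scaling)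
    have Q: "p \<in> Q" "\<And>n. n0 \<le> n \<Longrightarrow> p + 1 / real (Suc n) \<in> Q \<and> p - 1 / real (Suc n) \<in> Q"
      by (auto simp: Q_def)
    show ?case
    proof (rule liminf_limsup_elog2)
      fix \<epsilon> :: real
      assume \<epsilon>: "0 < \<epsilon>"
      show "\<forall>\<^sub>F j in sequentially. real (count_C T (\<lambda>m. mu m \<omega>) chi h \<epsilon> j) \<le>
          2 powr ((chi + (p * h - scaling p) + (\<bar>p\<bar> + 1) * \<epsilon>) * real j)"
        unfolding elim(3)[rule_format]
        by (rule growth(1)) (use elim Q der \<epsilon> in auto)
      show "\<forall>\<^sub>F j in sequentially. 2 powr ((chi + (p * h - scaling p) - (\<bar>p\<bar> + 1) * \<epsilon>) * real j) \<le>
          real (count_C T (\<lambda>m. mu m \<omega>) chi h \<epsilon> j)"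
        unfolding elim(3)[rule_format]
        by (rule growth(2)) (use elim Q der \<epsilon> in auto)
    qed
  qed
qed

end

theorem theorem3p4:
  fixes M :: "'a measure" and W :: "'a \<Rightarrow> real"
    and X :: "nat \<Rightarrow> bool list \<Rightarrow> 'a \<Rightarrow> real"
    and mu :: "nat \<Rightarrow> 'a \<Rightarrow> real measure"
    and T chi h :: real
  assumes "prob_space M"
    and "standing_assumptions M W"
    and "T > 0" and "chi > 0"
    and "prob_space.indep_vars M (\<lambda>_. borel) (\<lambda>(m, r). X m r) {(m, r). r \<noteq> []}"
    and "\<And>m r. r \<noteq> [] \<Longrightarrow> distr M borel (X m r) = distr M borel W"
    and "\<And>m \<omega>. sets (mu m \<omega>) = sets borel \<and> finite_measure (mu m \<omega>)"
    and "AE \<omega> in M. \<forall>m. weak_conv_fin (cascade_approx T (\<lambda>r. X m r \<omega>)) (mu m \<omega>)"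
    and "p_plus M W chi < \<infinity>" and "p_minus M W chi > - \<infinity>"
    and "tau M W (real_of_ereal (p_plus M W chi)) > 0"
    and "deriv (tau M W) (real_of_ereal (p_plus M W chi)) < h"
    and "h < deriv (tau M W) (real_of_ereal (p_minus M W chi))"
  shows "AE \<omega> in M.
     ((\<lambda>\<epsilon>. liminf (\<lambda>j. ereal (1 / real j) * elog2 (count_C T (\<lambda>m. mu m \<omega>) chi h \<epsilon> j)))
        \<longlongrightarrow> ereal chi + Dspec M W h) (at_right 0) \<and>
     ((\<lambda>\<epsilon>. limsup (\<lambda>j. ereal (1 / real j) * elog2 (count_C T (\<lambda>m. mu m \<omega>) chi h \<epsilon> j)))
        \<longlongrightarrow> ereal chi + Dspec M W h) (at_right 0)"
proof -
  interpret M: prob_space M by fact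
  define \<nu> where "\<nu> = distr M borel W"
  have W [measurable]: "W \<in> borel_measurable M"
    using assms(2) by (simp add: standing_assumptions_def)
  have tau_eq: "tau M W = tau \<nu> (\<lambda>x. x)"
    by (rule ext) (simp add: tau_def \<nu>_def integral_distr)
  have Dspec_M: "Dspec M W = Dspec \<nu> (\<lambda>x. x)" and p_plus_M: "p_plus M W = p_plus \<nu> (\<lambda>x. x)"
    and p_minus_M: "p_minus M W = p_minus \<nu> (\<lambda>x. x)"
    by (simp_all add: Dspec_def p_plus_def p_minus_def tau_eq fun_eq_iff)
  interpret weight: cascade_weight \<nu>
  proof (intro cascade_weight.intro cascade_weight_axioms.intro)
    show "prob_space \<nu>"
      unfolding \<nu>_def by (rule M.prob_space_distr[OF W])
    show "sets \<nu> = sets borel"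
      by (simp add: \<nu>_def)
    have "AE \<omega> in M. 0 < W \<omega>"
      using assms(2) M.AE_prob_1[of "{\<omega> \<in> space M. W \<omega> > 0}"]
      by (auto simp: standing_assumptions_def elim: eventually_mono)
    then show "AE x in \<nu>. 0 < x"
      unfolding \<nu>_def by (subst AE_distr_iff) auto
    show "(\<integral>x. x \<partial>\<nu>) = 1"
      using assms(2) by (simp add: \<nu>_def integral_distr standing_assumptions_def)
    show "integrable \<nu> (\<lambda>x. x powr p)" for p
      using assms(2) by (simp add: \<nu>_def integrable_distr_eq standing_assumptions_def)
  qed
  interpret limit: cascade_limit \<nu> M X T mu
    by unfold_locales (use assms(3,5-8) in \<open>auto simp: \<nu>_def\<close>)
  obtain P p where P: "1 < P" "0 < weight.scaling P" "p < P" "deriv weight.scaling p = h"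
      "- chi < p * h - weight.scaling p"
    using weight.saddle_point[of chi h] assms(4,9-13) unfolding tau_eq p_plus_M p_minus_M by blast
  \<comment> \<open>The limit mass becomes available only here: the almost sure convergence which
    its locale assumes has been derived from the weak limit in the preceding interpretation.\<close>
  interpret mixed: mixed_cascade \<nu> M X T mu P
    by unfold_locales (use P limit.AE_tree_convergent in auto)
  have "ereal chi + Dspec M W h = ereal (chi + (p * h - weight.scaling p))"
    unfolding Dspec_M using weight.Dspec_eq[OF P(4)] by simp
  then show ?thesis
    using mixed.AE_count_C_limit[of p chi] P assms(4) by simp
qed

end
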